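(* Let $\mu$ be a finite positive Reinhardt Borel measure supported on the unit sphere $\partial\mathbb B_d$ of $\mathbb C^d$, with $\|z^\alpha\|_{L^2(\partial\mathbb B_d,\mu)}>0$ for all $\alpha\in\mathbb N^d$, and let $\mathcal H^2(\mu)$ be the closure of polynomials in $L^2(\partial\mathbb B_d,\mu)$. Suppose that $\mathscr M_z$ is bounded on $\mathcal H^2(\mu)$. Then the following statements are equivalent: (i) $\mathscr M_z$ (on $\mathcal H^2(\mu)$) is weakly $\mathcal U(d)$-homogeneous. (ii) There exist positive constants $k$ and $K$ such that for all $u\in\mathcal U(d)$, $$k\leqslant\frac{d\mu\circ u^{-1}}{d\mu}(z)\leqslant K\quad\text{for }\mu\text{-almost every }z\in\partial\mathbb B_d.$$ (iii) $\mathscr M_z$ (on $\mathcal H^2(\mu)$) is similar to the Szegő shift.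
   Context: $\mathbb N$ is the set of non-negative integers, $\mathbb B_d$ the open unit ball of $\mathbb C^d$. A measure $\mu$ on $\partial\mathbb B_d$ is Reinhardt if it is invariant under the torus action $z\mapsto(t_1z_1,\ldots,t_dz_d)$, $t\in\mathbb T^d$; then monomials are mutually orthogonal in $\mathcal H^2(\mu)$. $\mathscr M_z=(\mathscr M_{z_1},\ldots,\mathscr M_{z_d})$ with $\mathscr M_{z_j}f=z_jf$. $\mathcal U(d)$ is the group of $d\times d$ complex unitary matrices, acting on $\mathbb C^d$ by matrix multiplication. $\mu\circ u^{-1}$ is the measure $\Delta\mapsto\mu(u^{-1}\Delta)$ on Borel subsets of $\partial\mathbb B_d$, and $\frac{d\mu\circ u^{-1}}{d\mu}$ is its Radon–Nikodym derivative with respect to $\mu$ (statement (ii) includes that $\mu\circ u^{-1}$ is absolutely continuous with respect to $\mu$). The Szegő shift is $\mathscr M_z$ on $\mathcal H^2(\sigma)$, where $\sigma$ is the normalized surface area measure on $\partial\mathbb B_d$ (the unique $\mathcal U(d)$-invariant Borel probability measure). For $u=(u_{jk})$ and a $d$-tuple $T$ of operators, $(u\cdot T)_j=\sum_{k=1}^d u_{jk}T_k$. A commuting $d$-tuple $T$ of bounded operators on a complex separable Hilbert space $\mathcal H$ is weakly $\mathcal U(d)$-homogeneous if for every $u\in\mathcal U(d)$ there is a bounded invertible operator $\Gamma(u)$ on $\mathcal H$ with $\Gamma(u)T_j=(u\cdot T)_j\Gamma(u)$ for all $j$. Tuples $T$ on $\mathcal H$ and $T'$ on $\mathcal H'$ are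 similar if there is a bounded invertible $S:\mathcal H\to\mathcal H'$ with $ST_j=T'_jS$ for all $j$. *)

theory Defs
  imports "HOL-Algebra.Module" "HOL-Probability.Probability_Measure"
begin

section \<open>Complex inner product spaces with explicit carrier\<close>

text \<open>The space $H^2(\mu)$ depends on the measure, so it cannot be a type.  We extend the module
  record of HOL-Algebra, whose ring fields \<open>mult\<close> and \<open>one\<close> play no role (as always for modules).
  The inner product is linear in its first argument.  Operators are functions on the underlying
  type, of which only the restriction to the carrier matters.\<close>

record 'h cspace = "(complex, 'h) module" +
  cinner :: "'h \<Rightarrow> 'h \<Rightarrow> complex"

definition complex_ring :: "complex ring" where
  "complex_ring = \<lparr>carrier = UNIV, monoid.mult = (*), one = 1, zero = 0, add = (+)\<rparr>"

definition cnorm :: "('h, 'm) cspace_scheme \<Rightarrow> 'h \<Rightarrow> real" where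
  "cnorm H x = sqrt (Re (cinner H x x))"

definition cclosure :: "('h, 'm) cspace_scheme \<Rightarrow> 'h set \<Rightarrow> 'h set" where
  "cclosure H S = {x \<in> carrier H. \<forall>e>0. \<exists>y\<in>S. cnorm H (x \<ominus>\<^bsub>H\<^esub> y) < e}"

definition bounded_operator ::
    "('g, 'm) cspace_scheme \<Rightarrow> ('h, 'n) cspace_scheme \<Rightarrow> ('g \<Rightarrow> 'h) \<Rightarrow> bool" where
  "bounded_operator G H T \<longleftrightarrow>
     T \<in> carrier G \<rightarrow> carrier H \<and>
     (\<forall>x\<in>carrier G. \<forall>y\<in>carrier G. T (x \<oplus>\<^bsub>G\<^esub> y) = T x \<oplus>\<^bsub>H\<^esub> T y) \<and>
     (\<forall>c. \<forall>x\<in>carrier G. T (c \<odot>\<^bsub>G\<^esub> x) = c \<odot>\<^bsub>H\<^esub> T x) \<and>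
     (\<exists>C. \<forall>x\<in>carrier G. cnorm H (T x) \<le> C * cnorm G x)"

definition bounded_invertible_operator ::
    "('g, 'm) cspace_scheme \<Rightarrow> ('h, 'n) cspace_scheme \<Rightarrow> ('g \<Rightarrow> 'h) \<Rightarrow> bool" where
  "bounded_invertible_operator G H S \<longleftrightarrow>
     bounded_operator G H S \<and>
     (\<exists>R. bounded_operator H G R \<and> (\<forall>x\<in>carrier G. R (S x) = x) \<and> (\<forall>y\<in>carrier H. S (R y) = y))"


section \<open>Tuples of operators\<close>

text \<open>A $d$-tuple is indexed by a finite type \<open>'d\<close> with $d$ elements.\<close>

definition commuting_bounded_tuple ::
    "('h, 'm) cspace_scheme \<Rightarrow> ('d \<Rightarrow> 'h \<Rightarrow> 'h) \<Rightarrow> bool" where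
  "commuting_bounded_tuple H T \<longleftrightarrow>
     (\<forall>j. bounded_operator H H (T j)) \<and>
     (\<forall>i j. \<forall>x\<in>carrier H. T i (T j x) = T j (T i x))"

definition unitary_matrix :: "complex^'d^'d \<Rightarrow> bool" where
  "unitary_matrix u \<longleftrightarrow>
     (\<chi> i j. cnj (u $ j $ i)) ** u = mat 1 \<and> u ** (\<chi> i j. cnj (u $ j $ i)) = mat 1"

definition matrix_act_tuple ::
    "('h, 'm) cspace_scheme \<Rightarrow> complex^'d^'d \<Rightarrow> ('d \<Rightarrow> 'h \<Rightarrow> 'h) \<Rightarrow> 'd \<Rightarrow> 'h \<Rightarrow> 'h" where
  "matrix_act_tuple H u T j x = (\<Oplus>\<^bsub>H\<^esub>k\<in>UNIV. (u $ j $ k) \<odot>\<^bsub>H\<^esub> T k x)"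

definition weakly_unitarily_homogeneous ::
    "('h, 'm) cspace_scheme \<Rightarrow> ('d::finite \<Rightarrow> 'h \<Rightarrow> 'h) \<Rightarrow> bool" where
  "weakly_unitarily_homogeneous H T \<longleftrightarrow>
     commuting_bounded_tuple H T \<and>
     (\<forall>u :: complex^'d^'d. unitary_matrix u \<longrightarrow>
        (\<exists>\<Gamma>. bounded_invertible_operator H H \<Gamma> \<and>
             (\<forall>j. \<forall>x\<in>carrier H. \<Gamma> (T j x) = matrix_act_tuple H u T j (\<Gamma> x))))"

definition similar_tuples ::
    "('g, 'm) cspace_scheme \<Rightarrow> ('d \<Rightarrow> 'g \<Rightarrow> 'g) \<Rightarrow>
     ('h, 'n) cspace_scheme \<Rightarrow> ('d \<Rightarrow> 'h \<Rightarrow> 'h) \<Rightarrow> bool" where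
  "similar_tuples G T H T' \<longleftrightarrow>
     (\<exists>S. bounded_invertible_operator G H S \<and> (\<forall>j. \<forall>x\<in>carrier G. S (T j x) = T' j (S x)))"


section \<open>The space $L^2$ of a measure\<close>

definition square_integrable :: "'a measure \<Rightarrow> ('a \<Rightarrow> complex) \<Rightarrow> bool" where
  "square_integrable M f \<longleftrightarrow> f \<in> borel_measurable M \<and> integrable M (\<lambda>z. (cmod (f z))\<^sup>2)"

definition ae_class :: "'a measure \<Rightarrow> ('a \<Rightarrow> complex) \<Rightarrow> ('a \<Rightarrow> complex) set" where
  "ae_class M f = {g \<in> borel_measurable M. AE z in M. g z = f z}"

text \<open>Elements of $L^2$ are classes of functions modulo almost everywhere equality; the operations
  are defined through representatives.  The results below show that they do not depend on the
  choice.\<close>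

definition L2_space :: "'a measure \<Rightarrow> ('a \<Rightarrow> complex) set cspace" where
  "L2_space M =
     \<lparr>carrier = ae_class M ` Collect (square_integrable M),
      monoid.mult = undefined, one = undefined,
      zero = ae_class M (\<lambda>_. 0),
      add = (\<lambda>F G. \<Union>f\<in>F. \<Union>g\<in>G. ae_class M (\<lambda>z. f z + g z)),
      module.smult = (\<lambda>c F. \<Union>f\<in>F. ae_class M (\<lambda>z. c * f z)),
      cinner = (\<lambda>F G. THE c. \<exists>f\<in>F. \<exists>g\<in>G. c = (LINT z|M. f z * cnj (g z)))\<rparr>"

lemma AE_iff_cong:
  assumes "AE z in M. f z = g z"
  shows "(AE z in M. h z = f z) \<longleftrightarrow> (AE z in M. h z = g z)"
  using assms by (auto elim: AE_mp)

lemma ae_class_eq_iff: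
  assumes "f \<in> borel_measurable M"
  shows "ae_class M f = ae_class M g \<longleftrightarrow> (AE z in M. f z = g z)"
proof
  assume "ae_class M f = ae_class M g"
  moreover have "f \<in> ae_class M f" using assms by (simp add: ae_class_def)
  ultimately show "AE z in M. f z = g z" by (auto simp: ae_class_def)
next
  assume *: "AE z in M. f z = g z"
  have "(AE z in M. h z = f z) \<longleftrightarrow> (AE z in M. h z = g z)" for h
    using * by (rule AE_iff_cong)
  then show "ae_class M f = ae_class M g" by (auto simp: ae_class_def)
qed

lemma ae_class_self: "f \<in> borel_measurable M \<Longrightarrow> f \<in> ae_class M f"
  by (simp add: ae_class_def)

lemma ae_class_cong: "AE z in M. f z = g z \<Longrightarrow> ae_class M f = ae_class M g"
  unfolding ae_class_def using AE_iff_cong[of f g M] by blast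

lemma UN_const_eq: "x \<in> A \<Longrightarrow> (\<And>y. y \<in> A \<Longrightarrow> C y = X) \<Longrightarrow> (\<Union>y\<in>A. C y) = X"
  by blast

lemma L2_add:
  assumes [measurable]: "f \<in> borel_measurable M" "g \<in> borel_measurable M"
  shows "ae_class M f \<oplus>\<^bsub>L2_space M\<^esub> ae_class M g = ae_class M (\<lambda>z. f z + g z)"
proof -
  have "ae_class M (\<lambda>z. f' z + g' z) = ae_class M (\<lambda>z. f z + g z)"
    if "f' \<in> ae_class M f" "g' \<in> ae_class M g" for f' g'
  proof (rule ae_class_cong)
    show "AE z in M. f' z + g' z = f z + g z"
      using that unfolding ae_class_def by fastforce
  qed
  then have "(\<Union>f'\<in>ae_class M f. \<Union>g'\<in>ae_class M g. ae_class M (\<lambda>z. f' z + g' z)) =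
      ae_class M (\<lambda>z. f z + g z)"
    using assms by (intro UN_const_eq[where x = f] UN_const_eq[where x = g] ae_class_self)
  then show ?thesis by (simp add: L2_space_def)
qed

lemma L2_smult:
  assumes "f \<in> borel_measurable M"
  shows "c \<odot>\<^bsub>L2_space M\<^esub> ae_class M f = ae_class M (\<lambda>z. c * f z)"
proof -
  have "ae_class M (\<lambda>z. c * f' z) = ae_class M (\<lambda>z. c * f z)" if "f' \<in> ae_class M f" for f'
  proof (rule ae_class_cong)
    show "AE z in M. c * f' z = c * f z"
      using that unfolding ae_class_def by fastforce
  qed
  then have "(\<Union>f'\<in>ae_class M f. ae_class M (\<lambda>z. c * f' z)) = ae_class M (\<lambda>z. c * f z)"
    using assms by (intro UN_const_eq[where x = f] ae_class_self)
  then show ?thesis by (simp add: L2_space_def)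
qed

lemma L2_cinner:
  assumes [measurable]: "f \<in> borel_measurable M" "g \<in> borel_measurable M"
  shows "cinner (L2_space M) (ae_class M f) (ae_class M g) = (LINT z|M. f z * cnj (g z))"
proof -
  have cnj [measurable]: "(\<lambda>z. cnj (h z)) \<in> borel_measurable M"
    if [measurable]: "h \<in> borel_measurable M" for h
    by (rule borel_measurable_continuous_on[where f = cnj]) (auto intro: continuous_intros)
  have eq: "(LINT z|M. f' z * cnj (g' z)) = (LINT z|M. f z * cnj (g z))"
    if "f' \<in> ae_class M f" "g' \<in> ae_class M g" for f' g'
  proof (rule integral_cong_AE)
    have [measurable]: "f' \<in> borel_measurable M" "g' \<in> borel_measurable M"
      using that by (auto simp: ae_class_def)
    show "(\<lambda>z. f' z * cnj (g' z)) \<in> borel_measurable M"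
      and "(\<lambda>z. f z * cnj (g z)) \<in> borel_measurable M" by measurable
    show "AE z in M. f' z * cnj (g' z) = f z * cnj (g z)"
      using that unfolding ae_class_def by fastforce
  qed
  have "(THE c. \<exists>f'\<in>ae_class M f. \<exists>g'\<in>ae_class M g. c = (LINT z|M. f' z * cnj (g' z))) =
      (LINT z|M. f z * cnj (g z))"
    by (rule the_equality) (use assms[THEN ae_class_self] eq in blast)+
  then show ?thesis by (simp add: L2_space_def)
qed

lemma square_integrable_add:
  assumes "square_integrable M f" "square_integrable M g"
  shows "square_integrable M (\<lambda>z. f z + g z)"
proof -
  have [measurable]: "f \<in> borel_measurable M" "g \<in> borel_measurable M"
    and int: "integrable M (\<lambda>z. 2 * (cmod (f z))\<^sup>2 + 2 * (cmod (g z))\<^sup>2)"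
    using assms by (auto simp: square_integrable_def)
  have "(cmod (a + b))\<^sup>2 \<le> 2 * (cmod a)\<^sup>2 + 2 * (cmod b)\<^sup>2" for a b
  proof -
    have "(cmod (a + b))\<^sup>2 \<le> (cmod a + cmod b)\<^sup>2"
      by (intro power_mono norm_triangle_ineq) auto
    also have "\<dots> \<le> 2 * (cmod a)\<^sup>2 + 2 * (cmod b)\<^sup>2"
      using sum_squares_bound[of "cmod a" "cmod b"] by (simp add: power2_sum)
    finally show ?thesis .
  qed
  then have "integrable M (\<lambda>z. (cmod (f z + g z))\<^sup>2)"
    by (intro Bochner_Integration.integrable_bound[OF int]) auto
  then show ?thesis by (simp add: square_integrable_def)
qed

lemma square_integrable_cmult:
  "square_integrable M f \<Longrightarrow> square_integrable M (\<lambda>z. c * f z)"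
  by (auto simp: square_integrable_def norm_mult power_mult_distrib)

lemma square_integrable_measurable: "square_integrable M f \<Longrightarrow> f \<in> borel_measurable M"
  by (simp add: square_integrable_def)

lemma carrier_L2: "carrier (L2_space M) = ae_class M ` Collect (square_integrable M)"
  by (simp add: L2_space_def)

lemma zero_L2: "\<zero>\<^bsub>L2_space M\<^esub> = ae_class M (\<lambda>_. 0)"
  by (simp add: L2_space_def)


lemma L2_carrierE: assumes "x \<in> carrier (L2_space M)"
  obtains f where "square_integrable M f" "f \<in> borel_measurable M" "x = ae_class M f"
  using assms square_integrable_measurable by (auto simp: carrier_L2)

lemma L2_carrierI: "square_integrable M f \<Longrightarrow> ae_class M f \<in> carrier (L2_space M)"
  by (simp add: carrier_L2)

lemma abelian_group_L2: "abelian_group (L2_space M)"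
proof (rule abelian_groupI)
  fix x y z assume *: "x \<in> carrier (L2_space M)" "y \<in> carrier (L2_space M)"
  from *(1) obtain f where f: "square_integrable M f" "f \<in> borel_measurable M" "x = ae_class M f"
    by (rule L2_carrierE)
  from *(2) obtain g where g: "square_integrable M g" "g \<in> borel_measurable M" "y = ae_class M g"
    by (rule L2_carrierE)
  show "x \<oplus>\<^bsub>L2_space M\<^esub> y \<in> carrier (L2_space M)"
    using f g by (simp add: L2_add L2_carrierI square_integrable_add)
  show "x \<oplus>\<^bsub>L2_space M\<^esub> y = y \<oplus>\<^bsub>L2_space M\<^esub> x"
    using f g by (simp add: L2_add add.commute)
  assume "z \<in> carrier (L2_space M)"
  then obtain h where h: "square_integrable M h" "h \<in> borel_measurable M" "z = ae_class M h"
    by (rule L2_carrierE)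
  show "x \<oplus>\<^bsub>L2_space M\<^esub> y \<oplus>\<^bsub>L2_space M\<^esub> z =
        x \<oplus>\<^bsub>L2_space M\<^esub> (y \<oplus>\<^bsub>L2_space M\<^esub> z)"
    using f g h by (simp add: L2_add add.assoc)
next
  show "\<zero>\<^bsub>L2_space M\<^esub> \<in> carrier (L2_space M)"
    unfolding zero_L2 by (rule L2_carrierI) (simp add: square_integrable_def)
next
  fix x assume "x \<in> carrier (L2_space M)"
  then obtain f where f: "square_integrable M f" "f \<in> borel_measurable M" "x = ae_class M f"
    by (rule L2_carrierE)
  show "\<zero>\<^bsub>L2_space M\<^esub> \<oplus>\<^bsub>L2_space M\<^esub> x = x"
    using f by (simp add: zero_L2 L2_add)
  show "\<exists>y\<in>carrier (L2_space M). y \<oplus>\<^bsub>L2_space M\<^esub> x = \<zero>\<^bsub>L2_space M\<^esub>"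
  proof
    show "ae_class M (\<lambda>z. -1 * f z) \<in> carrier (L2_space M)"
      by (intro L2_carrierI square_integrable_cmult f)
    show "ae_class M (\<lambda>z. -1 * f z) \<oplus>\<^bsub>L2_space M\<^esub> x = \<zero>\<^bsub>L2_space M\<^esub>"
      using f by (simp add: zero_L2 L2_add)
  qed
qed

lemma cring_complex_ring: "cring complex_ring"
proof (rule cringI)
  show "abelian_group complex_ring"
    by (rule abelian_groupI)
       (auto simp: complex_ring_def add.assoc add.commute intro: exI[of _ "- x" for x])
  show "Group.comm_monoid complex_ring"
    by (rule comm_monoidI) (auto simp: complex_ring_def)
qed (auto simp: complex_ring_def distrib_right)

lemma module_L2: "Module.module complex_ring (L2_space M)"
proof (rule moduleI[OF cring_complex_ring abelian_group_L2])
  fix a b x y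
  assume x: "x \<in> carrier (L2_space M)"
  from x obtain f where f: "square_integrable M f" "f \<in> borel_measurable M" "x = ae_class M f"
    by (rule L2_carrierE)
  show "a \<odot>\<^bsub>L2_space M\<^esub> x \<in> carrier (L2_space M)"
    using f by (simp add: L2_smult L2_carrierI square_integrable_cmult)
  show "(a \<oplus>\<^bsub>complex_ring\<^esub> b) \<odot>\<^bsub>L2_space M\<^esub> x =
        a \<odot>\<^bsub>L2_space M\<^esub> x \<oplus>\<^bsub>L2_space M\<^esub> b \<odot>\<^bsub>L2_space M\<^esub> x"
    using f by (simp add: L2_smult L2_add complex_ring_def distrib_right)
  show "(a \<otimes>\<^bsub>complex_ring\<^esub> b) \<odot>\<^bsub>L2_space M\<^esub> x =
        a \<odot>\<^bsub>L2_space M\<^esub> (b \<odot>\<^bsub>L2_space M\<^esub> x)"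
    using f by (simp add: L2_smult complex_ring_def mult.assoc)
  show "\<one>\<^bsub>complex_ring\<^esub> \<odot>\<^bsub>L2_space M\<^esub> x = x"
    using f by (simp add: L2_smult complex_ring_def)
  assume "y \<in> carrier (L2_space M)"
  then obtain g where g: "square_integrable M g" "g \<in> borel_measurable M" "y = ae_class M g"
    by (rule L2_carrierE)
  show "a \<odot>\<^bsub>L2_space M\<^esub> (x \<oplus>\<^bsub>L2_space M\<^esub> y) =
        a \<odot>\<^bsub>L2_space M\<^esub> x \<oplus>\<^bsub>L2_space M\<^esub> a \<odot>\<^bsub>L2_space M\<^esub> y"
    using f g by (simp add: L2_smult L2_add distrib_left)
qed


section \<open>Hardy spaces on the sphere\<close>

abbreviation sphere_borel :: "(complex^'d) measure" where
  "sphere_borel \<equiv> restrict_space borel (sphere 0 1)"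

definition cmonomial :: "('d \<Rightarrow> nat) \<Rightarrow> complex^'d \<Rightarrow> complex" where
  "cmonomial \<alpha> z = (\<Prod>j\<in>UNIV. (z $ j) ^ \<alpha> j)"

definition polynomial_functions :: "(complex^'d \<Rightarrow> complex) set" where
  "polynomial_functions = {p. \<exists>A c. finite A \<and> p = (\<lambda>z. \<Sum>\<alpha>\<in>A. c \<alpha> * cmonomial \<alpha> z)}"

definition reinhardt :: "(complex^'d) measure \<Rightarrow> bool" where
  "reinhardt \<mu> \<longleftrightarrow>
     (\<forall>t :: complex^'d. (\<forall>j. cmod (t $ j) = 1) \<longrightarrow> distr \<mu> \<mu> (\<lambda>z. \<chi> j. t $ j * z $ j) = \<mu>)"

definition hardy_space :: "(complex^'d) measure \<Rightarrow> (complex^'d \<Rightarrow> complex) set cspace" where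
  "hardy_space \<mu> =
     (L2_space \<mu>)\<lparr>carrier := cclosure (L2_space \<mu>) (ae_class \<mu> ` polynomial_functions)\<rparr>"

definition coord_mult ::
    "(complex^'d) measure \<Rightarrow> 'd \<Rightarrow> (complex^'d \<Rightarrow> complex) set \<Rightarrow> (complex^'d \<Rightarrow> complex) set" where
  "coord_mult \<mu> j F = (\<Union>f\<in>F. ae_class \<mu> (\<lambda>z. z $ j * f z))"

text \<open>The measure $\mu \circ u^{-1}$, that is, $\Delta \mapsto \mu(u^{-1}\Delta)$.\<close>

definition rotated_measure :: "complex^'d^'d \<Rightarrow> (complex^'d) measure \<Rightarrow> (complex^'d) measure" where
  "rotated_measure u \<mu> = distr \<mu> \<mu> (\<lambda>z. u *v z)"

text \<open>Normalized surface area measure on the unit sphere, in polar coordinates: the measure of a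
  Borel set is the proportion of the volume of the unit ball taken up by the cone over that set.
  The centre is removed so that radial projection maps into the sphere.\<close>

definition surface_measure :: "(complex^'d) measure" where
  "surface_measure =
     distr (restrict_space (uniform_measure lborel (ball 0 1)) (- {0})) sphere_borel sgn"

text \<open>This is a $\mathcal U(d)$-invariant probability measure.  Invariance rests on that of Lebesgue
  measure under linear isometries, which the library has only for \<open>real^'n\<close>.\<close>

lemma norm_unitary_matrix_vector:
  fixes u :: "complex^'d^'d"
  assumes "unitary_matrix u"
  shows "norm (u *v z) = norm z"
proof -
  have sq: "complex_of_real ((norm x)\<^sup>2) = (\<Sum>i\<in>UNIV. x $ i * cnj (x $ i))" for x :: "complex^'d"
    by (simp add: norm_vec_def L2_set_def sum_nonneg flip: complex_norm_square)
  have orth: "(\<Sum>i\<in>UNIV. u $ i $ k * cnj (u $ i $ l)) = (if k = l then 1 else 0)" for k l :: 'd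
  proof -
    have "((\<chi> i j. cnj (u $ j $ i)) ** u) $ l $ k = (mat 1 :: complex^'d^'d) $ l $ k"
      using assms by (simp add: unitary_matrix_def)
    then show ?thesis by (simp add: matrix_matrix_mult_def mat_def mult.commute eq_commute)
  qed
  have "complex_of_real ((norm (u *v z))\<^sup>2) =
      (\<Sum>i\<in>UNIV. \<Sum>k\<in>UNIV. \<Sum>l\<in>UNIV. (u $ i $ k * z $ k) * (cnj (u $ i $ l) * cnj (z $ l)))"
    unfolding sq by (simp add: matrix_vector_mult_def sum_product)
  also have "\<dots> = (\<Sum>k\<in>UNIV. \<Sum>i\<in>UNIV. \<Sum>l\<in>UNIV. (u $ i $ k * z $ k) * (cnj (u $ i $ l) * cnj (z $ l)))"
    by (rule sum.swap)
  also have "\<dots> = (\<Sum>k\<in>UNIV. \<Sum>l\<in>UNIV. \<Sum>i\<in>UNIV. (u $ i $ k * z $ k) * (cnj (u $ i $ l) * cnj (z $ l)))"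
    by (rule sum.cong[OF refl]) (rule sum.swap)
  also have "\<dots> = (\<Sum>k\<in>UNIV. \<Sum>l\<in>UNIV. z $ k * cnj (z $ l) * (\<Sum>i\<in>UNIV. u $ i $ k * cnj (u $ i $ l)))"
    by (simp add: sum_distrib_left mult_ac)
  also have "\<dots> = (\<Sum>k\<in>UNIV. z $ k * cnj (z $ k))"
    unfolding orth by (simp add: if_distrib if_distribR sum.delta cong: if_cong)
  also have "\<dots> = complex_of_real ((norm z)\<^sup>2)" by (rule sq[symmetric])
  finally show ?thesis by (simp only: of_real_eq_iff) simp
qed

lemma linear_matrix_vector_mult_complex: "linear (\<lambda>z. u *v z :: complex^'n)"
  for u :: "complex^'m^'n"
  by (rule linearI)
     (simp_all add: matrix_vector_mult_def vec_eq_iff distrib_left sum.distrib scaleR_sum_right)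

lemma nn_integral_lborel_reflect:
  fixes c :: "'a::euclidean_space"
  assumes [measurable]: "g \<in> borel_measurable borel"
  shows "(\<integral>\<^sup>+x. g (c - x) \<partial>lborel) = (\<integral>\<^sup>+x. g x \<partial>lborel)"
proof -
  have "lborel = distr lborel borel (\<lambda>x. c - x)"
    using lborel_affine[of "-1" c] by (simp add: density_1 one_ennreal_def[symmetric])
  then have "(\<integral>\<^sup>+x. g x \<partial>lborel) = (\<integral>\<^sup>+x. g x \<partial>distr lborel borel (\<lambda>x. c - x))" by simp
  also have "\<dots> = (\<integral>\<^sup>+x. g (c - x) \<partial>lborel)" by (subst nn_integral_distr) auto
  finally show ?thesis by simp
qed

lemma nn_integral_lborel_translate:
  fixes c :: "'a::euclidean_space"
  assumes [measurable]: "g \<in> borel_measurable borel"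
  shows "(\<integral>\<^sup>+x. g (x - c) \<partial>lborel) = (\<integral>\<^sup>+x. g x \<partial>lborel)"
proof -
  have "(\<integral>\<^sup>+x. g x \<partial>lborel) = (\<integral>\<^sup>+x. g x \<partial>distr lborel borel ((+) (- c)))"
    by (simp add: lborel_distr_plus)
  also have "\<dots> = (\<integral>\<^sup>+x. g (x - c) \<partial>lborel)" by (subst nn_integral_distr) auto
  finally show ?thesis by simp
qed

lemma distr_lborel_linear_isometry:
  fixes f :: "'a::euclidean_space \<Rightarrow> 'a"
  assumes lin: "linear f" and iso: "\<And>x. norm (f x) = norm x"
  shows "distr lborel borel f = lborel"
proof -
  have [measurable]: "f \<in> borel_measurable borel"
    using lin by (intro borel_measurable_continuous_onI linear_continuous_on) (simp add: linear_linear)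
  have "inj f"
    unfolding linear_injective_0[OF lin] by (metis iso norm_eq_zero)
  then have surj: "surj f" using linear_injective_imp_surjective[OF lin] by blast
  define \<nu> where "\<nu> = distr lborel borel f"
  have sets [measurable_cong]: "sets \<nu> = sets borel" by (simp add: \<nu>_def)
  have ball: "emeasure \<nu> (ball 0 r) = emeasure lborel (ball (0::'a) r)" for r
  proof -
    have "f -` ball 0 r = ball 0 r" by (auto simp: iso)
    then show ?thesis by (simp add: \<nu>_def emeasure_distr)
  qed
  interpret \<nu>: sigma_finite_measure \<nu>
  proof
    show "\<exists>A. countable A \<and> A \<subseteq> sets \<nu> \<and> \<Union> A = space \<nu> \<and> (\<forall>a\<in>A. emeasure \<nu> a \<noteq> \<infinity>)"
    proof (intro exI[of _ "range (\<lambda>n::nat. ball 0 (real n))"] conjI ballI)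
      show "\<Union> (range (\<lambda>n::nat. ball (0::'a) (real n))) = space \<nu>"
        by (auto simp: \<nu>_def reals_Archimedean2)
    next
      fix a assume "a \<in> range (\<lambda>n::nat. ball (0::'a) (real n))"
      then show "emeasure \<nu> a \<noteq> \<infinity>"
        using less_imp_neq[OF emeasure_lborel_ball_finite[of "0::'a"]] by (auto simp: ball)
    qed (auto simp: sets)
  qed
  interpret P: pair_sigma_finite lborel \<nu> ..
  have reflect: "(\<integral>\<^sup>+x. g (y - x) \<partial>\<nu>) = (\<integral>\<^sup>+x. g x \<partial>\<nu>)"
    if [measurable]: "g \<in> borel_measurable borel" for g y
  proof -
    obtain c where c: "y = f c" using surj by blast
    have "(\<integral>\<^sup>+x. g (y - x) \<partial>\<nu>) = (\<integral>\<^sup>+x. g (f (c - x)) \<partial>lborel)"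
      unfolding \<nu>_def by (subst nn_integral_distr) (auto simp: c linear_diff[OF lin])
    also have "\<dots> = (\<integral>\<^sup>+x. g (f x) \<partial>lborel)"
      by (rule nn_integral_lborel_reflect[of "\<lambda>x. g (f x)"]) simp
    also have "\<dots> = (\<integral>\<^sup>+x. g x \<partial>\<nu>)"
      unfolding \<nu>_def by (subst nn_integral_distr) auto
    finally show ?thesis .
  qed
  define B where "B = ball (0::'a) 1"
  have [measurable]: "B \<in> sets borel" by (simp add: B_def)
  have meas: "(\<lambda>y. indicator X (y - x) :: ennreal) \<in> borel_measurable borel"
    if "X \<in> sets borel" for X :: "'a set" and x
    by (rule measurable_compose[OF _ borel_measurable_indicator[OF that]]) simp
  have "emeasure \<nu> A = emeasure lborel A" if [measurable]: "A \<in> sets borel" for A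
  proof -
    have "emeasure \<nu> A * emeasure lborel B =
        (\<integral>\<^sup>+x. indicator A x * (\<integral>\<^sup>+y. indicator B (y - x) \<partial>lborel) \<partial>\<nu>)"
      by (subst nn_integral_lborel_translate)
         (auto simp: nn_integral_multc sets intro!: borel_measurable_indicator)
    also have "\<dots> = (\<integral>\<^sup>+x. (\<integral>\<^sup>+y. indicator A x * indicator B (y - x) \<partial>lborel) \<partial>\<nu>)"
      by (subst nn_integral_cmult) (auto intro!: meas)
    also have "\<dots> = (\<integral>\<^sup>+y. (\<integral>\<^sup>+x. indicator A x * indicator B (y - x) \<partial>\<nu>) \<partial>lborel)"
      by (rule P.Fubini') measurable
    also have "\<dots> = (\<integral>\<^sup>+y. (\<integral>\<^sup>+x. indicator A (y - x) * indicator B x \<partial>\<nu>) \<partial>lborel)"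
    proof (rule nn_integral_cong)
      fix y
      have "(\<lambda>x. indicator A x * indicator B (y - x) :: ennreal) \<in> borel_measurable borel"
        by measurable
      from reflect[OF this, of y]
      show "(\<integral>\<^sup>+x. indicator A x * indicator B (y - x) \<partial>\<nu>) =
          (\<integral>\<^sup>+x. indicator A (y - x) * indicator B x \<partial>\<nu>)"
        by simp
    qed
    also have "\<dots> = (\<integral>\<^sup>+x. (\<integral>\<^sup>+y. indicator A (y - x) * indicator B x \<partial>lborel) \<partial>\<nu>)"
      by (rule P.Fubini'[symmetric]) measurable
    also have "\<dots> = (\<integral>\<^sup>+x. (\<integral>\<^sup>+y. indicator A (y - x) \<partial>lborel) * indicator B x \<partial>\<nu>)"
      by (subst nn_integral_multc) (auto intro!: meas)
    also have "\<dots> = emeasure lborel A * emeasure \<nu> B"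
      by (subst nn_integral_lborel_translate)
         (auto simp: nn_integral_cmult sets intro!: borel_measurable_indicator)
    finally have "emeasure \<nu> A * emeasure lborel B = emeasure lborel A * emeasure lborel B"
      by (simp add: B_def ball)
    moreover have "emeasure lborel B \<noteq> 0" "emeasure lborel B \<noteq> \<infinity>"
      using emeasure_lborel_ball_finite[of "0::'a" 1] content_ball_pos[of 1 "0::'a"]
      by (auto simp: B_def measure_def)
    ultimately show ?thesis
      by (metis ennreal_mult_cancel_left infinity_ennreal_def mult.commute)
  qed
  then show ?thesis
    by (intro measure_eqI) (auto simp: \<nu>_def)
qed

lemma distr_surface_base:
  fixes u :: "complex^'d^'d"
  assumes "unitary_matrix u"
  defines "B \<equiv> restrict_space (uniform_measure lborel (ball (0::complex^'d) 1)) (- {0})"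
  shows "distr B B (\<lambda>z. u *v z) = B"
proof -
  let ?f = "\<lambda>z::complex^'d. u *v z"
  have [measurable]: "?f \<in> borel_measurable borel"
    by (intro borel_measurable_continuous_onI linear_continuous_on)
       (simp add: linear_linear linear_matrix_vector_mult_complex)
  note iso = norm_unitary_matrix_vector[OF assms(1)]
  have nz: "u *v z = 0 \<longleftrightarrow> z = 0" for z by (metis iso norm_eq_zero)
  have sB: "sets B = sets (restrict_space borel (- {0}))" and spB: "space B = - {0}"
    by (auto simp: B_def sets_restrict_space space_restrict_space)
  have mB: "?f \<in> B \<rightarrow>\<^sub>M B"
    unfolding measurable_cong_sets[OF sB sB]
    by (rule measurable_restrict_space3) (auto simp: nz)
  show ?thesis
  proof (rule measure_eqI)
    fix A assume "A \<in> sets (distr B B ?f)"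
    then have A: "A \<in> sets B" by simp
    then have A' [measurable]: "A \<in> sets borel" and A0: "0 \<notin> A"
      by (auto simp: sB sets_restrict_space)
    have em: "emeasure B X = emeasure lborel (ball 0 1 \<inter> X) / emeasure lborel (ball (0::complex^'d) 1)"
      if "X \<in> sets borel" "0 \<notin> X" for X
      using that unfolding B_def by (subst emeasure_restrict_space) auto
    have "emeasure (distr B B ?f) A = emeasure B (?f -` A \<inter> - {0})"
      using mB A by (simp add: emeasure_distr spB)
    also have "?f -` A \<inter> - {0} = ?f -` A"
    proof -
      have "0 \<notin> ?f -` A" unfolding vimage_eq nz[of 0, THEN iffD2, OF refl] by (rule A0)
      then show ?thesis by blast
    qed
    also have "emeasure B (?f -` A) =
        emeasure lborel (?f -` (ball 0 1 \<inter> A)) / emeasure lborel (ball (0::complex^'d) 1)"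
    proof -
      have "?f -` (ball 0 1 \<inter> A) = ball 0 1 \<inter> ?f -` A" by (auto simp: iso)
      moreover have "?f -` A \<in> sets borel" using measurable_sets_borel[of ?f borel A] by simp
      ultimately show ?thesis using A0 by (simp add: em)
    qed
    also have "emeasure lborel (?f -` (ball 0 1 \<inter> A)) =
        emeasure (distr lborel borel ?f) (ball 0 1 \<inter> A)"
      by (simp add: emeasure_distr)
    also have "distr lborel borel ?f = lborel"
      by (rule distr_lborel_linear_isometry[OF linear_matrix_vector_mult_complex iso])
    finally show "emeasure (distr B B ?f) A = emeasure B A"
      using em[OF A' A0] by simp
  qed simp
qed

lemma sgn_measurable_sphere:
  "sgn \<in> restrict_space (uniform_measure lborel (ball (0::complex^'d) 1)) (- {0}) \<rightarrow>\<^sub>M sphere_borel"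
  by (intro measurable_restrict_space3) (auto simp: norm_sgn)

lemma prob_space_surface_measure: "prob_space (surface_measure :: (complex^'d) measure)"
proof -
  let ?b = "ball (0::complex^'d) 1"
  have nz: "emeasure lborel ?b \<noteq> 0" "emeasure lborel ?b \<noteq> \<infinity>"
    using emeasure_lborel_ball_finite[of "0::complex^'d" 1] content_ball_pos[of 1 "0::complex^'d"]
    by (auto simp: measure_def)
  have "prob_space (restrict_space (uniform_measure lborel ?b) (- {0}))"
  proof (rule prob_space_restrict_space)
    have "emeasure lborel (?b \<inter> - {0}) = emeasure lborel ?b"
      unfolding Diff_eq[symmetric] by (rule emeasure_Diff_null_set) (auto simp: null_sets_def)
    then show "emeasure (uniform_measure lborel ?b) (- {0}) = 1"
      using nz by (simp add: ennreal_divide_self less_top)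
  qed simp
  then show ?thesis
    unfolding surface_measure_def by (rule prob_space.prob_space_distr[OF _ sgn_measurable_sphere])
qed

lemma rotated_surface_measure:
  fixes u :: "complex^'d^'d"
  assumes "unitary_matrix u"
  shows "rotated_measure u surface_measure = surface_measure"
proof -
  let ?f = "\<lambda>z::complex^'d. u *v z"
  define B where "B = restrict_space (uniform_measure lborel (ball (0::complex^'d) 1)) (- {0})"
  have [measurable]: "?f \<in> borel_measurable borel"
    by (intro borel_measurable_continuous_onI linear_continuous_on)
       (simp add: linear_linear linear_matrix_vector_mult_complex)
  note iso = norm_unitary_matrix_vector[OF assms]
  have nz: "u *v z = 0 \<longleftrightarrow> z = 0" for z by (metis iso norm_eq_zero)
  have mS: "?f \<in> sphere_borel \<rightarrow>\<^sub>M sphere_borel"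
    by (intro measurable_restrict_space3) (auto simp: iso)
  have mB: "?f \<in> B \<rightarrow>\<^sub>M B"
    unfolding B_def by (intro measurable_restrict_space3) (auto simp: nz)
  have m: "sgn \<in> B \<rightarrow>\<^sub>M sphere_borel" unfolding B_def by (rule sgn_measurable_sphere)
  have S: "surface_measure = distr B sphere_borel sgn" by (simp add: surface_measure_def B_def)
  have "rotated_measure u surface_measure = distr (distr B sphere_borel sgn) sphere_borel ?f"
    unfolding rotated_measure_def S by (rule distr_cong) auto
  also have "\<dots> = distr B sphere_borel (?f \<circ> sgn)" by (rule distr_distr[OF mS m])
  also have "?f \<circ> sgn = sgn \<circ> ?f"
    by (auto simp: fun_eq_iff sgn_div_norm iso linear_cmul[OF linear_matrix_vector_mult_complex])
  also have "distr B sphere_borel (sgn \<circ> ?f) = distr (distr B B ?f) sphere_borel sgn"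
    by (rule distr_distr[OF m mB, symmetric])
  also have "distr B B ?f = B" unfolding B_def by (rule distr_surface_base[OF assms])
  finally show ?thesis by (simp add: S)
qed

end

theory Submission
  imports Defs
begin

text \<open>The three conditions are linked by the norm estimate \<open>\<parallel>p \<circ> u\<parallel> \<le> K \<parallel>p\<parallel>\<close> for polynomials \<open>p\<close> in
\<open>L\<^sup>2(\<mu>)\<close>, uniformly in the unitary \<open>u\<close>.

Weak homogeneity implies the estimate.  An operator \<open>\<Gamma>\<close> that intertwines the shift with its rotation by
\<open>u\<close> has the form \<open>p \<mapsto> (p \<circ> u) h\<close> with \<open>h = \<Gamma> 1\<close> (\<open>intertwiner_on_polynomials\<close>).  The mean of \<open>h\<close> is
not zero, since otherwise the range of \<open>\<Gamma>\<close> would be orthogonal to the constants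
(\<open>intertwiner_mean_nonzero\<close>).  Because \<open>\<mu>\<close> is invariant under scalar rotations, averaging replaces \<open>h\<close>
by its mean, and \<open>p \<mapsto> p \<circ> u\<close> itself is bounded (\<open>composition_bound_of_homogeneous\<close>).  The Baire category
theorem on the compact unitary group makes the bound uniform (\<open>uniform_composition_bound\<close>).

Norms of polynomials control the measure.  The polynomials \<open>((1 + <z,w>)/2)^n\<close> peak at the point \<open>w\<close> of the
sphere; their square moduli form a unitarily invariant approximate identity for surface measure.
Therefore an inequality between the \<open>L\<^sup>2\<close> norms of these polynomials for two measures on the sphere implies
the same inequality between the measures (\<open>measure_le_of_peak_le\<close>).  Applied to \<open>\<mu>\<close> and its rotations,
this yields \<open>\<mu> \<circ> u^{-1} \<le> K\<^sup>2 \<mu>\<close>, and the inverse unitary gives the reverse inequality: these are the bounds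
on the Radon-Nikodym derivative.  Applied to \<open>\<mu>\<close> and surface measure, together with transitivity of the
unitary group on the sphere, it shows that the two are comparable (\<open>comparable_surface_measure\<close>), and
comparable measures have similar shifts, through the identity map (\<open>similar_if_comparable\<close>).

Conversely, bounds on the derivative make composition with \<open>u\<close> a bounded invertible operator on the Hardy
space, which is an intertwiner (\<open>weakly_homogeneous_if_dominated\<close>).  In particular the Szego shift is
weakly homogeneous, and weak homogeneity passes to similar tuples (\<open>weakly_homogeneous_similar\<close>).\<close>

section \<open>The unitary group and the sphere\<close>

definition herm :: "complex^'d \<Rightarrow> complex^'d \<Rightarrow> complex" where
  "herm z w = (\<Sum>j\<in>UNIV. z $ j * cnj (w $ j))"

definition adjoint_matrix :: "complex^'d^'d \<Rightarrow> complex^'d^'d" where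
  "adjoint_matrix u = (\<chi> i j. cnj (u $ j $ i))"

lemma herm_self: "herm z z = complex_of_real ((norm z)\<^sup>2)"
  by (simp add: herm_def norm_vec_def L2_set_def sum_nonneg flip: complex_norm_square)

lemma cnj_herm: "cnj (herm z w) = herm w z"
  by (simp add: herm_def mult.commute)

lemma norm_diff_herm: "(norm (z - w))\<^sup>2 = (norm z)\<^sup>2 + (norm w)\<^sup>2 - 2 * Re (herm z w)"
proof -
  have "complex_of_real ((norm (z - w))\<^sup>2) = herm (z - w) (z - w)" by (rule herm_self[symmetric])
  also have "\<dots> = herm z z - herm w z - (herm z w - herm w w)"
    by (simp add: herm_def left_diff_distrib right_diff_distrib sum_subtractf)
  finally have "(norm (z - w))\<^sup>2 = Re (herm z z - herm w z - (herm z w - herm w w))"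
    by (metis Re_complex_of_real)
  moreover have "Re (herm w z) = Re (herm z w)" by (subst cnj_herm[symmetric]) simp
  ultimately show ?thesis by (simp add: herm_self flip: of_real_power)
qed

lemma norm_herm_le: "cmod (herm z w) \<le> norm z * norm w"
proof -
  have "cmod (herm z w) \<le> (\<Sum>j\<in>UNIV. \<bar>cmod (z $ j)\<bar> * \<bar>cmod (w $ j)\<bar>)"
    unfolding herm_def by (rule order_trans[OF norm_sum]) (simp add: norm_mult)
  also have "\<dots> \<le> L2_set (\<lambda>j. cmod (z $ j)) UNIV * L2_set (\<lambda>j. cmod (w $ j)) UNIV"
    by (rule L2_set_mult_ineq)
  finally show ?thesis by (simp add: norm_vec_def)
qed

lemma unitary_matrix_iff: "unitary_matrix u \<longleftrightarrow> adjoint_matrix u ** u = mat 1"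
  unfolding unitary_matrix_def adjoint_matrix_def using matrix_left_right_inverse by blast

lemma adjoint_adjoint [simp]: "adjoint_matrix (adjoint_matrix u) = u"
  by (simp add: adjoint_matrix_def vec_eq_iff)

lemma adjoint_matrix_mult: "adjoint_matrix (u ** v) = adjoint_matrix v ** adjoint_matrix u"
  by (simp add: adjoint_matrix_def matrix_matrix_mult_def vec_eq_iff mult.commute)

lemma unitary_adjoint: "unitary_matrix u \<Longrightarrow> unitary_matrix (adjoint_matrix u)"
  unfolding unitary_matrix_iff by (simp add: matrix_left_right_inverse)

lemma unitary_mult: "unitary_matrix u \<Longrightarrow> unitary_matrix v \<Longrightarrow> unitary_matrix (u ** v)"
  unfolding unitary_matrix_iff adjoint_matrix_mult
  by (metis matrix_mul_assoc matrix_mul_lid)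

lemma unitary_adjoint_cancel:
  assumes "unitary_matrix u"
  shows "adjoint_matrix u *v (u *v z) = z" "u *v (adjoint_matrix u *v z) = z"
  using assms unitary_adjoint[OF assms]
  by (simp_all add: unitary_matrix_iff matrix_vector_mul_assoc)

lemma herm_adjoint: "herm (u *v z) w = herm z (adjoint_matrix u *v w)"
proof -
  have "herm (u *v z) w = (\<Sum>i\<in>UNIV. \<Sum>j\<in>UNIV. u $ i $ j * z $ j * cnj (w $ i))"
    by (simp add: herm_def matrix_vector_mult_def sum_distrib_right)
  also have "\<dots> = (\<Sum>j\<in>UNIV. \<Sum>i\<in>UNIV. u $ i $ j * z $ j * cnj (w $ i))" by (rule sum.swap)
  also have "\<dots> = herm z (adjoint_matrix u *v w)"
    by (simp add: herm_def matrix_vector_mult_def adjoint_matrix_def sum_distrib_left mult_ac)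
  finally show ?thesis .
qed

lemma matrix_mult_nth: "(A ** B) $ i $ j = (\<Sum>k\<in>UNIV. A $ i $ k * B $ k $ j)"
  by (simp add: matrix_matrix_mult_def)

lemma continuous_on_matrix_mult:
  fixes f g :: "'a::topological_space \<Rightarrow> complex^'d^'d"
  assumes "continuous_on S f" "continuous_on S g"
  shows "continuous_on S (\<lambda>x. f x ** g x)"
  unfolding matrix_matrix_mult_def
  by (intro continuous_on_vec_lambda continuous_on_sum continuous_on_mult continuous_on_component assms)

lemma continuous_on_adjoint:
  fixes f :: "'a::topological_space \<Rightarrow> complex^'d^'d"
  assumes "continuous_on S f"
  shows "continuous_on S (\<lambda>x. adjoint_matrix (f x))"
  unfolding adjoint_matrix_def
  by (intro continuous_on_vec_lambda continuous_on_cnj continuous_on_component assms)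

lemma continuous_on_matrix_vector:
  fixes f :: "'a::topological_space \<Rightarrow> complex^'d^'d"
  assumes "continuous_on S f" "continuous_on S g"
  shows "continuous_on S (\<lambda>x. f x *v g x)"
  unfolding matrix_vector_mult_def
  by (intro continuous_on_vec_lambda continuous_on_sum continuous_on_mult continuous_on_component assms)

lemma norm_axis_complex: "norm (axis j 1 :: complex^'d) = 1"
  by (simp add: norm_vec_def L2_set_def axis_def if_distrib[of "\<lambda>x. (norm x)\<^sup>2"] cong: if_cong)

lemma norm_le_sum_components: "norm (x :: 'a::real_normed_vector^'d) \<le> (\<Sum>i\<in>UNIV. norm (x $ i))"
  by (simp add: L2_set_le_sum norm_vec_def)

lemma compact_unitary: "compact (Collect unitary_matrix :: (complex^'d^'d) set)"
  unfolding compact_eq_bounded_closed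
proof
  have c: "continuous_on UNIV (\<lambda>u :: complex^'d^'d. adjoint_matrix u ** u)"
    by (intro continuous_on_matrix_mult continuous_on_adjoint continuous_on_id)
  have "closed ((\<lambda>u :: complex^'d^'d. adjoint_matrix u ** u) -` {mat 1})"
    by (rule closed_vimage[OF _ c]) simp
  moreover have "(\<lambda>u :: complex^'d^'d. adjoint_matrix u ** u) -` {mat 1} = Collect unitary_matrix"
    by (auto simp: unitary_matrix_iff)
  ultimately show "closed (Collect unitary_matrix :: (complex^'d^'d) set)" by simp
  have "cmod (u $ i $ j) \<le> 1" if "unitary_matrix u" for u :: "complex^'d^'d" and i j
  proof -
    have "cmod ((u *v axis j 1) $ i) \<le> norm (u *v axis j 1)"
      by (rule Finite_Cartesian_Product.norm_nth_le)
    also have "\<dots> = 1"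
      unfolding norm_unitary_matrix_vector[OF that] by (rule norm_axis_complex)
    finally show ?thesis
      by (simp add: matrix_vector_mult_def axis_def if_distrib cong: if_cong)
  qed
  then have "norm u \<le> (\<Sum>i\<in>(UNIV::'d set). \<Sum>j\<in>(UNIV::'d set). 1)" 
    if "unitary_matrix u" for u :: "complex^'d^'d"
    using that
    by (intro order_trans[OF norm_le_sum_components] sum_mono order_trans[OF norm_le_sum_components]) blast
  then show "bounded (Collect unitary_matrix :: (complex^'d^'d) set)"
    unfolding bounded_iff by blast
qed

text \<open>A phase \<open>t\<close> makes the inner product of \<open>t x\<close> with \<open>y\<close> real; then the complex reflection along
\<open>t x - y\<close> exchanges the two unit vectors.  Transitivity is what makes every quantity that is
\<open>U(d)\<close>-invariant, or invariant up to a factor, comparable at all points of the sphere.\<close>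

lemma unitary_transitive:
  fixes x y :: "complex^'d"
  assumes "norm x = 1" "norm y = 1"
  obtains u where "unitary_matrix u" "u *v x = y"
proof -
  define t where "t = (if herm x y = 0 then 1 else cnj (herm x y) / cmod (herm x y))"
  have nt: "cmod t = 1" by (simp add: t_def norm_divide)
  then have t: "cnj t * t = 1" using complex_norm_square[of t] by (simp add: mult.commute)
  have tr: "t * herm x y = cmod (herm x y)"
    by (auto simp: t_def divide_simps power2_eq_square mult.commute simp flip: complex_norm_square)
  define v where "v = t *s x - y"
  define s :: complex where "s = (if v = 0 then 0 else 2 / (norm v)\<^sup>2)"
  have vv: "(\<Sum>k\<in>UNIV. v $ k * cnj (v $ k)) = (norm v)\<^sup>2"
    using herm_self[of v] by (simp add: herm_def)
  have sc: "cnj s = s" by (simp add: s_def)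
  have ss: "s * s * (\<Sum>k\<in>UNIV. v $ k * cnj (v $ k)) = 2 * s"
    by (simp add: vv s_def power2_eq_square)
  have hx: "herm (t *s x) w = t * herm x w" for w
    by (simp add: herm_def sum_distrib_left mult.assoc)
  have ntx: "norm (t *s x) = 1"
    using assms(1) nt by (simp add: norm_vec_def L2_set_def norm_mult)
  have sv: "s * herm (t *s x) v = 1" if "v \<noteq> 0"
  proof -
    have "herm (t *s x) v = herm (t *s x) (t *s x) - herm (t *s x) y"
      unfolding v_def by (simp add: herm_def right_diff_distrib sum_subtractf)
    also have "\<dots> = 1 - complex_of_real (cmod (herm x y))" by (simp add: herm_self ntx hx tr)
    finally have "herm (t *s x) v = 1 - complex_of_real (cmod (herm x y))" .
    moreover have "(norm v)\<^sup>2 = 2 - 2 * cmod (herm x y)"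
      unfolding v_def by (simp add: norm_diff_herm ntx assms hx tr)
    ultimately have "2 * herm (t *s x) v = (norm v)\<^sup>2" by simp
    then show ?thesis using that by (simp add: s_def)
  qed
  define u :: "complex^'d^'d" where "u = (\<chi> i j. t * ((if i = j then 1 else 0) - s * v $ i * cnj (v $ j)))"
  \<comment> \<open>The rank one terms cancel because \<open>s\<^sup>2 |v|\<^sup>2 = 2 s\<close>.\<close>
  have "(\<Sum>k\<in>UNIV. cnj (u $ k $ i) * u $ k $ j) = (if i = j then 1 else 0)" for i j
  proof -
    have "cnj (u $ k $ i) * u $ k $ j =
        (if k = i then (if k = j then 1 else 0) - s * v $ k * cnj (v $ j) else 0)
        - (if k = j then s * cnj (v $ k) * v $ i else 0)
        + s * s * (v $ k * cnj (v $ k)) * (v $ i * cnj (v $ j))" for k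
    proof -
      have "cnj (u $ k $ i) * u $ k $ j = (cnj t * t) *
          (((if k = i then 1 else 0) - s * cnj (v $ k) * v $ i) * ((if k = j then 1 else 0) - s * v $ k * cnj (v $ j)))"
        by (simp add: u_def sc mult_ac)
      also have "\<dots> = (if k = i then (if k = j then 1 else 0) - s * v $ k * cnj (v $ j) else 0)
        - (if k = j then s * cnj (v $ k) * v $ i else 0)
        + s * s * (v $ k * cnj (v $ k)) * (v $ i * cnj (v $ j))"
        unfolding t by (auto simp: algebra_simps)
      finally show ?thesis .
    qed
    then have "(\<Sum>k\<in>UNIV. cnj (u $ k $ i) * u $ k $ j) =
       ((if i = j then 1 else 0) - s * v $ i * cnj (v $ j)) - s * cnj (v $ j) * v $ i
        + s * s * (\<Sum>k\<in>UNIV. v $ k * cnj (v $ k)) * (v $ i * cnj (v $ j))"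
      by (simp add: sum.distrib sum_subtractf sum.delta flip: sum_distrib_left sum_distrib_right)
    then show ?thesis unfolding ss by (simp add: algebra_simps)
  qed
  then have "unitary_matrix u"
    by (simp add: unitary_matrix_iff vec_eq_iff matrix_mult_nth adjoint_matrix_def mat_def)
  moreover have "(u *v x) $ i = y $ i" for i
  proof -
    have "(u *v x) $ i = (\<Sum>j\<in>UNIV. (if j = i then t * x $ j else 0) - s * v $ i * (t * x $ j * cnj (v $ j)))"
      unfolding matrix_vector_mult_def u_def by (auto intro!: sum.cong simp: algebra_simps)
    also have "\<dots> = t * x $ i - v $ i * (s * herm (t *s x) v)"
      by (simp add: sum_subtractf herm_def mult_ac flip: sum_distrib_left)
    also have "\<dots> = y $ i" 
    proof (cases "v = 0")
      case True
      then have "v $ i = 0" by simp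
      then show ?thesis by (simp add: v_def)
    next
      case False
      show ?thesis unfolding sv[OF False] by (simp add: v_def)
    qed
    finally show ?thesis .
  qed
  ultimately show ?thesis using that by (simp add: vec_eq_iff)
qed

section \<open>The peak kernel\<close>

text \<open>The holomorphic polynomial \<open>((1 + <z,w>)/2)^n\<close> has modulus 1 at \<open>z = w\<close> and is exponentially small
in \<open>n\<close> away from \<open>w\<close>.  Its square modulus depends only on the inner product of the two points, hence
is a \<open>U(d)\<close>-invariant kernel; being the square modulus of a polynomial, it can be fed into norm
inequalities in the Hardy space.  The estimates \<open>peak_upper\<close> and \<open>peak_lower\<close> use
\<open>|z - w|\<^sup>2 = 2 - 2 Re <z,w>\<close>; the lower bound is the square of the upper one, which is harmless
because they are compared at different distances.\<close>

definition peak :: "nat \<Rightarrow> complex^'d \<Rightarrow> complex^'d \<Rightarrow> complex" where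
  "peak n w z = ((1 + herm z w) / 2) ^ n"

lemma peak_unitary: "peak n w (u *v z) = peak n (adjoint_matrix u *v w) z"
  by (simp add: peak_def herm_adjoint)

lemma norm_peak_commute: "cmod (peak n w z) = cmod (peak n z w)"
  unfolding peak_def norm_power norm_divide
  by (subst cnj_herm[symmetric, of w z], subst complex_mod_cnj[symmetric]) simp

lemma continuous_on_herm:
  assumes "continuous_on S f" "continuous_on S g"
  shows "continuous_on S (\<lambda>x. herm (f x) (g x))"
  unfolding herm_def by (intro continuous_intros assms)

lemma continuous_on_peak:
  assumes "continuous_on S f" "continuous_on S g"
  shows "continuous_on S (\<lambda>x. peak n (f x) (g x))"
  unfolding peak_def by (intro continuous_intros continuous_on_herm assms) simp

lemma peak_upper:
  assumes "norm z = 1" "norm w = 1"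
  shows "(cmod (peak n w z))\<^sup>2 \<le> (1 - (norm (z - w))\<^sup>2 / 4) ^ n"
proof -
  let ?h = "herm z w"
  have le: "cmod ?h \<le> 1" using norm_herm_le[of z w] assms by simp
  have "(cmod (1 + ?h))\<^sup>2 = 1 + 2 * Re ?h + (cmod ?h)\<^sup>2"
    by (simp add: cmod_power2) (simp add: power2_eq_square algebra_simps)
  also have "\<dots> \<le> 1 + 2 * Re ?h + 1" using le by (simp add: power_le_one)
  also have "\<dots> = 4 - (norm (z - w))\<^sup>2" using assms by (simp add: norm_diff_herm)
  finally have "(cmod ((1 + ?h) / 2))\<^sup>2 \<le> 1 - (norm (z - w))\<^sup>2 / 4"
    by (simp add: norm_divide power_divide)
  then have "((cmod ((1 + ?h) / 2))\<^sup>2) ^ n \<le> (1 - (norm (z - w))\<^sup>2 / 4) ^ n"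
    by (rule power_mono) simp
  then show ?thesis by (simp add: peak_def norm_power flip: power_mult) (simp add: mult.commute)
qed

lemma peak_lower:
  assumes "norm z = 1" "norm w = 1"
  shows "((1 - (norm (z - w))\<^sup>2 / 4)\<^sup>2) ^ n \<le> (cmod (peak n w z))\<^sup>2"
proof -
  let ?h = "herm z w"
  have d: "(norm (z - w))\<^sup>2 = 2 - 2 * Re ?h" using assms by (simp add: norm_diff_herm)
  have "0 \<le> 1 + Re ?h"
    using norm_herm_le[of z w] abs_Re_le_cmod[of ?h] assms by simp
  moreover have "1 + Re ?h \<le> cmod (1 + ?h)" using complex_Re_le_cmod[of "1 + ?h"] by simp
  ultimately have "((1 + Re ?h) / 2)\<^sup>2 \<le> (cmod ((1 + ?h) / 2))\<^sup>2"
    by (intro power_mono) (auto simp: norm_divide)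
  moreover have "1 - (norm (z - w))\<^sup>2 / 4 = (1 + Re ?h) / 2"
    unfolding d by (simp add: field_simps)
  ultimately have "((1 - (norm (z - w))\<^sup>2 / 4)\<^sup>2) \<le> (cmod ((1 + ?h) / 2))\<^sup>2"
    by metis
  then have "((1 - (norm (z - w))\<^sup>2 / 4)\<^sup>2) ^ n \<le> ((cmod ((1 + ?h) / 2))\<^sup>2) ^ n"
    by (rule power_mono) simp
  then show ?thesis by (simp add: peak_def norm_power flip: power_mult) (simp add: mult.commute)
qed

section \<open>Finite measures on the sphere\<close>

locale sphere_measure = finite_measure \<mu> for \<mu> :: "(complex^'d) measure" +
  assumes sets_sphere: "sets \<mu> = sets sphere_borel"
begin

lemma space_sphere: "space \<mu> = sphere 0 1"
  using sets_eq_imp_space_eq[OF sets_sphere] by (simp add: space_restrict_space)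

lemma in_space_iff: "z \<in> space \<mu> \<longleftrightarrow> norm z = 1"
  by (simp add: space_sphere)

lemma measurable_of_borel: "f \<in> borel \<rightarrow>\<^sub>M N \<Longrightarrow> f \<in> \<mu> \<rightarrow>\<^sub>M N"
  unfolding measurable_cong_sets[OF sets_sphere refl] by (rule measurable_restrict_space1)

lemma measurable_continuous:
  "continuous_on UNIV f \<Longrightarrow> f \<in> borel_measurable \<mu>"
  by (intro measurable_of_borel borel_measurable_continuous_onI)

lemma integrable_continuous:
  fixes f :: "complex^'d \<Rightarrow> 'b::{banach, second_countable_topology}"
  assumes "continuous_on UNIV f"
  shows "integrable \<mu> f"
proof -
  have "compact (f ` sphere 0 1)"
    by (intro compact_continuous_image continuous_on_subset[OF assms]) auto
  then obtain B where "\<forall>x\<in>sphere 0 1. norm (f x) \<le> B"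
    using compact_imp_bounded[of "f ` sphere 0 1"] by (auto simp: bounded_iff)
  then show ?thesis
    by (intro integrable_const_bound[where B = B] measurable_continuous[OF assms] AE_I2)
       (simp add: space_sphere)
qed

lemma continuous_matrix_vector: "continuous_on UNIV (\<lambda>z. (u :: complex^'d^'d) *v z)"
  by (intro continuous_on_matrix_vector continuous_on_const continuous_on_id)

lemma measurable_unitary:
  assumes "unitary_matrix u"
  shows "(\<lambda>z. u *v z) \<in> \<mu> \<rightarrow>\<^sub>M \<mu>"
  unfolding measurable_cong_sets[OF sets_sphere sets_sphere]
  by (rule measurable_restrict_space3)
     (auto intro!: borel_measurable_continuous_onI continuous_matrix_vector
           simp: norm_unitary_matrix_vector[OF assms])

lemma sphere_measure_rotated:
  assumes "unitary_matrix u"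
  shows "sphere_measure (rotated_measure u \<mu>)"
proof -
  interpret r: finite_measure "rotated_measure u \<mu>"
    unfolding rotated_measure_def by (rule finite_measure_distr[OF measurable_unitary[OF assms]])
  show ?thesis
    by unfold_locales (simp add: rotated_measure_def sets_sphere)
qed

lemma integral_rotated:
  fixes f :: "complex^'d \<Rightarrow> 'b::{banach, second_countable_topology}"
  assumes "unitary_matrix u" "f \<in> borel_measurable \<mu>"
  shows "integral\<^sup>L (rotated_measure u \<mu>) f = (LINT z|\<mu>. f (u *v z))"
  unfolding rotated_measure_def by (rule integral_distr[OF measurable_unitary[OF assms(1)] assms(2)])

end

abbreviation (input) \<sigma> :: "(complex^'d) measure" where "\<sigma> \<equiv> surface_measure"

interpretation surface: prob_space "\<sigma> :: (complex^'d) measure"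
  by (rule prob_space_surface_measure)

interpretation surface: sphere_measure "\<sigma> :: (complex^'d) measure"
  by unfold_locales (simp add: surface_measure_def)

lemma surface_integral_rotate:
  fixes f :: "complex^'d \<Rightarrow> 'b::{banach, second_countable_topology}"
  assumes "unitary_matrix u" "f \<in> borel_measurable \<sigma>"
  shows "(LINT z|\<sigma>. f (u *v z)) = integral\<^sup>L \<sigma> f"
  using surface.integral_rotated[OF assms] rotated_surface_measure[OF assms(1)] by simp

text \<open>All caps of one radius have the same measure by invariance, and finitely many of them cover the
sphere.\<close>

lemma surface_measure_cap_pos:
  fixes x :: "complex^'d"
  assumes x: "norm x = 1" and "0 < e"
  shows "0 < measure \<sigma> (ball x e \<inter> sphere 0 1)"
proof (rule ccontr)
  have sets: "ball y e \<inter> sphere 0 1 \<in> sets \<sigma>" for y :: "complex^'d"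
    unfolding surface.sets_sphere by (auto simp: sets_restrict_space)
  assume "\<not> 0 < measure \<sigma> (ball x e \<inter> sphere 0 1)"
  then have 0: "emeasure \<sigma> (ball x e \<inter> sphere 0 1) = 0"
    by (simp add: surface.emeasure_eq_measure zero_less_measure_iff)
  have cap: "ball y e \<inter> sphere 0 1 \<in> null_sets \<sigma>" if y: "norm y = 1" for y :: "complex^'d"
  proof -
    obtain u where u: "unitary_matrix u" "u *v x = y"
      using unitary_transitive[OF x y] by blast
    have "u *v z - y = u *v (z - x)" for z
      using u(2) by (simp add: matrix_vector_mult_diff_distrib)
    then have d: "dist y (u *v z) = dist x z" for z
      by (metis dist_commute dist_norm norm_unitary_matrix_vector[OF u(1)])
    have "emeasure \<sigma> (ball y e \<inter> sphere 0 1) =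
        emeasure (rotated_measure u \<sigma>) (ball y e \<inter> sphere 0 1)"
      by (simp add: rotated_surface_measure[OF u(1)])
    also have "\<dots> = emeasure \<sigma> ((\<lambda>z. u *v z) -` (ball y e \<inter> sphere 0 1) \<inter> space \<sigma>)"
      unfolding rotated_measure_def
      by (rule emeasure_distr[OF surface.measurable_unitary[OF u(1)] sets])
    also have "(\<lambda>z. u *v z) -` (ball y e \<inter> sphere 0 1) \<inter> space \<sigma> = ball x e \<inter> sphere 0 1"
      by (auto simp: surface.space_sphere d norm_unitary_matrix_vector[OF u(1)])
    finally show ?thesis using 0 sets by (simp add: null_setsI)
  qed
  have "sphere 0 1 \<subseteq> (\<Union>y\<in>sphere (0::complex^'d) 1. ball y e)"
    using \<open>0 < e\<close> by force
  then obtain D where D: "D \<subseteq> sphere (0::complex^'d) 1" "finite D" "sphere 0 1 \<subseteq> (\<Union>y\<in>D. ball y e)"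
    using compactE_image[OF compact_sphere[of "0::complex^'d" 1], of "sphere 0 1" "\<lambda>y. ball y e"]
    by (metis open_ball)
  have "(\<Union>y\<in>D. ball y e \<inter> sphere 0 1) \<in> null_sets \<sigma>"
    using D by (intro null_sets.finite_UN cap) auto
  also have "(\<Union>y\<in>D. ball y e \<inter> sphere 0 1) = space \<sigma>"
    using D(3) by (auto simp: surface.space_sphere)
  finally have "emeasure \<sigma> (space (\<sigma> :: (complex^'d) measure)) = 0" by auto
  moreover have "emeasure \<sigma> (space (\<sigma> :: (complex^'d) measure)) = 1"
    by (rule surface.emeasure_space_1)
  ultimately show False by simp
qed

section \<open>The peak kernel is an approximate identity\<close>

text \<open>By transitivity the total mass of the kernel is the same at every point (\<open>peak_mass_eq\<close>), so an
arbitrary unit vector serves as base point.\<close>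

definition peak_mass :: "'d::finite itself \<Rightarrow> nat \<Rightarrow> real" where
  "peak_mass _ n = (LINT w|\<sigma>. (cmod (peak n w (axis undefined 1 :: complex^'d)))\<^sup>2)"

lemma peak_mass_eq:
  fixes x :: "complex^'d"
  assumes "norm x = 1"
  shows "(LINT w|\<sigma>. (cmod (peak n w x))\<^sup>2) = peak_mass TYPE('d) n"
proof -
  obtain u where u: "unitary_matrix u" "u *v axis undefined 1 = x"
    using unitary_transitive[OF norm_axis_complex assms] by metis
  have "(LINT w|\<sigma>. (cmod (peak n w x))\<^sup>2) =
      (LINT w|\<sigma>. (cmod (peak n (adjoint_matrix u *v w) (axis undefined 1)))\<^sup>2)"
    by (simp add: peak_unitary flip: u(2))
  also have "\<dots> = peak_mass TYPE('d) n"
    unfolding peak_mass_def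
    by (rule surface_integral_rotate[OF unitary_adjoint[OF u(1)]])
       (intro surface.measurable_continuous continuous_intros continuous_on_peak)
  finally show ?thesis .
qed

text \<open>At distance at least \<open>\<eta>\<close> the kernel is at most \<open>a^n\<close> with \<open>a = 1 - \<eta>\<^sup>2/4\<close>, whereas on the cap of
radius \<open>\<eta>/2\<close>, which has positive measure \<open>m\<close>, it is at least \<open>b^n\<close> with \<open>b = 1 - \<eta>\<^sup>2/8\<close>.  Since
\<open>a < b\<close>, the contribution of far points is negligible against the total mass.\<close>

lemma peak_approximate_identity:
  fixes \<psi> :: "complex^'d \<Rightarrow> real"
  assumes \<psi>: "continuous_on UNIV \<psi>" and \<epsilon>: "0 < \<epsilon>"
  shows "\<exists>n. 0 < peak_mass TYPE('d) n \<and> (\<forall>x. norm x = 1 \<longrightarrow>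
    \<bar>(LINT w|\<sigma>. \<psi> w * (cmod (peak n w x))\<^sup>2) - peak_mass TYPE('d) n * \<psi> x\<bar> \<le> \<epsilon> * peak_mass TYPE('d) n)"
proof -
  let ?S = "sphere 0 1 :: (complex^'d) set"
  let ?e = "axis undefined 1 :: complex^'d"
  have "bounded (\<psi> ` ?S)"
    by (intro compact_imp_bounded compact_continuous_image continuous_on_subset[OF \<psi>]) auto
  then obtain B where B: "0 < B" "\<And>x. norm x = 1 \<Longrightarrow> \<bar>\<psi> x\<bar> \<le> B"
    unfolding bounded_pos by auto
  have "uniformly_continuous_on ?S \<psi>"
    by (intro compact_uniformly_continuous continuous_on_subset[OF \<psi>]) auto
  then obtain \<eta>0 where \<eta>0: "\<eta>0 > 0" "\<And>x w. norm x = 1 \<Longrightarrow> norm w = 1 \<Longrightarrow> dist w x < \<eta>0 \<Longrightarrow> \<bar>\<psi> w - \<psi> x\<bar> < \<epsilon> / 2"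
    using \<epsilon> unfolding uniformly_continuous_on_def
    by (metis dist_0_norm dist_real_def half_gt_zero mem_sphere)
  \<comment> \<open>The bound \<open>\<eta> \<le> 1\<close> keeps \<open>a\<close> and \<open>b\<close> positive.\<close>
  define \<eta> where "\<eta> = min \<eta>0 1"
  have \<eta>: "0 < \<eta>" "\<eta> \<le> 1" "\<eta> \<le> \<eta>0" using \<eta>0(1) by (auto simp: \<eta>_def)
  have \<eta>2: "0 < \<eta>\<^sup>2" "\<eta>\<^sup>2 \<le> 1" using \<eta> by (auto simp: power_le_one)
  define m where "m = measure \<sigma> (ball ?e (\<eta> / 2) \<inter> ?S)"
  have m: "0 < m" unfolding m_def using \<eta> by (intro surface_measure_cap_pos norm_axis_complex) auto
  define a b where "a = 1 - \<eta>\<^sup>2 / 4" and "b = 1 - \<eta>\<^sup>2 / 8"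
  have ab: "0 < a" "a < b" "0 < b" using \<eta>2 by (auto simp: a_def b_def)
  have "(\<lambda>n. (a / b) ^ n) \<longlonglongrightarrow> 0"
    using ab by (intro LIMSEQ_power_zero) auto
  then have "\<forall>\<^sub>F n in sequentially. (a / b) ^ n < \<epsilon> * m / (4 * B)"
    using \<epsilon> m B by (intro order_tendstoD) auto
  then obtain n where n: "(a / b) ^ n < \<epsilon> * m / (4 * B)" by (metis eventually_happens sequentially_bot)
  then have n': "2 * B * a ^ n \<le> \<epsilon> / 2 * (m * b ^ n)"
    using B ab by (simp add: power_divide divide_simps split: if_splits) (simp add: mult_ac)
  let ?k = "\<lambda>w x :: complex^'d. (cmod (peak n w x))\<^sup>2"
  let ?M = "peak_mass TYPE('d) n"
  have mk: "m * b ^ n \<le> ?M"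
  proof -
    have "m * b ^ n = (LINT w|\<sigma>. indicator (ball ?e (\<eta> / 2) \<inter> ?S) w * b ^ n)"
      by (simp add: m_def surface.space_sphere Int_absorb2)
    also have "\<dots> \<le> (LINT w|\<sigma>. ?k w ?e)"
    proof (rule integral_mono)
      show "integrable \<sigma> (\<lambda>w. ?k w ?e)"
        by (intro surface.integrable_continuous continuous_intros continuous_on_peak)
      have "ball ?e (\<eta> / 2) \<inter> ?S \<in> sets \<sigma>"
        unfolding surface.sets_sphere by (auto simp: sets_restrict_space)
      then show "integrable \<sigma> (\<lambda>w. indicator (ball ?e (\<eta> / 2) \<inter> ?S) w * b ^ n)"
        by (intro integrable_mult_left integrable_real_indicator) (auto simp: less_top[symmetric])
      fix w :: "complex^'d" assume "w \<in> space \<sigma>"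
      then have w: "norm w = 1" by (simp add: surface.space_sphere)
      show "indicator (ball ?e (\<eta> / 2) \<inter> ?S) w * b ^ n \<le> ?k w ?e"
      proof (cases "dist ?e w < \<eta> / 2")
        case True
        let ?d = "(norm (?e - w))\<^sup>2"
        have "?d \<le> (\<eta> / 2)\<^sup>2" using True by (intro power_mono) (auto simp: dist_norm)
        then have d: "?d / 4 \<le> \<eta>\<^sup>2 / 16" by (simp add: power_divide)
        have "b \<le> (1 - \<eta>\<^sup>2 / 16)\<^sup>2" by (simp add: b_def power2_diff)
        also have "\<dots> \<le> (1 - ?d / 4)\<^sup>2"
          using d \<eta>2 by (intro power_mono) auto
        finally have "b ^ n \<le> ((1 - ?d / 4)\<^sup>2) ^ n" using ab by (intro power_mono) auto
        also have "\<dots> \<le> ?k w ?e" by (rule peak_lower[OF norm_axis_complex w])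
        finally show ?thesis by (simp add: indicator_def)
      qed auto
    qed
    finally show ?thesis by (simp add: peak_mass_def)
  qed
  have M: "0 < ?M" using mk m ab by (smt (verit) mult_pos_pos zero_less_power)
  have "\<bar>(LINT w|\<sigma>. \<psi> w * ?k w x) - ?M * \<psi> x\<bar> \<le> \<epsilon> * ?M" if x: "norm x = 1" for x :: "complex^'d"
  proof -
    have i1: "integrable \<sigma> (\<lambda>w. ?k w x)" and i2: "integrable \<sigma> (\<lambda>w. \<psi> w * ?k w x)"
      and i3: "integrable \<sigma> (\<lambda>w. \<bar>(\<psi> w - \<psi> x) * ?k w x\<bar>)"
      by (intro surface.integrable_continuous continuous_intros continuous_on_peak \<psi>)+
    have "(LINT w|\<sigma>. \<psi> w * ?k w x) - ?M * \<psi> x = (LINT w|\<sigma>. (\<psi> w - \<psi> x) * ?k w x)"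
      unfolding peak_mass_eq[OF x, symmetric] using i1 i2 by (simp add: left_diff_distrib mult.commute)
    also have "\<bar>\<dots>\<bar> \<le> (LINT w|\<sigma>. \<bar>(\<psi> w - \<psi> x) * ?k w x\<bar>)"
      using integral_norm_bound[of \<sigma> "\<lambda>w. (\<psi> w - \<psi> x) * ?k w x"] by simp
    also have "\<dots> \<le> (LINT w|\<sigma>. \<epsilon> / 2 * ?k w x + 2 * B * a ^ n)"
    proof (rule integral_mono[OF i3])
      show "integrable \<sigma> (\<lambda>w. \<epsilon> / 2 * ?k w x + 2 * B * a ^ n)" using i1 by simp
      fix w :: "complex^'d" assume "w \<in> space \<sigma>"
      then have w: "norm w = 1" by (simp add: surface.space_sphere)
      show "\<bar>(\<psi> w - \<psi> x) * ?k w x\<bar> \<le> \<epsilon> / 2 * ?k w x + 2 * B * a ^ n"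
      proof (cases "dist w x < \<eta>")
        case True
        then have "\<bar>\<psi> w - \<psi> x\<bar> \<le> \<epsilon> / 2" using \<eta>0(2)[OF x w] \<eta> by simp
        then have "\<bar>\<psi> w - \<psi> x\<bar> * ?k w x \<le> \<epsilon> / 2 * ?k w x" by (rule mult_right_mono) simp
        moreover have "0 \<le> 2 * B * a ^ n" using B ab by simp
        ultimately show ?thesis by (simp add: abs_mult)
      next
        case False
        let ?d = "(norm (x - w))\<^sup>2"
        have "\<eta>\<^sup>2 \<le> ?d" using False \<eta> by (intro power_mono) (auto simp: dist_norm norm_minus_commute)
        moreover have "?d \<le> 4"
        proof -
          have "norm (x - w) \<le> 2" using norm_triangle_ineq4[of x w] x w by simp
          then show ?thesis using power_mono[of "norm (x - w)" 2 2] by simp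
        qed
        ultimately have "(1 - ?d / 4) ^ n \<le> a ^ n" by (intro power_mono) (auto simp: a_def)
        then have k: "?k w x \<le> a ^ n" using peak_upper[OF x w, of n] by simp
        have "\<bar>\<psi> w - \<psi> x\<bar> \<le> 2 * B" using B(2)[OF x] B(2)[OF w] by simp
        then have "\<bar>\<psi> w - \<psi> x\<bar> * ?k w x \<le> 2 * B * a ^ n" using k ab B by (intro mult_mono) auto
        then show ?thesis using \<epsilon> by (simp add: abs_mult add_increasing)
      qed
    qed
    also have "\<dots> = \<epsilon> / 2 * ?M + 2 * B * a ^ n"
      using i1 by (simp add: peak_mass_eq[OF x] surface.prob_space)
    also have "\<dots> \<le> \<epsilon> * ?M"
    proof -
      have "\<epsilon> / 2 * (m * b ^ n) \<le> \<epsilon> / 2 * ?M" using mk \<epsilon> by (intro mult_left_mono) auto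
      then show ?thesis using n' by simp
    qed
    finally show ?thesis .
  qed
  then show ?thesis using M by blast
qed

section \<open>Peak functions order the measures on the sphere\<close>

lemma (in sphere_measure) peak_fubini:
  fixes \<psi> :: "complex^'d \<Rightarrow> real"
  assumes \<psi>: "continuous_on UNIV \<psi>"
  defines "k n w z \<equiv> (cmod (peak n w z))\<^sup>2"
  shows "(LINT z|\<mu>. LINT w|\<sigma>. \<psi> w * k n w z) = (LINT w|\<sigma>. \<psi> w * (LINT z|\<mu>. k n w z))"
    and "integrable \<mu> (\<lambda>z. LINT w|\<sigma>. \<psi> w * k n w z)"
    and "integrable \<sigma> (\<lambda>w. \<psi> w * (LINT z|\<mu>. k n w z))"
proof -
  interpret P: pair_sigma_finite \<mu> \<sigma> ..
  interpret Q: pair_sigma_finite \<sigma> \<mu> ..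
  interpret PF: finite_measure "\<mu> \<Otimes>\<^sub>M \<sigma>"
    by (rule finite_measure_pair_measure) unfold_locales
  let ?F = "\<lambda>p. \<psi> (snd p) * k n (snd p) (fst p)"
  have c: "continuous_on UNIV ?F"
    unfolding k_def
    by (intro continuous_intros continuous_on_peak continuous_on_compose2[OF \<psi>]) auto
  have "(\<lambda>p. (fst p, snd p)) \<in> \<mu> \<Otimes>\<^sub>M \<sigma> \<rightarrow>\<^sub>M borel \<Otimes>\<^sub>M borel"
    by (intro measurable_Pair measurable_compose[OF measurable_fst] measurable_compose[OF measurable_snd]
        measurable_of_borel surface.measurable_of_borel measurable_ident_sets refl)
  then have id: "(\<lambda>p. p) \<in> \<mu> \<Otimes>\<^sub>M \<sigma> \<rightarrow>\<^sub>M borel" by (simp add: borel_prod)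
  have m: "?F \<in> borel_measurable (\<mu> \<Otimes>\<^sub>M \<sigma>)"
    using measurable_compose[OF id borel_measurable_continuous_onI[OF c]] by simp
  have sp: "space (\<mu> \<Otimes>\<^sub>M \<sigma>) = sphere 0 1 \<times> sphere 0 1"
    by (simp add: space_pair_measure space_sphere surface.space_sphere)
  have "bounded (?F ` (sphere 0 1 \<times> sphere 0 1))"
    by (intro compact_imp_bounded compact_continuous_image continuous_on_subset[OF c] compact_Times) auto
  then obtain B where B: "\<And>p. p \<in> sphere 0 1 \<times> sphere 0 1 \<Longrightarrow> norm (?F p) \<le> B"
    unfolding bounded_iff by blast
  have int: "integrable (\<mu> \<Otimes>\<^sub>M \<sigma>) ?F"
    by (rule PF.integrable_const_bound[OF AE_I2 m]) (rule B, simp add: sp)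
  then have int': "integrable (\<mu> \<Otimes>\<^sub>M \<sigma>) (\<lambda>(z, w). \<psi> w * k n w z)"
    by (simp add: split_beta')
  show "integrable \<mu> (\<lambda>z. LINT w|\<sigma>. \<psi> w * k n w z)"
    using P.integrable_fst'[OF int] by simp
  show "integrable \<sigma> (\<lambda>w. \<psi> w * (LINT z|\<mu>. k n w z))"
    using Q.integrable_fst'[OF P.integrable_product_swap[OF int]] by simp
  show "(LINT z|\<mu>. LINT w|\<sigma>. \<psi> w * k n w z) = (LINT w|\<sigma>. \<psi> w * (LINT z|\<mu>. k n w z))"
    using P.Fubini_integral[OF int'] by simp
qed

text \<open>Averaging a function against the kernel and then integrating it is, by Fubini, the same as
integrating it against the function \<open>w \<mapsto> \<integral>|peak n w|\<^sup>2 d\<mu>\<close>, whose values are squared norms of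
polynomials.\<close>

lemma (in sphere_measure) peak_smoothing_error:
  fixes \<psi> :: "complex^'d \<Rightarrow> real"
  assumes \<psi>: "continuous_on UNIV \<psi>"
    and n: "\<And>x. norm x = 1 \<Longrightarrow>
      \<bar>(LINT w|\<sigma>. \<psi> w * (cmod (peak n w x))\<^sup>2) - M * \<psi> x\<bar> \<le> e"
  shows "\<bar>(LINT w|\<sigma>. \<psi> w * (LINT z|\<mu>. (cmod (peak n w z))\<^sup>2)) - M * (LINT z|\<mu>. \<psi> z)\<bar>
      \<le> e * measure \<mu> (space \<mu>)"
proof -
  let ?J = "\<lambda>z. LINT w|\<sigma>. \<psi> w * (cmod (peak n w z))\<^sup>2"
  note fub = peak_fubini[OF \<psi>, of n]
  have i: "integrable \<mu> (\<lambda>z. ?J z - M * \<psi> z)"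
    by (intro Bochner_Integration.integrable_diff fub(2) integrable_mult_right integrable_continuous \<psi>)
  have "(LINT w|\<sigma>. \<psi> w * (LINT z|\<mu>. (cmod (peak n w z))\<^sup>2)) - M * (LINT z|\<mu>. \<psi> z) =
      (LINT z|\<mu>. ?J z - M * \<psi> z)"
    using fub(2) integrable_continuous[OF \<psi>] by (simp flip: fub(1))
  also have "\<bar>\<dots>\<bar> \<le> (LINT z|\<mu>. \<bar>?J z - M * \<psi> z\<bar>)"
    using integral_norm_bound[of \<mu> "\<lambda>z. ?J z - M * \<psi> z"] by simp
  also have "\<dots> \<le> (LINT z|\<mu>. e)"
    by (rule integral_mono) (use i n in \<open>auto simp: in_space_iff\<close>)
  finally show ?thesis by (simp add: mult.commute)
qed

text \<open>Both integrals are limits of integrals of \<open>\<psi>\<close> against the functions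
\<open>w \<mapsto> \<integral>|peak n w|\<^sup>2\<close>, which are ordered by hypothesis.\<close>

lemma integral_le_of_peak_le:
  fixes \<mu> \<nu> :: "(complex^'d) measure" and \<psi> :: "complex^'d \<Rightarrow> real"
  assumes \<mu>: "sphere_measure \<mu>" and \<nu>: "sphere_measure \<nu>" and C: "0 \<le> C"
    and le: "\<And>n w. norm w = 1 \<Longrightarrow>
      (LINT z|\<mu>. (cmod (peak n w z))\<^sup>2) \<le> C * (LINT z|\<nu>. (cmod (peak n w z))\<^sup>2)"
    and \<psi>: "continuous_on UNIV \<psi>" "\<And>z. 0 \<le> \<psi> z"
  shows "(LINT z|\<mu>. \<psi> z) \<le> C * (LINT z|\<nu>. \<psi> z)"
proof (rule ccontr)
  interpret \<mu>: sphere_measure \<mu> by fact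
  interpret \<nu>: sphere_measure \<nu> by fact
  let ?I = "LINT z|\<mu>. \<psi> z" and ?I' = "LINT z|\<nu>. \<psi> z"
  \<comment> \<open>The summand 1 makes the smoothing errors strictly smaller than the gap to be refuted.\<close>
  define T where "T = measure \<mu> (space \<mu>) + C * measure \<nu> (space \<nu>) + 1"
  have T: "0 < T" using C by (simp add: T_def add_nonneg_pos)
  assume "\<not> ?I \<le> C * ?I'"
  then have D: "0 < (?I - C * ?I') / T" using T by simp
  obtain n where M: "0 < peak_mass TYPE('d) n" and n: "\<And>x. norm x = 1 \<Longrightarrow>
    \<bar>(LINT w|\<sigma>. \<psi> w * (cmod (peak n w x))\<^sup>2) - peak_mass TYPE('d) n * \<psi> x\<bar>
      \<le> (?I - C * ?I') / T * peak_mass TYPE('d) n"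
    using peak_approximate_identity[OF \<psi>(1) D] by blast
  let ?M = "peak_mass TYPE('d) n" and ?e = "(?I - C * ?I') / T * peak_mass TYPE('d) n"
  let ?J = "LINT w|\<sigma>. \<psi> w * (LINT z|\<mu>. (cmod (peak n w z))\<^sup>2)"
    and ?J' = "LINT w|\<sigma>. \<psi> w * (LINT z|\<nu>. (cmod (peak n w z))\<^sup>2)"
  have e: "0 < ?e" by (rule mult_pos_pos[OF D M])
  have "?J \<le> (LINT w|\<sigma>. C * (\<psi> w * (LINT z|\<nu>. (cmod (peak n w z))\<^sup>2)))"
  proof (rule integral_mono)
    fix w :: "complex^'d" assume "w \<in> space \<sigma>"
    then have "norm w = 1" by (simp add: surface.in_space_iff)
    from mult_left_mono[OF le[OF this, of n] \<psi>(2)]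
    show "\<psi> w * (LINT z|\<mu>. (cmod (peak n w z))\<^sup>2) \<le> C * (\<psi> w * (LINT z|\<nu>. (cmod (peak n w z))\<^sup>2))"
      by (simp add: mult_ac)
  qed (intro \<mu>.peak_fubini(3) \<nu>.peak_fubini(3) integrable_mult_right \<psi>)+
  then have "?J \<le> C * ?J'" by simp
  moreover have "?M * ?I - ?e * measure \<mu> (space \<mu>) \<le> ?J"
    using \<mu>.peak_smoothing_error[OF \<psi>(1) n] by linarith
  moreover have "?J' \<le> ?M * ?I' + ?e * measure \<nu> (space \<nu>)"
    using \<nu>.peak_smoothing_error[OF \<psi>(1) n] by linarith
  then have "C * ?J' \<le> C * (?M * ?I' + ?e * measure \<nu> (space \<nu>))" using C by (rule mult_left_mono)
  ultimately have "?M * ?I - ?e * measure \<mu> (space \<mu>) \<le> C * (?M * ?I' + ?e * measure \<nu> (space \<nu>))"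
    by linarith
  moreover have "M * (I - C * I') \<le> e * (a + C * b + 1 - 1)"
    if "M * I - e * a \<le> C * (M * I' + e * b)" for M I I' e a b :: real
    using that by (simp add: algebra_simps)
  ultimately have "?M * (?I - C * ?I') \<le> ?e * (T - 1)" unfolding T_def by blast
  also have "\<dots> < ?e * T" by (rule mult_strict_left_mono[OF _ e]) simp
  also have "\<dots> = ?M * (?I - C * ?I')" using T by simp
  finally show False by simp
qed

text \<open>Indicators of compact sets are limits of continuous functions, and compact sets exhaust Borel sets.
Hence two finite measures on the sphere are ordered as soon as the \<open>L\<^sup>2\<close> norms of the polynomials
\<open>peak n w\<close> are: inequalities between Hardy space norms turn into inequalities between measures.\<close>

lemma measure_le_of_peak_le:
  fixes \<mu> \<nu> :: "(complex^'d) measure"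
  assumes \<mu>: "sphere_measure \<mu>" and \<nu>: "sphere_measure \<nu>" and C: "0 \<le> C"
    and le: "\<And>n w. norm w = 1 \<Longrightarrow>
      (LINT z|\<mu>. (cmod (peak n w z))\<^sup>2) \<le> C * (LINT z|\<nu>. (cmod (peak n w z))\<^sup>2)"
  shows "\<mu> \<le> scale_measure (ennreal C) \<nu>"
proof -
  interpret \<mu>: sphere_measure \<mu> by fact
  interpret \<nu>: sphere_measure \<nu> by fact
  have compact: "measure \<mu> (K \<inter> sphere 0 1) \<le> C * measure \<nu> (K \<inter> sphere 0 1)"
    if K: "compact K" for K :: "(complex^'d) set"
  proof (cases "K = {}")
    case False
    define \<psi> where "\<psi> m x = max 0 (1 - real m * infdist x K)" for m x
    have c: "continuous_on UNIV (\<psi> m)" for m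
      unfolding \<psi>_def by (intro continuous_intros)
    have lim: "(\<lambda>m. \<psi> m x) \<longlonglongrightarrow> indicator K x" for x
    proof (cases "x \<in> K")
      case True
      then show ?thesis by (simp add: \<psi>_def)
    next
      case nK: False
      then have pos: "0 < infdist x K"
        using in_closed_iff_infdist_zero[OF compact_imp_closed[OF K] False, of x] infdist_nonneg[of x K]
        by simp
      obtain m0 :: nat where m0: "1 / infdist x K < real m0" using reals_Archimedean2 by blast
      have "\<psi> m x = 0" if "m0 \<le> m" for m
      proof -
        have "1 / infdist x K < real m" using m0 that by linarith
        then show ?thesis using pos by (simp add: \<psi>_def divide_simps mult.commute)
      qed
      then have "\<forall>\<^sub>F m in sequentially. \<psi> m x = 0" unfolding eventually_sequentially by blast
      then show ?thesis using nK by (simp add: tendsto_eventually)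
    qed
    have dct: "(\<lambda>m. LINT z|M. \<psi> m z) \<longlonglongrightarrow> measure M (K \<inter> sphere 0 1)"
      if "sphere_measure M" for M :: "(complex^'d) measure"
    proof -
      interpret M: sphere_measure M by fact
      have "(\<lambda>m. LINT z|M. \<psi> m z) \<longlonglongrightarrow> (LINT z|M. indicator K z)"
      proof (rule integral_dominated_convergence[where w = "\<lambda>_. 1"])
        show "(\<lambda>z. indicator K z :: real) \<in> borel_measurable M"
          by (rule M.measurable_of_borel) (use K in \<open>intro borel_measurable_indicator borel_compact\<close>)
        show "\<And>i. AE x in M. norm (\<psi> i x) \<le> 1" by (auto simp: \<psi>_def infdist_nonneg)
      qed (use lim c in \<open>auto intro: M.measurable_continuous\<close>)
      then show ?thesis by (simp add: M.space_sphere)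
    qed
    have "(LINT z|\<mu>. \<psi> m z) \<le> C * (LINT z|\<nu>. \<psi> m z)" for m
      by (rule integral_le_of_peak_le[OF \<mu> \<nu> C le c]) (auto simp: \<psi>_def)
    then show ?thesis
      by (intro LIMSEQ_le[OF dct[OF \<mu>] tendsto_mult_left[OF dct[OF \<nu>]]]) auto
  qed auto
  have "emeasure \<mu> A \<le> ennreal C * emeasure \<nu> A" if A: "A \<in> sets \<mu>" for A
  proof -
    have id: "(\<lambda>z. z) \<in> \<mu> \<rightarrow>\<^sub>M borel" by (rule \<mu>.measurable_of_borel) simp
    from A have A': "A \<in> sets borel" "A \<subseteq> sphere 0 1"
      by (auto simp: \<mu>.sets_sphere sets_restrict_space)
    define N where "N = distr \<mu> borel (\<lambda>z. z)"
    have N: "emeasure N B = emeasure \<mu> (B \<inter> sphere 0 1)" if "B \<in> sets borel" for B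
      using that by (simp add: N_def emeasure_distr[OF id] \<mu>.space_sphere)
    have "emeasure \<mu> A = emeasure N A" using A' by (simp add: N Int_absorb2)
    also have "\<dots> = (SUP K \<in> {K. K \<subseteq> A \<and> compact K}. emeasure N K)"
      using A' by (intro inner_regular) (auto simp: N_def emeasure_distr[OF id])
    also have "\<dots> \<le> ennreal C * emeasure \<nu> A"
    proof (rule SUP_least)
      fix K assume "K \<in> {K. K \<subseteq> A \<and> compact K}"
      then have K: "K \<subseteq> A" "compact K" by auto
      have "emeasure N K = measure \<mu> (K \<inter> sphere 0 1)"
        using K by (simp add: N borel_compact \<mu>.emeasure_eq_measure)
      also have "\<dots> \<le> ennreal (C * measure \<nu> (K \<inter> sphere 0 1))"
        using compact[OF K(2)] by (rule ennreal_leI)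
      also have "\<dots> = ennreal C * emeasure \<nu> (K \<inter> sphere 0 1)"
        using C by (simp add: ennreal_mult \<nu>.emeasure_eq_measure)
      also have "\<dots> \<le> ennreal C * emeasure \<nu> A"
        using K A by (intro mult_left_mono emeasure_mono) (auto simp: \<mu>.sets_sphere \<nu>.sets_sphere)
      finally show "emeasure N K \<le> ennreal C * emeasure \<nu> A" .
    qed
    finally show ?thesis .
  qed
  moreover have "emeasure \<mu> A = 0" if "A \<notin> sets \<mu>" for A
    using that by (rule emeasure_notin_sets)
  ultimately show ?thesis
    by (subst le_measure) (auto simp: \<mu>.sets_sphere \<nu>.sets_sphere)
qed

section \<open>Polynomial functions\<close>

lemma cmonomial_add: "cmonomial (\<lambda>i. \<alpha> i + \<beta> i) z = cmonomial \<alpha> z * cmonomial \<beta> z"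
  by (simp add: cmonomial_def power_add prod.distrib)

lemma cmonomial_unit: "cmonomial (\<lambda>i. if i = j then 1 else 0) z = z $ j"
proof -
  have "cmonomial (\<lambda>i. if i = j then 1 else 0) z = (\<Prod>i\<in>UNIV. if i = j then z $ i else 1)"
    unfolding cmonomial_def by (rule prod.cong) auto
  then show ?thesis by simp
qed

lemma polynomial_monomial: "(\<lambda>z. c * cmonomial \<alpha> z) \<in> polynomial_functions"
  unfolding polynomial_functions_def by (auto intro!: exI[of _ "{\<alpha>}"] exI[of _ "\<lambda>_. c"])

lemma polynomial_const: "(\<lambda>_. c) \<in> polynomial_functions"
  using polynomial_monomial[of c "\<lambda>_. 0"] by (simp add: cmonomial_def)

lemma polynomial_add:
  assumes "p \<in> polynomial_functions" "q \<in> polynomial_functions"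
  shows "(\<lambda>z. p z + q z) \<in> polynomial_functions"
proof -
  obtain A c where A: "finite A" "p = (\<lambda>z. \<Sum>\<alpha>\<in>A. c \<alpha> * cmonomial \<alpha> z)"
    using assms(1) by (auto simp: polynomial_functions_def)
  obtain B d where B: "finite B" "q = (\<lambda>z. \<Sum>\<alpha>\<in>B. d \<alpha> * cmonomial \<alpha> z)"
    using assms(2) by (auto simp: polynomial_functions_def)
  define e where "e \<alpha> = (if \<alpha> \<in> A then c \<alpha> else 0) + (if \<alpha> \<in> B then d \<alpha> else 0)" for \<alpha>
  have "p z + q z = (\<Sum>\<alpha>\<in>A \<union> B. e \<alpha> * cmonomial \<alpha> z)" for z
  proof -
    have "p z = (\<Sum>\<alpha>\<in>A \<union> B. (if \<alpha> \<in> A then c \<alpha> else 0) * cmonomial \<alpha> z)"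
      unfolding A(2) using A(1) B(1) by (intro sum.mono_neutral_cong_left) auto
    moreover have "q z = (\<Sum>\<alpha>\<in>A \<union> B. (if \<alpha> \<in> B then d \<alpha> else 0) * cmonomial \<alpha> z)"
      unfolding B(2) using A(1) B(1) by (intro sum.mono_neutral_cong_left) auto
    ultimately show ?thesis by (simp add: e_def distrib_right sum.distrib)
  qed
  then show ?thesis unfolding polynomial_functions_def using A(1) B(1) by blast
qed

lemma polynomial_sum:
  assumes "finite A" "\<And>i. i \<in> A \<Longrightarrow> p i \<in> polynomial_functions"
  shows "(\<lambda>z. \<Sum>i\<in>A. p i z) \<in> polynomial_functions"
  using assms by (induction A) (auto simp: polynomial_const polynomial_add)

lemma polynomial_mult:
  assumes "p \<in> polynomial_functions" "q \<in> polynomial_functions"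
  shows "(\<lambda>z. p z * q z) \<in> polynomial_functions"
proof -
  obtain A c where A: "finite A" "p = (\<lambda>z. \<Sum>\<alpha>\<in>A. c \<alpha> * cmonomial \<alpha> z)"
    using assms(1) by (auto simp: polynomial_functions_def)
  obtain B d where B: "finite B" "q = (\<lambda>z. \<Sum>\<alpha>\<in>B. d \<alpha> * cmonomial \<alpha> z)"
    using assms(2) by (auto simp: polynomial_functions_def)
  have "p z * q z = (\<Sum>\<alpha>\<in>A. \<Sum>\<beta>\<in>B. (c \<alpha> * d \<beta>) * cmonomial (\<lambda>i. \<alpha> i + \<beta> i) z)" for z
    unfolding A(2) B(2) by (simp add: sum_product cmonomial_add mult_ac)
  then show ?thesis using A(1) B(1) by (auto intro!: polynomial_sum polynomial_monomial)
qed

lemma polynomial_coord: "(\<lambda>z. z $ j) \<in> polynomial_functions"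
  using polynomial_monomial[of 1 "\<lambda>i. if i = j then 1 else 0"] by (simp add: cmonomial_unit)

lemma polynomial_power:
  "p \<in> polynomial_functions \<Longrightarrow> (\<lambda>z. p z ^ n) \<in> polynomial_functions"
  by (induction n) (auto simp: polynomial_const polynomial_mult)

text \<open>Monomials are peeled one coordinate at a time, so a property that is stable under the shifts
\<open>z_j\<close> and under sums, and holds for constants, holds for all polynomials.  This is the form in which
intertwining relations are used.\<close>

lemma polynomial_induct [consumes 1, case_names const add coord]:
  assumes p: "p \<in> polynomial_functions"
    and const: "\<And>c. P (\<lambda>_. c)"
    and add: "\<And>p q. p \<in> polynomial_functions \<Longrightarrow> q \<in> polynomial_functions \<Longrightarrow> P p \<Longrightarrow> P q \<Longrightarrow> P (\<lambda>z. p z + q z)"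
    and coord: "\<And>p j. p \<in> polynomial_functions \<Longrightarrow> P p \<Longrightarrow> P (\<lambda>z. z $ j * p z)"
  shows "P p"
proof -
  have mono: "P (\<lambda>z. c * cmonomial \<alpha> z)" for c and \<alpha> :: "'a \<Rightarrow> nat"
  proof (induction "\<Sum>j\<in>UNIV. \<alpha> j" arbitrary: \<alpha>)
    case 0
    then have "\<alpha> = (\<lambda>_. 0)" by (simp add: fun_eq_iff)
    then show ?case using const[of c] by (simp add: cmonomial_def)
  next
    case (Suc k)
    then obtain j where j: "\<alpha> j \<noteq> 0" by (metis Zero_not_Suc sum.neutral)
    define \<beta> where "\<beta> = (\<lambda>i. if i = j then \<alpha> j - 1 else \<alpha> i)"
    have \<alpha>: "\<alpha> = (\<lambda>i. (if i = j then 1 else 0) + \<beta> i)" using j by (auto simp: \<beta>_def)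
    have "(\<Sum>i\<in>UNIV. \<alpha> i) = 1 + (\<Sum>i\<in>UNIV. \<beta> i)"
      by (subst \<alpha>) (simp add: sum.distrib)
    then have "k = (\<Sum>i\<in>UNIV. \<beta> i)" using Suc(2) by simp
    from coord[OF polynomial_monomial Suc(1)[OF this], of j] show ?case
      by (subst \<alpha>) (simp add: cmonomial_add cmonomial_unit mult_ac)
  qed
  obtain A c where A: "finite A" "p = (\<lambda>z. \<Sum>\<alpha>\<in>A. c \<alpha> * cmonomial \<alpha> z)"
    using p by (auto simp: polynomial_functions_def)
  show ?thesis unfolding A(2) using A(1)
  proof (induction A)
    case empty
    then show ?case using const[of 0] by simp
  next
    case (insert \<alpha> A)
    then show ?case
      by (simp add: add polynomial_monomial polynomial_sum mono)
  qed
qed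

lemma continuous_on_polynomial:
  assumes "p \<in> polynomial_functions"
  shows "continuous_on UNIV p"
  using assms by (induction rule: polynomial_induct) (auto intro!: continuous_intros)

lemma polynomial_compose_unitary:
  assumes "p \<in> polynomial_functions"
  shows "(\<lambda>z. p (u *v z)) \<in> polynomial_functions"
  using assms
proof (induction rule: polynomial_induct)
  case (coord p j)
  have "(\<lambda>z. \<Sum>k\<in>UNIV. u $ j $ k * z $ k) \<in> polynomial_functions"
    by (intro polynomial_sum polynomial_mult polynomial_const polynomial_coord) auto
  then show ?case
    using polynomial_mult[OF _ coord.IH] by (simp add: matrix_vector_mult_def)
qed (auto intro: polynomial_const polynomial_add)

lemma polynomial_peak: "peak n w \<in> polynomial_functions"
proof -
  have "(\<lambda>z. ((1 + (\<Sum>j\<in>UNIV. z $ j * cnj (w $ j))) * (1 / 2)) ^ n) \<in> polynomial_functions"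
    by (intro polynomial_power polynomial_mult polynomial_add polynomial_const polynomial_sum polynomial_coord) auto
  then show ?thesis by (simp add: peak_def[abs_def] herm_def)
qed

section \<open>The norm of L2\<close>

definition l2norm :: "'a measure \<Rightarrow> ('a \<Rightarrow> complex) \<Rightarrow> real" where
  "l2norm M f = sqrt (LINT z|M. (cmod (f z))\<^sup>2)"

lemma l2norm_nonneg [simp]: "0 \<le> l2norm M f"
  by (simp add: l2norm_def)

lemma l2norm_square: "(l2norm M f)\<^sup>2 = (LINT z|M. (cmod (f z))\<^sup>2)"
  by (simp add: l2norm_def)

lemma cnorm_L2: "f \<in> borel_measurable M \<Longrightarrow> cnorm (L2_space M) (ae_class M f) = l2norm M f"
proof -
  assume f: "f \<in> borel_measurable M"
  have "(LINT z|M. f z * cnj (f z)) = complex_of_real (LINT z|M. (cmod (f z))\<^sup>2)"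
    by (simp add: complex_norm_square[symmetric] flip: of_real_power integral_complex_of_real)
  then show ?thesis by (simp add: cnorm_def L2_cinner[OF f f] l2norm_def)
qed

lemma square_integrable_diff:
  "square_integrable M f \<Longrightarrow> square_integrable M g \<Longrightarrow> square_integrable M (\<lambda>z. f z - g z)"
  using square_integrable_add[OF _ square_integrable_cmult[of M g "-1"]] by simp

lemma l2norm_cmult: "l2norm M (\<lambda>z. c * f z) = cmod c * l2norm M f"
  by (simp add: l2norm_def norm_mult power_mult_distrib real_sqrt_mult)

text \<open>From \<open>|x + y|\<^sup>2 \<le> (1 + t)|x|\<^sup>2 + (1 + 1/t)|y|\<^sup>2\<close> with the optimal \<open>t\<close>, the ratio of the two norms; half of a
small \<open>e\<close> is added to both norms so that the ratio is defined.\<close>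

lemma l2norm_triangle:
  assumes f: "square_integrable M f" and g: "square_integrable M g"
  shows "l2norm M (\<lambda>z. f z + g z) \<le> l2norm M f + l2norm M g"
proof -
  let ?F = "LINT z|M. (cmod (f z))\<^sup>2" and ?G = "LINT z|M. (cmod (g z))\<^sup>2"
  have int: "integrable M (\<lambda>z. (cmod (f z))\<^sup>2)" "integrable M (\<lambda>z. (cmod (g z))\<^sup>2)"
    "integrable M (\<lambda>z. (cmod (f z + g z))\<^sup>2)"
    using f g square_integrable_add[OF f g] by (auto simp: square_integrable_def)
  have weighted: "(LINT z|M. (cmod (f z + g z))\<^sup>2) \<le> (1 + t) * ?F + (1 + 1 / t) * ?G" if t: "0 < t" for t :: real
  proof -
    have "(cmod (a + b))\<^sup>2 \<le> (1 + t) * (cmod a)\<^sup>2 + (1 + 1 / t) * (cmod b)\<^sup>2" for a b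
    proof -
      have "(cmod (a + b))\<^sup>2 \<le> (cmod a + cmod b)\<^sup>2" by (intro power_mono norm_triangle_ineq) simp
      moreover have "(1 + t) * (cmod a)\<^sup>2 + (1 + 1 / t) * (cmod b)\<^sup>2 - (cmod a + cmod b)\<^sup>2 = (t * cmod a - cmod b)\<^sup>2 / t"
        using t by (simp add: field_simps power2_eq_square)
      moreover have "0 \<le> (t * cmod a - cmod b)\<^sup>2 / t" using t by simp
      ultimately show ?thesis by linarith
    qed
    then have "(LINT z|M. (cmod (f z + g z))\<^sup>2) \<le> (LINT z|M. (1 + t) * (cmod (f z))\<^sup>2 + (1 + 1 / t) * (cmod (g z))\<^sup>2)"
      using int by (intro integral_mono) auto
    then show ?thesis using int by simp
  qed
  define a b where "a = l2norm M f" and "b = l2norm M g"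
  have ab: "0 \<le> a" "0 \<le> b" "?F = a\<^sup>2" "?G = b\<^sup>2" by (auto simp: a_def b_def l2norm_square)
  have "(LINT z|M. (cmod (f z + g z))\<^sup>2) \<le> (a + b + e)\<^sup>2" if e: "0 < e" for e
  proof -
    let ?t = "(b + e / 2) / (a + e / 2)"
    have "(1 + ?t) * a\<^sup>2 + (1 + 1 / ?t) * b\<^sup>2 \<le> (1 + ?t) * (a + e / 2)\<^sup>2 + (1 + 1 / ?t) * (b + e / 2)\<^sup>2"
      using ab e by (intro add_mono mult_left_mono power_mono) auto
    also have "\<dots> = (a + b + e)\<^sup>2"
    proof -
      have "(1 + y / x) * x\<^sup>2 + (1 + 1 / (y / x)) * y\<^sup>2 = (x + y)\<^sup>2" if "0 < x" "0 < y" for x y :: real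
        using that by (simp add: field_simps power2_eq_square)
      from this[of "a + e / 2" "b + e / 2"] show ?thesis using ab e by (simp add: add_ac)
    qed
    finally show ?thesis using weighted[of ?t] ab e by (simp add: add_nonneg_pos)
  qed
  then have "l2norm M (\<lambda>z. f z + g z) \<le> a + b + e" if "0 < e" for e
    unfolding l2norm_def using ab that by (intro real_le_lsqrt) auto
  then show ?thesis unfolding a_def b_def by (rule field_le_epsilon)
qed

lemma l2norm_diff_commute: "l2norm M (\<lambda>z. f z - g z) = l2norm M (\<lambda>z. g z - f z)"
  by (simp add: l2norm_def norm_minus_commute)

lemma l2norm_triangle_diff:
  assumes f: "square_integrable M f" and g: "square_integrable M g"
  shows "l2norm M f \<le> l2norm M g + l2norm M (\<lambda>z. f z - g z)"
  using l2norm_triangle[OF g square_integrable_diff[OF f g]] by simp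

lemma (in finite_measure) integral_le_l2norm:
  assumes "square_integrable M f"
  shows "integrable M f" "cmod (LINT z|M. f z) \<le> sqrt (measure M (space M) + 1) * l2norm M f"
proof -
  have [measurable]: "f \<in> borel_measurable M" and i: "integrable M (\<lambda>z. (cmod (f z))\<^sup>2)"
    using assms by (auto simp: square_integrable_def)
  have "integrable M (\<lambda>z. (f z)\<^sup>2)"
    by (rule integrable_norm_iff[THEN iffD1]) (use i in \<open>simp_all add: norm_power\<close>)
  then show int: "integrable M f"
    by (rule square_integrable_imp_integrable[rotated]) simp
  \<comment> \<open>The summand 1 allows division by \<open>m\<close> also for the zero measure.\<close>
  define m where "m = measure M (space M) + 1"
  have m: "0 < m" by (simp add: m_def add_nonneg_pos)
  let ?A = "LINT z|M. cmod (f z)"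
  have "0 \<le> (LINT z|M. (m * cmod (f z) - ?A)\<^sup>2)" by simp
  also have "\<dots> = (LINT z|M. m\<^sup>2 * (cmod (f z))\<^sup>2 - 2 * m * ?A * cmod (f z) + ?A\<^sup>2)"
    by (rule Bochner_Integration.integral_cong) (simp_all add: power2_eq_square algebra_simps)
  also have "\<dots> = m\<^sup>2 * (l2norm M f)\<^sup>2 - 2 * m * ?A\<^sup>2 + (m - 1) * ?A\<^sup>2"
    unfolding l2norm_square using i int by (simp add: m_def power2_eq_square)
  also have "\<dots> \<le> m * (m * (l2norm M f)\<^sup>2 - ?A\<^sup>2)"
    by (simp add: algebra_simps power2_eq_square)
  finally have "?A\<^sup>2 \<le> m * (l2norm M f)\<^sup>2" using m by (simp add: zero_le_mult_iff)
  then have "?A \<le> sqrt (m * (l2norm M f)\<^sup>2)" by (rule real_le_rsqrt)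
  then have "?A \<le> sqrt m * l2norm M f" by (simp add: real_sqrt_mult)
  then show "cmod (LINT z|M. f z) \<le> sqrt (measure M (space M) + 1) * l2norm M f"
    using integral_norm_bound[of M f] unfolding m_def by linarith
qed

section \<open>Hardy spaces and operators on them\<close>

text \<open>Elements of the Hardy space are classes of functions.  This predicate describes the representatives
(see \<open>carrier_hardy\<close>), so that operators can be studied on functions.\<close>

definition hardy_function :: "(complex^'d) measure \<Rightarrow> (complex^'d \<Rightarrow> complex) \<Rightarrow> bool" where
  "hardy_function \<mu> f \<longleftrightarrow> square_integrable \<mu> f \<and>
     (\<forall>e>0. \<exists>p\<in>polynomial_functions. l2norm \<mu> (\<lambda>z. f z - p z) < e)"

lemma hardy_functionD:
  assumes "hardy_function \<mu> f"
  shows "square_integrable \<mu> f" "f \<in> borel_measurable \<mu>"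
  using assms by (auto simp: hardy_function_def square_integrable_def)

lemma L2_minus:
  assumes f: "square_integrable M f" and g: "square_integrable M g"
  shows "ae_class M f \<ominus>\<^bsub>L2_space M\<^esub> ae_class M g = ae_class M (\<lambda>z. f z - g z)"
proof -
  note [measurable] = square_integrable_measurable[OF f] square_integrable_measurable[OF g]
  have "\<ominus>\<^bsub>L2_space M\<^esub> ae_class M g = ae_class M (\<lambda>z. -1 * g z)"
    by (rule abelian_group.minus_equality[OF abelian_group_L2])
       (use square_integrable_cmult[OF g, of "-1"] g in \<open>simp_all add: L2_add zero_L2 L2_carrierI\<close>)
  then show ?thesis by (simp add: a_minus_def L2_add)
qed

lemma hardy_space_simps:
  "\<zero>\<^bsub>hardy_space \<mu>\<^esub> = ae_class \<mu> (\<lambda>_. 0)"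
  "x \<oplus>\<^bsub>hardy_space \<mu>\<^esub> y = x \<oplus>\<^bsub>L2_space \<mu>\<^esub> y"
  "c \<odot>\<^bsub>hardy_space \<mu>\<^esub> x = c \<odot>\<^bsub>L2_space \<mu>\<^esub> x"
  "cinner (hardy_space \<mu>) = cinner (L2_space \<mu>)"
  "cnorm (hardy_space \<mu>) = cnorm (L2_space \<mu>)"
  by (simp_all add: hardy_space_def zero_L2 cnorm_def[abs_def])

context sphere_measure
begin

lemma square_integrable_continuous_mult:
  assumes g: "continuous_on UNIV g" and f: "square_integrable \<mu> f"
    and B: "\<And>z. norm z = 1 \<Longrightarrow> cmod (g z) \<le> B"
  shows "square_integrable \<mu> (\<lambda>z. g z * f z)" "l2norm \<mu> (\<lambda>z. g z * f z) \<le> B * l2norm \<mu> f"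
proof -
  have [measurable]: "f \<in> borel_measurable \<mu>" and i: "integrable \<mu> (\<lambda>z. (cmod (f z))\<^sup>2)"
    using f by (auto simp: square_integrable_def)
  have [measurable]: "g \<in> borel_measurable \<mu>" by (rule measurable_continuous[OF g])
  have B0: "0 \<le> B" using B[OF norm_axis_complex] norm_ge_zero order_trans by blast
  have le: "(cmod (g z * f z))\<^sup>2 \<le> B\<^sup>2 * (cmod (f z))\<^sup>2" if "z \<in> space \<mu>" for z
    using B[of z] that by (simp add: in_space_iff norm_mult power_mult_distrib mult_right_mono power_mono)
  have i': "integrable \<mu> (\<lambda>z. B\<^sup>2 * (cmod (f z))\<^sup>2)" using i by simp
  have i2: "integrable \<mu> (\<lambda>z. (cmod (g z * f z))\<^sup>2)"
    by (rule Bochner_Integration.integrable_bound[OF i']) (use le in \<open>auto\<close>)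
  then show "square_integrable \<mu> (\<lambda>z. g z * f z)" by (simp add: square_integrable_def)
  have "(LINT z|\<mu>. (cmod (g z * f z))\<^sup>2) \<le> (LINT z|\<mu>. B\<^sup>2 * (cmod (f z))\<^sup>2)"
    by (rule integral_mono[OF i2 i' le])
  then have "l2norm \<mu> (\<lambda>z. g z * f z) \<le> sqrt (B\<^sup>2 * (LINT z|\<mu>. (cmod (f z))\<^sup>2))"
    unfolding l2norm_def by (intro real_sqrt_le_mono) simp
  then show "l2norm \<mu> (\<lambda>z. g z * f z) \<le> B * l2norm \<mu> f"
    using B0 by (simp add: real_sqrt_mult l2norm_def)
qed

lemma square_integrable_continuous:
  assumes "continuous_on UNIV f"
  shows "square_integrable \<mu> f"
  unfolding square_integrable_def
  by (intro conjI measurable_continuous integrable_continuous continuous_intros assms)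

lemma square_integrable_polynomial: "p \<in> polynomial_functions \<Longrightarrow> square_integrable \<mu> p"
  by (intro square_integrable_continuous continuous_on_polynomial)

lemma polynomial_bounded:
  assumes "p \<in> polynomial_functions"
  obtains B where "0 \<le> B" "\<And>z :: complex^'d. norm z = 1 \<Longrightarrow> cmod (p z) \<le> B"
proof -
  have "bounded (p ` sphere 0 1)"
    by (intro compact_imp_bounded compact_continuous_image
        continuous_on_subset[OF continuous_on_polynomial[OF assms]]) auto
  then show ?thesis using that unfolding bounded_pos by (metis imageI less_imp_le mem_sphere_0)
qed

lemma hardy_polynomial: "p \<in> polynomial_functions \<Longrightarrow> hardy_function \<mu> p"
  by (auto simp: hardy_function_def square_integrable_polynomial l2norm_def intro!: bexI[of _ p])

lemma hardy_add:
  assumes f: "hardy_function \<mu> f" and g: "hardy_function \<mu> g"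
  shows "hardy_function \<mu> (\<lambda>z. f z + g z)"
  unfolding hardy_function_def
proof (intro conjI allI impI)
  show "square_integrable \<mu> (\<lambda>z. f z + g z)"
    using f g by (intro square_integrable_add) (auto simp: hardy_function_def)
  fix e :: real assume e: "0 < e"
  obtain p where p: "p \<in> polynomial_functions" "l2norm \<mu> (\<lambda>z. f z - p z) < e / 2"
    using f e unfolding hardy_function_def by (meson half_gt_zero)
  obtain q where q: "q \<in> polynomial_functions" "l2norm \<mu> (\<lambda>z. g z - q z) < e / 2"
    using g e unfolding hardy_function_def by (meson half_gt_zero)
  have "l2norm \<mu> (\<lambda>z. (f z - p z) + (g z - q z)) \<le> l2norm \<mu> (\<lambda>z. f z - p z) + l2norm \<mu> (\<lambda>z. g z - q z)"
    by (intro l2norm_triangle square_integrable_diff square_integrable_polynomial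
        hardy_functionD(1)[OF f] hardy_functionD(1)[OF g] p q)
  then have "l2norm \<mu> (\<lambda>z. f z + g z - (p z + q z)) < e"
    using p q by (simp add: algebra_simps)
  then show "\<exists>r\<in>polynomial_functions. l2norm \<mu> (\<lambda>z. f z + g z - r z) < e"
    using polynomial_add[OF p(1) q(1)] by (rule bexI)
qed

end

text \<open>Multiplications and substitutions that are bounded on \<open>L\<^sup>2\<close> and preserve polynomials act on the
closure of the polynomials, since they map an approximating polynomial to an approximating
polynomial.\<close>

lemma hardy_function_map:
  assumes M: "sphere_measure M" and f: "hardy_function M f"
    and sq: "\<And>g. square_integrable M g \<Longrightarrow> square_integrable N (\<Phi> g)"
    and bound: "\<And>g. square_integrable M g \<Longrightarrow> l2norm N (\<Phi> g) \<le> C * l2norm M g"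
    and diff: "\<And>g h. \<Phi> (\<lambda>z. g z - h z) = (\<lambda>z. \<Phi> g z - \<Phi> h z)"
    and poly: "\<And>p. p \<in> polynomial_functions \<Longrightarrow> \<Phi> p \<in> polynomial_functions"
  shows "hardy_function N (\<Phi> f)"
  unfolding hardy_function_def
proof (intro conjI allI impI)
  interpret M: sphere_measure M by fact
  show "square_integrable N (\<Phi> f)" using f by (intro sq) (simp add: hardy_function_def)
  fix e :: real assume e: "0 < e"
  then have "0 < e / (\<bar>C\<bar> + 1)" by simp
  then obtain p where p: "p \<in> polynomial_functions" "l2norm M (\<lambda>z. f z - p z) < e / (\<bar>C\<bar> + 1)"
    using f unfolding hardy_function_def by blast
  have "square_integrable M (\<lambda>z. f z - p z)"
    by (intro square_integrable_diff M.square_integrable_polynomial hardy_functionD(1)[OF f] p)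
  from bound[OF this] have "l2norm N (\<lambda>z. \<Phi> f z - \<Phi> p z) \<le> C * l2norm M (\<lambda>z. f z - p z)"
    by (simp add: diff)
  also have "\<dots> \<le> (\<bar>C\<bar> + 1) * l2norm M (\<lambda>z. f z - p z)" by (intro mult_right_mono) auto
  also have "\<dots> < e" using p(2) by (simp add: pos_less_divide_eq mult.commute)
  finally show "\<exists>r\<in>polynomial_functions. l2norm N (\<lambda>z. \<Phi> f z - r z) < e"
    using poly[OF p(1)] by (rule bexI)
qed

context sphere_measure
begin

lemma coordinate_le: "norm z = 1 \<Longrightarrow> cmod (z $ j) \<le> 1"
  by (metis Finite_Cartesian_Product.norm_nth_le)

lemma hardy_coord:
  assumes "hardy_function \<mu> f"
  shows "hardy_function \<mu> (\<lambda>z. z $ j * f z)"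
proof (rule hardy_function_map[OF sphere_measure_axioms assms, where \<Phi> = "\<lambda>f z. z $ j * f z"])
  fix g assume "square_integrable \<mu> g"
  have "continuous_on UNIV (\<lambda>z :: complex^'d. z $ j)" by (intro continuous_intros)
  from square_integrable_continuous_mult[OF this \<open>square_integrable \<mu> g\<close> coordinate_le]
  show "square_integrable \<mu> (\<lambda>z. z $ j * g z)" "l2norm \<mu> (\<lambda>z. z $ j * g z) \<le> 1 * l2norm \<mu> g"
    by auto
qed (auto simp: right_diff_distrib intro: polynomial_mult polynomial_coord)

lemma hardy_cmult:
  assumes "hardy_function \<mu> f"
  shows "hardy_function \<mu> (\<lambda>z. c * f z)"
  by (rule hardy_function_map[OF sphere_measure_axioms assms, where \<Phi> = "\<lambda>f z. c * f z"])
     (auto simp: square_integrable_cmult l2norm_cmult right_diff_distrib intro: polynomial_mult polynomial_const)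

lemma carrier_hardy: "carrier (hardy_space \<mu>) = ae_class \<mu> ` Collect (hardy_function \<mu>)"
proof -
  have dist: "cnorm (L2_space \<mu>) (ae_class \<mu> f \<ominus>\<^bsub>L2_space \<mu>\<^esub> ae_class \<mu> p) = l2norm \<mu> (\<lambda>z. f z - p z)"
    if "square_integrable \<mu> f" "p \<in> polynomial_functions" for f p
    using square_integrable_polynomial[OF that(2)] that(1)
    by (simp add: L2_minus cnorm_L2 square_integrable_measurable square_integrable_diff)
  show ?thesis
  proof (intro Set.set_eqI iffI)
    fix x assume "x \<in> carrier (hardy_space \<mu>)"
    then have x: "x \<in> carrier (L2_space \<mu>)"
      and cl: "\<And>e. 0 < e \<Longrightarrow> \<exists>p\<in>polynomial_functions. cnorm (L2_space \<mu>) (x \<ominus>\<^bsub>L2_space \<mu>\<^esub> ae_class \<mu> p) < e"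
      by (auto simp: hardy_space_def cclosure_def)
    obtain f where f: "square_integrable \<mu> f" "x = ae_class \<mu> f"
      using x by (auto simp: carrier_L2)
    have "hardy_function \<mu> f"
      using cl f dist unfolding hardy_function_def by (metis (no_types, lifting))
    then show "x \<in> ae_class \<mu> ` Collect (hardy_function \<mu>)" using f by blast
  next
    fix x assume "x \<in> ae_class \<mu> ` Collect (hardy_function \<mu>)"
    then obtain f where f: "hardy_function \<mu> f" "x = ae_class \<mu> f" by blast
    then have "\<exists>y\<in>ae_class \<mu> ` polynomial_functions. cnorm (L2_space \<mu>) (x \<ominus>\<^bsub>L2_space \<mu>\<^esub> y) < e"
      if "0 < e" for e
      using that dist[OF hardy_functionD(1)[OF f(1)]] unfolding hardy_function_def by fastforce
    then show "x \<in> carrier (hardy_space \<mu>)"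
      using f by (simp add: hardy_space_def cclosure_def L2_carrierI hardy_functionD)
  qed
qed

lemma hardy_carrierI: "hardy_function \<mu> f \<Longrightarrow> ae_class \<mu> f \<in> carrier (hardy_space \<mu>)"
  by (simp add: carrier_hardy)

lemma hardy_carrierE:
  assumes "x \<in> carrier (hardy_space \<mu>)"
  obtains f where "hardy_function \<mu> f" "x = ae_class \<mu> f"
  using assms by (auto simp: carrier_hardy)

lemma hardy_space_ops:
  assumes "hardy_function \<mu> f"
  shows "hardy_function \<mu> g \<Longrightarrow> ae_class \<mu> f \<oplus>\<^bsub>hardy_space \<mu>\<^esub> ae_class \<mu> g = ae_class \<mu> (\<lambda>z. f z + g z)"
    and "c \<odot>\<^bsub>hardy_space \<mu>\<^esub> ae_class \<mu> f = ae_class \<mu> (\<lambda>z. c * f z)"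
    and "cnorm (hardy_space \<mu>) (ae_class \<mu> f) = l2norm \<mu> f"
  using assms by (simp_all add: hardy_space_simps L2_add L2_smult cnorm_L2 hardy_functionD)

lemma ae_class_UN:
  assumes f: "f \<in> borel_measurable \<mu>"
    and "\<And>g. g \<in> borel_measurable \<mu> \<Longrightarrow> AE z in \<mu>. g z = f z \<Longrightarrow> AE z in N. \<Phi> g z = \<Phi> f z"
  shows "(\<Union>g\<in>ae_class \<mu> f. ae_class N (\<Phi> g)) = ae_class N (\<Phi> f)"
  using f assms(2)
  by (intro UN_const_eq[where x = f] ae_class_self ae_class_cong) (auto simp: ae_class_def)

lemma coord_mult_class:
  assumes "f \<in> borel_measurable \<mu>"
  shows "coord_mult \<mu> j (ae_class \<mu> f) = ae_class \<mu> (\<lambda>z. z $ j * f z)"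
  unfolding coord_mult_def
  by (rule ae_class_UN[OF assms, where \<Phi> = "\<lambda>f z. z $ j * f z"]) (auto elim: eventually_mono)

lemma abelian_group_hardy: "abelian_group (hardy_space \<mu>)"
proof (rule abelian_groupI)
  interpret L: abelian_group "L2_space \<mu>" by (rule abelian_group_L2)
  have sub: "x \<in> carrier (L2_space \<mu>)" if "x \<in> carrier (hardy_space \<mu>)" for x
    using that by (auto simp: hardy_space_def cclosure_def)
  fix x y z assume x: "x \<in> carrier (hardy_space \<mu>)" and y: "y \<in> carrier (hardy_space \<mu>)"
  show "x \<oplus>\<^bsub>hardy_space \<mu>\<^esub> y \<in> carrier (hardy_space \<mu>)"
    using x y by (auto simp: carrier_hardy hardy_space_ops hardy_add)
  show "x \<oplus>\<^bsub>hardy_space \<mu>\<^esub> y = y \<oplus>\<^bsub>hardy_space \<mu>\<^esub> x"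
    using x y by (simp add: hardy_space_simps L.a_comm sub)
  assume "z \<in> carrier (hardy_space \<mu>)"
  then show "x \<oplus>\<^bsub>hardy_space \<mu>\<^esub> y \<oplus>\<^bsub>hardy_space \<mu>\<^esub> z = x \<oplus>\<^bsub>hardy_space \<mu>\<^esub> (y \<oplus>\<^bsub>hardy_space \<mu>\<^esub> z)"
    using x y by (simp add: hardy_space_simps L.a_assoc sub)
next
  show "\<zero>\<^bsub>hardy_space \<mu>\<^esub> \<in> carrier (hardy_space \<mu>)"
    unfolding hardy_space_simps by (intro hardy_carrierI hardy_polynomial polynomial_const)
next
  fix x assume "x \<in> carrier (hardy_space \<mu>)"
  then obtain f where f: "hardy_function \<mu> f" "x = ae_class \<mu> f" by (rule hardy_carrierE)
  show "\<zero>\<^bsub>hardy_space \<mu>\<^esub> \<oplus>\<^bsub>hardy_space \<mu>\<^esub> x = x"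
    using f by (simp add: hardy_space_simps L2_add hardy_functionD)
  show "\<exists>y\<in>carrier (hardy_space \<mu>). y \<oplus>\<^bsub>hardy_space \<mu>\<^esub> x = \<zero>\<^bsub>hardy_space \<mu>\<^esub>"
    using f hardy_cmult[OF f(1), of "-1"]
    by (intro bexI[of _ "ae_class \<mu> (\<lambda>z. -1 * f z)"] hardy_carrierI)
       (auto simp: hardy_space_ops hardy_space_simps(1))
qed

lemma finsum_hardy:
  assumes "finite A" "\<And>i. i \<in> A \<Longrightarrow> hardy_function \<mu> (F i)"
  shows "(\<Oplus>\<^bsub>hardy_space \<mu>\<^esub>i\<in>A. ae_class \<mu> (F i)) = ae_class \<mu> (\<lambda>z. \<Sum>i\<in>A. F i z) \<and>
    hardy_function \<mu> (\<lambda>z. \<Sum>i\<in>A. F i z)"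
  using assms
proof (induction A)
  case empty
  interpret H: abelian_group "hardy_space \<mu>" by (rule abelian_group_hardy)
  show ?case using H.finsum_empty
    by (simp add: hardy_space_simps hardy_polynomial polynomial_const)
next
  case (insert a A)
  interpret H: abelian_group "hardy_space \<mu>" by (rule abelian_group_hardy)
  have "(\<Oplus>\<^bsub>hardy_space \<mu>\<^esub>i\<in>insert a A. ae_class \<mu> (F i)) =
      ae_class \<mu> (F a) \<oplus>\<^bsub>hardy_space \<mu>\<^esub> (\<Oplus>\<^bsub>hardy_space \<mu>\<^esub>i\<in>A. ae_class \<mu> (F i))"
    using insert by (intro H.finsum_insert) (auto intro: hardy_carrierI)
  then show ?case using insert by (simp add: hardy_space_ops hardy_add)
qed

lemma matrix_act_class:
  assumes "hardy_function \<mu> f"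
  shows "matrix_act_tuple (hardy_space \<mu>) u (coord_mult \<mu>) j (ae_class \<mu> f) =
    ae_class \<mu> (\<lambda>z. (u *v z) $ j * f z)"
proof -
  have "matrix_act_tuple (hardy_space \<mu>) u (coord_mult \<mu>) j (ae_class \<mu> f) =
      (\<Oplus>\<^bsub>hardy_space \<mu>\<^esub>k\<in>UNIV. ae_class \<mu> (\<lambda>z. u $ j $ k * (z $ k * f z)))"
    by (simp add: matrix_act_tuple_def coord_mult_class hardy_functionD[OF assms] hardy_space_ops hardy_coord[OF assms])
  also have "\<dots> = ae_class \<mu> (\<lambda>z. \<Sum>k\<in>UNIV. u $ j $ k * (z $ k * f z))"
    using finsum_hardy[of UNIV "\<lambda>k z. u $ j $ k * (z $ k * f z)"] hardy_cmult[OF hardy_coord[OF assms]] by simp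
  finally show ?thesis by (simp add: matrix_vector_mult_def sum_distrib_right mult.assoc)
qed

lemma commuting_coord_mult:
  assumes "\<And>j. bounded_operator (hardy_space \<mu>) (hardy_space \<mu>) (coord_mult \<mu> j)"
  shows "commuting_bounded_tuple (hardy_space \<mu>) (coord_mult \<mu>)"
  unfolding commuting_bounded_tuple_def
proof (intro conjI allI ballI assms)
  fix i j x assume "x \<in> carrier (hardy_space \<mu>)"
  then obtain f where f: "hardy_function \<mu> f" "x = ae_class \<mu> f" by (rule hardy_carrierE)
  then show "coord_mult \<mu> i (coord_mult \<mu> j x) = coord_mult \<mu> j (coord_mult \<mu> i x)"
    by (simp add: coord_mult_class hardy_functionD hardy_coord mult.left_commute)
qed

end

lemma bounded_operator_hardyI:
  assumes M: "sphere_measure M" and N: "sphere_measure N"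
    and hardy: "\<And>f. hardy_function M f \<Longrightarrow> hardy_function N (\<Phi> f)"
    and T: "\<And>f. hardy_function M f \<Longrightarrow> T (ae_class M f) = ae_class N (\<Phi> f)"
    and add: "\<And>f g. \<Phi> (\<lambda>z. f z + g z) = (\<lambda>z. \<Phi> f z + \<Phi> g z)"
    and cmult: "\<And>c f. \<Phi> (\<lambda>z. c * f z) = (\<lambda>z. c * \<Phi> f z)"
    and bound: "\<And>f. hardy_function M f \<Longrightarrow> l2norm N (\<Phi> f) \<le> C * l2norm M f"
  shows "bounded_operator (hardy_space M) (hardy_space N) T"
proof -
  interpret M: sphere_measure M by fact
  interpret N: sphere_measure N by fact
  show ?thesis
    unfolding bounded_operator_def
  proof (intro conjI)
    show "T \<in> carrier (hardy_space M) \<rightarrow> carrier (hardy_space N)"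
      by (auto simp: M.carrier_hardy N.carrier_hardy T hardy)
    show "\<forall>x\<in>carrier (hardy_space M). \<forall>y\<in>carrier (hardy_space M).
        T (x \<oplus>\<^bsub>hardy_space M\<^esub> y) = T x \<oplus>\<^bsub>hardy_space N\<^esub> T y"
      by (auto simp: M.carrier_hardy T hardy M.hardy_space_ops N.hardy_space_ops M.hardy_add add)
    show "\<forall>c. \<forall>x\<in>carrier (hardy_space M). T (c \<odot>\<^bsub>hardy_space M\<^esub> x) = c \<odot>\<^bsub>hardy_space N\<^esub> T x"
      by (auto simp: M.carrier_hardy T hardy M.hardy_space_ops N.hardy_space_ops M.hardy_cmult cmult)
    show "\<exists>C. \<forall>x\<in>carrier (hardy_space M). cnorm (hardy_space N) (T x) \<le> C * cnorm (hardy_space M) x"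
      using bound
      by (intro exI[of _ C]) (auto simp: M.carrier_hardy T hardy M.hardy_space_ops N.hardy_space_ops)
  qed
qed

section \<open>Comparable measures\<close>

lemma scale_measure_AE:
  assumes "N \<le> scale_measure K M" "sets N = sets M" "AE z in M. P z"
  shows "AE z in N. P z"
proof -
  from assms(3) obtain A where A: "A \<in> sets M" "emeasure M A = 0" "{z\<in>space M. \<not> P z} \<subseteq> A"
    by (auto elim: AE_E)
  have "emeasure N A \<le> K * emeasure M A"
    using le_measureD3[OF assms(1)] assms(2) by (simp add: le_fun_def)
  then have "emeasure N A = 0" using A(2) by simp
  then show ?thesis
    using A assms(2) sets_eq_imp_space_eq[OF assms(2)] by (intro AE_I[of _ _ A]) auto
qed

lemma scale_measure_integral:
  fixes f :: "'a \<Rightarrow> real"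
  assumes le: "N \<le> scale_measure (ennreal K) M" and s: "sets N = sets M" and K: "0 \<le> K"
    and f: "integrable M f" "\<And>z. 0 \<le> f z"
  shows "integrable N f" "(LINT z|N. f z) \<le> K * (LINT z|M. f z)"
proof -
  have mM: "f \<in> borel_measurable M" using f(1) by simp
  then have mN: "f \<in> borel_measurable N" using s by (simp cong: measurable_cong_sets)
  have "(\<integral>\<^sup>+z. f z \<partial>N) \<le> (\<integral>\<^sup>+z. f z \<partial>scale_measure (ennreal K) M)"
    by (rule nn_integral_mono_measure) (use s le in auto)
  also have "\<dots> = ennreal K * (\<integral>\<^sup>+z. f z \<partial>M)"
    by (rule nn_integral_scale_measure) (use mM in measurable)
  also have "(\<integral>\<^sup>+z. f z \<partial>M) = ennreal (LINT z|M. f z)"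
    by (rule nn_integral_eq_integral[OF f(1)]) (simp add: f(2))
  finally have b: "(\<integral>\<^sup>+z. f z \<partial>N) \<le> ennreal (K * (LINT z|M. f z))"
    using K f(2) by (simp add: ennreal_mult)
  show i: "integrable N f"
    by (rule integrableI_nonneg[OF mN]) (use b f(2) in \<open>auto intro: le_less_trans\<close>)
  show "(LINT z|N. f z) \<le> K * (LINT z|M. f z)"
    using b K f(2) nn_integral_eq_integral[OF i] by (simp add: integral_nonneg)
qed

lemma scale_measure_l2norm:
  assumes le: "N \<le> scale_measure (ennreal K) M" and s: "sets N = sets M" and K: "0 \<le> K"
    and f: "square_integrable M f"
  shows "square_integrable N f" "l2norm N f \<le> sqrt K * l2norm M f"
proof -
  have i: "integrable M (\<lambda>z. (cmod (f z))\<^sup>2)" and m: "f \<in> borel_measurable M"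
    using f by (auto simp: square_integrable_def)
  have "f \<in> borel_measurable N" using m s by (simp cong: measurable_cong_sets)
  then show "square_integrable N f"
    using scale_measure_integral(1)[OF le s K i] by (simp add: square_integrable_def)
  show "l2norm N f \<le> sqrt K * l2norm M f"
    unfolding l2norm_def using scale_measure_integral(2)[OF le s K i]
    by (simp flip: real_sqrt_mult)
qed

text \<open>Comparable measures have the same null sets, so their classes of functions are literally equal and
their norms are equivalent.  The identity map is therefore a similarity.\<close>

lemma similar_if_comparable:
  fixes \<mu> \<nu> :: "(complex^'d) measure"
  assumes \<mu>: "sphere_measure \<mu>" and \<nu>: "sphere_measure \<nu>" and K: "0 \<le> K"
    and le: "\<mu> \<le> scale_measure (ennreal K) \<nu>" "\<nu> \<le> scale_measure (ennreal K) \<mu>"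
  shows "similar_tuples (hardy_space \<mu>) (coord_mult \<mu>) (hardy_space \<nu>) (coord_mult \<nu>)"
proof -
  interpret \<mu>: sphere_measure \<mu> by fact
  interpret \<nu>: sphere_measure \<nu> by fact
  have s: "sets \<mu> = sets \<nu>" by (simp add: \<mu>.sets_sphere \<nu>.sets_sphere)
  have mm: "borel_measurable \<mu> = borel_measurable \<nu>" using s by (simp cong: measurable_cong_sets)
  have cls: "ae_class \<mu> f = ae_class \<nu> f" for f :: "complex^'d \<Rightarrow> complex"
    unfolding ae_class_def mm
    using scale_measure_AE[OF le(1) s] scale_measure_AE[OF le(2) s[symmetric]] by blast
  have h1: "hardy_function \<nu> f" if "hardy_function \<mu> f" for f
    using hardy_function_map[OF \<mu> that, of \<nu> "\<lambda>f. f" "sqrt K"] 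
      scale_measure_l2norm[OF le(2) s[symmetric] K] by blast
  have h2: "hardy_function \<mu> f" if "hardy_function \<nu> f" for f
    using hardy_function_map[OF \<nu> that, of \<mu> "\<lambda>f. f" "sqrt K"] 
      scale_measure_l2norm[OF le(1) s K] by blast
  have "bounded_operator (hardy_space \<mu>) (hardy_space \<nu>) (\<lambda>x. x)"
    by (rule bounded_operator_hardyI[OF \<mu> \<nu>, where \<Phi> = "\<lambda>f. f" and C = "sqrt K"])
       (auto simp: h1 cls intro: scale_measure_l2norm[OF le(2) s[symmetric] K] hardy_functionD)
  moreover have "bounded_operator (hardy_space \<nu>) (hardy_space \<mu>) (\<lambda>x. x)"
    by (rule bounded_operator_hardyI[OF \<nu> \<mu>, where \<Phi> = "\<lambda>f. f" and C = "sqrt K"])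
       (auto simp: h2 cls intro: scale_measure_l2norm[OF le(1) s K] hardy_functionD)
  ultimately have "bounded_invertible_operator (hardy_space \<mu>) (hardy_space \<nu>) (\<lambda>x. x)"
    unfolding bounded_invertible_operator_def by blast
  moreover have "coord_mult \<mu> j x = coord_mult \<nu> j x" for j x
    by (simp add: coord_mult_def cls)
  ultimately show ?thesis unfolding similar_tuples_def by blast
qed

lemma (in sphere_measure) bounded_coord_mult:
  "bounded_operator (hardy_space \<mu>) (hardy_space \<mu>) (coord_mult \<mu> j)"
proof (rule bounded_operator_hardyI[OF sphere_measure_axioms sphere_measure_axioms,
      where \<Phi> = "\<lambda>f z. z $ j * f z" and C = 1])
  fix f assume f: "hardy_function \<mu> f"
  then show "hardy_function \<mu> (\<lambda>z. z $ j * f z)" by (rule hardy_coord)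
  show "coord_mult \<mu> j (ae_class \<mu> f) = ae_class \<mu> (\<lambda>z. z $ j * f z)"
    by (rule coord_mult_class[OF hardy_functionD(2)[OF f]])
  have "continuous_on UNIV (\<lambda>z :: complex^'d. z $ j)" by (intro continuous_intros)
  then show "l2norm \<mu> (\<lambda>z. z $ j * f z) \<le> 1 * l2norm \<mu> f"
    by (rule square_integrable_continuous_mult(2)[OF _ hardy_functionD(1)[OF f] coordinate_le])
qed (auto simp: distrib_left)

section \<open>Composition operators\<close>

definition composition :: "(complex^'d) measure \<Rightarrow> complex^'d^'d \<Rightarrow>
    (complex^'d \<Rightarrow> complex) set \<Rightarrow> (complex^'d \<Rightarrow> complex) set" where
  "composition \<mu> u F = (\<Union>f\<in>F. ae_class \<mu> (\<lambda>z. f (u *v z)))"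

lemma (in sphere_measure) composition_hardy:
  assumes u: "unitary_matrix u" and K: "0 \<le> K"
    and le: "rotated_measure u \<mu> \<le> scale_measure (ennreal K) \<mu>"
  shows composition_class: "f \<in> borel_measurable \<mu> \<Longrightarrow>
      composition \<mu> u (ae_class \<mu> f) = ae_class \<mu> (\<lambda>z. f (u *v z))"
    and hardy_composition: "hardy_function \<mu> f \<Longrightarrow> hardy_function \<mu> (\<lambda>z. f (u *v z))"
    and bounded_composition: "bounded_operator (hardy_space \<mu>) (hardy_space \<mu>) (composition \<mu> u)"
proof -
  have s: "sets (rotated_measure u \<mu>) = sets \<mu>" by (simp add: rotated_measure_def)
  show cls: "composition \<mu> u (ae_class \<mu> f) = ae_class \<mu> (\<lambda>z. f (u *v z))"
    if "f \<in> borel_measurable \<mu>" for f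
    unfolding composition_def
  proof (rule ae_class_UN[OF that, where \<Phi> = "\<lambda>f z. f (u *v z)"])
    fix g assume "AE z in \<mu>. g z = f z"
    then have "AE z in rotated_measure u \<mu>. g z = f z" by (rule scale_measure_AE[OF le s])
    then show "AE z in \<mu>. g (u *v z) = f (u *v z)"
      unfolding rotated_measure_def by (rule AE_distrD[OF measurable_unitary[OF u]])
  qed
  have sq: "square_integrable \<mu> (\<lambda>z. f (u *v z))"
    and bd: "l2norm \<mu> (\<lambda>z. f (u *v z)) \<le> sqrt K * l2norm \<mu> f" if f: "square_integrable \<mu> f" for f
  proof -
    have m: "f \<in> borel_measurable \<mu>" using f by (simp add: square_integrable_def)
    then have m2: "(\<lambda>z. (cmod (f z))\<^sup>2) \<in> borel_measurable \<mu>" by measurable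
    have "square_integrable (rotated_measure u \<mu>) f" by (rule scale_measure_l2norm(1)[OF le s K f])
    then have "integrable \<mu> (\<lambda>z. (cmod (f (u *v z)))\<^sup>2)"
      unfolding square_integrable_def rotated_measure_def
      using integrable_distr_eq[OF measurable_unitary[OF u] m2] by simp
    moreover have "(\<lambda>z. f (u *v z)) \<in> borel_measurable \<mu>"
      by (rule measurable_compose[OF measurable_unitary[OF u] m])
    ultimately show "square_integrable \<mu> (\<lambda>z. f (u *v z))" by (simp add: square_integrable_def)
    have "l2norm \<mu> (\<lambda>z. f (u *v z)) = l2norm (rotated_measure u \<mu>) f"
      by (simp add: l2norm_def integral_rotated[OF u m2])
    then show "l2norm \<mu> (\<lambda>z. f (u *v z)) \<le> sqrt K * l2norm \<mu> f"
      using scale_measure_l2norm(2)[OF le s K f] by simp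
  qed
  show h: "hardy_function \<mu> (\<lambda>z. f (u *v z))" if "hardy_function \<mu> f" for f
    by (rule hardy_function_map[OF sphere_measure_axioms that, where \<Phi> = "\<lambda>f z. f (u *v z)" and C = "sqrt K"])
       (auto intro: sq bd polynomial_compose_unitary)
  show "bounded_operator (hardy_space \<mu>) (hardy_space \<mu>) (composition \<mu> u)"
    by (rule bounded_operator_hardyI[OF sphere_measure_axioms sphere_measure_axioms,
          where \<Phi> = "\<lambda>f z. f (u *v z)" and C = "sqrt K"])
       (use h bd cls hardy_functionD in blast)+
qed

text \<open>Composition with \<open>u\<close> intertwines: the function \<open>z_j f\<close> becomes the product of the \<open>j\<close>-th coordinate
of \<open>u z\<close> with \<open>f(u z)\<close>.  Its norm is that of \<open>f\<close> in the rotated measure, and its inverse is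
composition with the adjoint.\<close>

lemma (in sphere_measure) weakly_homogeneous_if_dominated:
  assumes K: "0 \<le> K"
    and le: "\<And>u. unitary_matrix u \<Longrightarrow> rotated_measure u \<mu> \<le> scale_measure (ennreal K) \<mu>"
  shows "weakly_unitarily_homogeneous (hardy_space \<mu>) (coord_mult \<mu>)"
  unfolding weakly_unitarily_homogeneous_def
proof (intro conjI allI impI commuting_coord_mult bounded_coord_mult)
  fix u :: "complex^'d^'d" assume u: "unitary_matrix u"
  let ?v = "adjoint_matrix u"
  have v: "unitary_matrix ?v" by (rule unitary_adjoint[OF u])
  note Cu = composition_hardy[OF u K le[OF u]] and Cv = composition_hardy[OF v K le[OF v]]
  have "bounded_invertible_operator (hardy_space \<mu>) (hardy_space \<mu>) (composition \<mu> u)"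
    unfolding bounded_invertible_operator_def
  proof (intro conjI exI[of _ "composition \<mu> ?v"] ballI Cu(3) Cv(3))
    fix x assume "x \<in> carrier (hardy_space \<mu>)"
    then obtain f where f: "hardy_function \<mu> f" "x = ae_class \<mu> f" by (rule hardy_carrierE)
    show "composition \<mu> ?v (composition \<mu> u x) = x" "composition \<mu> u (composition \<mu> ?v x) = x"
      using f by (simp_all add: Cu(1) Cv(1) Cu(2) Cv(2) hardy_functionD unitary_adjoint_cancel[OF u])
  qed
  moreover have "composition \<mu> u (coord_mult \<mu> j x) =
      matrix_act_tuple (hardy_space \<mu>) u (coord_mult \<mu>) j (composition \<mu> u x)"
    if "x \<in> carrier (hardy_space \<mu>)" for j x
  proof -
    from that obtain f where f: "hardy_function \<mu> f" "x = ae_class \<mu> f" by (rule hardy_carrierE)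
    then show ?thesis
      by (simp add: Cu(1) Cu(2) coord_mult_class hardy_coord hardy_functionD matrix_act_class)
  qed
  ultimately show "\<exists>\<Gamma>. bounded_invertible_operator (hardy_space \<mu>) (hardy_space \<mu>) \<Gamma> \<and>
      (\<forall>j. \<forall>x\<in>carrier (hardy_space \<mu>).
        \<Gamma> (coord_mult \<mu> j x) = matrix_act_tuple (hardy_space \<mu>) u (coord_mult \<mu>) j (\<Gamma> x))"
    by blast
qed

section \<open>Weak homogeneity is a similarity invariant\<close>

lemma bounded_operatorD:
  assumes "bounded_operator G H T"
  shows "x \<in> carrier G \<Longrightarrow> T x \<in> carrier H"
    and "x \<in> carrier G \<Longrightarrow> y \<in> carrier G \<Longrightarrow> T (x \<oplus>\<^bsub>G\<^esub> y) = T x \<oplus>\<^bsub>H\<^esub> T y"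
    and "x \<in> carrier G \<Longrightarrow> T (c \<odot>\<^bsub>G\<^esub> x) = c \<odot>\<^bsub>H\<^esub> T x"
  using assms by (auto simp: bounded_operator_def)

lemma bounded_operator_bound:
  assumes "bounded_operator G H T"
  shows "\<exists>C. \<forall>x\<in>carrier G. cnorm H (T x) \<le> C * cnorm G x"
  using assms by (simp add: bounded_operator_def)

lemma bounded_invertible_operatorD:
  assumes "bounded_invertible_operator G H T"
  shows "bounded_operator G H T" and "y \<in> carrier H \<Longrightarrow> \<exists>x\<in>carrier G. T x = y"
proof -
  note inv = assms[unfolded bounded_invertible_operator_def]
  show "bounded_operator G H T" by (rule inv[THEN conjunct1])
  obtain R where R: "bounded_operator H G R \<and> (\<forall>x\<in>carrier G. R (T x) = x) \<and> (\<forall>y\<in>carrier H. T (R y) = y)"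
    by (rule exE[OF inv[THEN conjunct2]])
  show "\<exists>x\<in>carrier G. T x = y" if "y \<in> carrier H"
    using bounded_operatorD(1)[OF R[THEN conjunct1] that] R that by (intro bexI[of _ "R y"]) simp_all
qed

lemma bounded_operator_compose:
  assumes S: "bounded_operator G H S" and T: "bounded_operator H L T"
    and nonneg: "\<And>x. x \<in> carrier H \<Longrightarrow> 0 \<le> cnorm H x"
  shows "bounded_operator G L (\<lambda>x. T (S x))"
proof -
  have "\<exists>C. \<forall>x\<in>carrier G. cnorm H (S x) \<le> C * cnorm G x"
    "\<exists>D. \<forall>x\<in>carrier H. cnorm L (T x) \<le> D * cnorm H x"
    using S T by (simp_all add: bounded_operator_def)
  then obtain C D where C: "\<And>x. x \<in> carrier G \<Longrightarrow> cnorm H (S x) \<le> C * cnorm G x"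
    and D: "\<And>x. x \<in> carrier H \<Longrightarrow> cnorm L (T x) \<le> D * cnorm H x"
    by blast
  have "cnorm L (T (S x)) \<le> (\<bar>D\<bar> * C) * cnorm G x" if x: "x \<in> carrier G" for x
  proof -
    have Sx: "S x \<in> carrier H" by (rule bounded_operatorD(1)[OF S x])
    have "cnorm L (T (S x)) \<le> D * cnorm H (S x)" by (rule D[OF Sx])
    also have "\<dots> \<le> \<bar>D\<bar> * cnorm H (S x)" using nonneg[OF Sx] by (intro mult_right_mono) auto
    also have "\<dots> \<le> \<bar>D\<bar> * (C * cnorm G x)" using C[OF x] by (intro mult_left_mono) auto
    finally show ?thesis by (simp add: mult_ac)
  qed
  then show ?thesis
    unfolding bounded_operator_def
    by (intro conjI Pi_I ballI allI exI[of _ "\<bar>D\<bar> * C"])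
       (simp_all add: bounded_operatorD[OF S] bounded_operatorD[OF T])
qed

lemma (in sphere_measure) cnorm_hardy_nonneg:
  "x \<in> carrier (hardy_space \<mu>) \<Longrightarrow> 0 \<le> cnorm (hardy_space \<mu>) x"
  by (auto simp: carrier_hardy hardy_space_ops)

lemma bounded_operator_finsum:
  assumes "abelian_group G" "abelian_group H" and T: "bounded_operator G H T"
    and "finite A" "\<And>i. i \<in> A \<Longrightarrow> x i \<in> carrier G"
  shows "T (\<Oplus>\<^bsub>G\<^esub>i\<in>A. x i) = (\<Oplus>\<^bsub>H\<^esub>i\<in>A. T (x i))"
proof -
  interpret G: abelian_group G by fact
  interpret H: abelian_group H by fact
  note TD = bounded_operatorD[OF T]
  have "T \<zero>\<^bsub>G\<^esub> \<oplus>\<^bsub>H\<^esub> T \<zero>\<^bsub>G\<^esub> = T \<zero>\<^bsub>G\<^esub>"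
    using TD(2)[of "\<zero>\<^bsub>G\<^esub>" "\<zero>\<^bsub>G\<^esub>"] by simp
  then have zero: "T \<zero>\<^bsub>G\<^esub> = \<zero>\<^bsub>H\<^esub>"
    using TD(1)[OF G.zero_closed] by (metis H.add.r_cancel_one)
  show ?thesis using assms(4,5)
  proof (induction A)
    case empty
    then show ?case by (simp add: zero)
  next
    case (insert a A)
    then have "(\<Oplus>\<^bsub>G\<^esub>i\<in>insert a A. x i) = x a \<oplus>\<^bsub>G\<^esub> (\<Oplus>\<^bsub>G\<^esub>i\<in>A. x i)"
      "(\<Oplus>\<^bsub>H\<^esub>i\<in>insert a A. T (x i)) = T (x a) \<oplus>\<^bsub>H\<^esub> (\<Oplus>\<^bsub>H\<^esub>i\<in>A. T (x i))"
      by (auto intro!: G.finsum_insert H.finsum_insert TD(1))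
    then show ?case using insert by (simp add: TD(2) G.finsum_closed Pi_def)
  qed
qed

text \<open>If \<open>S\<close> is a similarity with inverse \<open>R\<close>, then \<open>R \<Gamma> S\<close> intertwines whenever \<open>\<Gamma>\<close> does, because
\<open>R\<close> commutes with the finite linear combinations that define the action of a matrix on a tuple.\<close>

lemma weakly_homogeneous_similar:
  fixes \<mu> \<nu> :: "(complex^'d) measure"
  assumes \<mu>: "sphere_measure \<mu>" and \<nu>: "sphere_measure \<nu>"
    and sim: "similar_tuples (hardy_space \<mu>) (coord_mult \<mu>) (hardy_space \<nu>) (coord_mult \<nu>)"
    and hom: "weakly_unitarily_homogeneous (hardy_space \<nu>) (coord_mult \<nu>)"
  shows "weakly_unitarily_homogeneous (hardy_space \<mu>) (coord_mult \<mu>)"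
proof -
  interpret \<mu>: sphere_measure \<mu> by fact
  interpret \<nu>: sphere_measure \<nu> by fact
  let ?G = "hardy_space \<mu>" and ?H = "hardy_space \<nu>"
  let ?T = "coord_mult \<mu>" and ?T' = "coord_mult \<nu>"
  obtain S where S': "bounded_invertible_operator ?G ?H S \<and>
      (\<forall>j. \<forall>x\<in>carrier ?G. S (?T j x) = ?T' j (S x))"
    using sim unfolding similar_tuples_def by (rule exE)
  then have ST: "S (?T j x) = ?T' j (S x)" if "x \<in> carrier ?G" for j x using that by blast
  have S: "bounded_operator ?G ?H S"
    using S' unfolding bounded_invertible_operator_def by (elim conjE)
  obtain R where R': "bounded_operator ?H ?G R \<and> (\<forall>x\<in>carrier ?G. R (S x) = x) \<and>
      (\<forall>y\<in>carrier ?H. S (R y) = y)"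
    by (rule exE[OF S'[THEN conjunct1, unfolded bounded_invertible_operator_def, THEN conjunct2]])
  then have R: "bounded_operator ?H ?G R"
    and RS: "\<And>x. x \<in> carrier ?G \<Longrightarrow> R (S x) = x" and SR: "\<And>y. y \<in> carrier ?H \<Longrightarrow> S (R y) = y"
    by auto
  note [simp] = bounded_operatorD(1)[OF S] bounded_operatorD(1)[OF R] SR ST
    bounded_operatorD(1)[OF \<mu>.bounded_coord_mult] bounded_operatorD(1)[OF \<nu>.bounded_coord_mult]
  have RT: "R (?T' j y) = ?T j (R y)" if "y \<in> carrier ?H" for j y
  proof -
    have "R (?T' j y) = R (?T' j (S (R y)))" using that by simp
    also have "\<dots> = R (S (?T j (R y)))" using that by simp
    also have "\<dots> = ?T j (R y)" using that by (intro RS) simp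
    finally show ?thesis .
  qed
  have smult: "c \<odot>\<^bsub>?H\<^esub> y \<in> carrier ?H" if "y \<in> carrier ?H" for c y
    using that by (auto simp: \<nu>.carrier_hardy \<nu>.hardy_space_ops \<nu>.hardy_cmult)
  have act: "R (matrix_act_tuple ?H u ?T' j y) = matrix_act_tuple ?G u ?T j (R y)"
    if "y \<in> carrier ?H" for u j y
  proof -
    have "R (matrix_act_tuple ?H u ?T' j y) = (\<Oplus>\<^bsub>?G\<^esub>k\<in>UNIV. R (u $ j $ k \<odot>\<^bsub>?H\<^esub> ?T' k y))"
      unfolding matrix_act_tuple_def
      by (rule bounded_operator_finsum[OF \<nu>.abelian_group_hardy \<mu>.abelian_group_hardy R])
         (simp_all add: that smult)
    also have "\<dots> = matrix_act_tuple ?G u ?T j (R y)"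
      using that by (simp add: matrix_act_tuple_def bounded_operatorD(3)[OF R] RT)
    finally show ?thesis .
  qed
  show ?thesis
    unfolding weakly_unitarily_homogeneous_def
  proof (intro conjI allI impI \<mu>.commuting_coord_mult \<mu>.bounded_coord_mult)
    fix u :: "complex^'d^'d" assume "unitary_matrix u"
    then have "\<exists>\<Gamma>. bounded_invertible_operator ?H ?H \<Gamma> \<and>
        (\<forall>j. \<forall>x\<in>carrier ?H. \<Gamma> (?T' j x) = matrix_act_tuple ?H u ?T' j (\<Gamma> x))"
      using hom by (simp only: weakly_unitarily_homogeneous_def)
    then obtain \<Gamma> where \<Gamma>': "bounded_invertible_operator ?H ?H \<Gamma> \<and>
        (\<forall>j. \<forall>x\<in>carrier ?H. \<Gamma> (?T' j x) = matrix_act_tuple ?H u ?T' j (\<Gamma> x))"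
      by (rule exE)
    then have act\<Gamma>: "\<Gamma> (?T' j x) = matrix_act_tuple ?H u ?T' j (\<Gamma> x)" if "x \<in> carrier ?H" for j x
      using that by blast
    have \<Gamma>: "bounded_operator ?H ?H \<Gamma>"
      using \<Gamma>' unfolding bounded_invertible_operator_def by (elim conjE)
    obtain \<Lambda> where \<Lambda>': "bounded_operator ?H ?H \<Lambda> \<and> (\<forall>x\<in>carrier ?H. \<Lambda> (\<Gamma> x) = x) \<and>
        (\<forall>x\<in>carrier ?H. \<Gamma> (\<Lambda> x) = x)"
      by (rule exE[OF \<Gamma>'[THEN conjunct1, unfolded bounded_invertible_operator_def, THEN conjunct2]])
    then have \<Lambda>: "bounded_operator ?H ?H \<Lambda>"
      and inv: "\<And>x. x \<in> carrier ?H \<Longrightarrow> \<Lambda> (\<Gamma> x) = x" "\<And>x. x \<in> carrier ?H \<Longrightarrow> \<Gamma> (\<Lambda> x) = x"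
      by auto
    note [simp] = inv bounded_operatorD(1)[OF \<Gamma>] bounded_operatorD(1)[OF \<Lambda>]
    have conj: "bounded_operator ?G ?G (\<lambda>x. R (X (S x)))" if "bounded_operator ?H ?H X" for X
      by (intro bounded_operator_compose[OF bounded_operator_compose[OF S that] R] \<nu>.cnorm_hardy_nonneg)
    have "bounded_invertible_operator ?G ?G (\<lambda>x. R (\<Gamma> (S x)))"
      unfolding bounded_invertible_operator_def
      by (intro conjI conj[OF \<Gamma>] exI[of _ "\<lambda>x. R (\<Lambda> (S x))"] conj[OF \<Lambda>] ballI) (simp_all add: RS)
    moreover have "R (\<Gamma> (S (?T j x))) = matrix_act_tuple ?G u ?T j (R (\<Gamma> (S x)))"
      if "x \<in> carrier ?G" for j x
      using that by (simp add: act\<Gamma> act)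
    ultimately show "\<exists>\<Gamma>. bounded_invertible_operator ?G ?G \<Gamma> \<and>
        (\<forall>j. \<forall>x\<in>carrier ?G. \<Gamma> (?T j x) = matrix_act_tuple ?G u ?T j (\<Gamma> x))"
      by (intro exI[of _ "\<lambda>x. R (\<Gamma> (S x))"] conjI allI ballI)
  qed
qed

section \<open>Bounds on the Radon-Nikodym derivative\<close>

lemma (in finite_measure) scale_measure_of_RN_le:
  assumes "absolutely_continuous M N" "sets N = sets M"
    and "AE z in M. RN_deriv M N z \<le> K"
  shows "N \<le> scale_measure K M"
proof -
  have d: "density M (RN_deriv M N) = N" by (rule density_RN_deriv[OF assms(1,2)])
  have "emeasure N A \<le> K * emeasure M A" if A: "A \<in> sets M" for A
  proof -
    have "emeasure N A = (\<integral>\<^sup>+z. RN_deriv M N z * indicator A z \<partial>M)"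
      using A by (subst d[symmetric]) (simp add: emeasure_density)
    also have "\<dots> \<le> (\<integral>\<^sup>+z. K * indicator A z \<partial>M)"
      using assms(3) by (intro nn_integral_mono_AE) (auto elim!: eventually_mono intro: mult_right_mono)
    also have "\<dots> = K * emeasure M A" using A by (simp add: nn_integral_cmult_indicator)
    finally show ?thesis .
  qed
  then show ?thesis using assms(2) by (subst le_measure) auto
qed

text \<open>Test on the set where \<open>g < f\<close>: there the difference has integral zero.\<close>

lemma AE_le_of_nn_integral_le:
  fixes f g :: "'a \<Rightarrow> ennreal"
  assumes [measurable]: "f \<in> borel_measurable M" "g \<in> borel_measurable M"
    and fin: "(\<integral>\<^sup>+z. g z \<partial>M) \<noteq> \<infinity>"
    and le: "\<And>A. A \<in> sets M \<Longrightarrow> (\<integral>\<^sup>+z. f z * indicator A z \<partial>M) \<le> (\<integral>\<^sup>+z. g z * indicator A z \<partial>M)"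
  shows "AE z in M. f z \<le> g z"
proof -
  define A where "A = {z \<in> space M. g z < f z}"
  have [measurable]: "A \<in> sets M" by (simp add: A_def)
  have "(\<integral>\<^sup>+z. g z * indicator A z \<partial>M) \<le> (\<integral>\<^sup>+z. g z \<partial>M)"
    by (intro nn_integral_mono) (auto simp: indicator_def)
  then have fin': "(\<integral>\<^sup>+z. g z * indicator A z \<partial>M) \<noteq> \<infinity>" using fin by (auto simp: top_unique)
  have "(\<integral>\<^sup>+z. f z * indicator A z - g z * indicator A z \<partial>M) =
      (\<integral>\<^sup>+z. f z * indicator A z \<partial>M) - (\<integral>\<^sup>+z. g z * indicator A z \<partial>M)"
    using fin' by (intro nn_integral_diff) (auto simp: A_def indicator_def)
  also have "\<dots> = 0" using le[of A] fin' by (simp add: diff_eq_0_iff_ennreal less_top)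
  finally have "AE z in M. f z * indicator A z - g z * indicator A z = 0"
    by (simp add: nn_integral_0_iff_AE)
  then show ?thesis
  proof (rule AE_mp, intro AE_I2 impI)
    fix z assume z: "z \<in> space M" "f z * indicator A z - g z * indicator A z = 0"
    show "f z \<le> g z"
    proof (rule ccontr)
      assume "\<not> f z \<le> g z"
      then have "z \<in> A" "g z < f z" using z by (auto simp: A_def)
      then show False using z(2) by (auto simp: diff_eq_0_iff_ennreal top.not_eq_extremum)
    qed
  qed
qed

lemma (in finite_measure) RN_bounds:
  assumes s: "sets N = sets M" and K: "0 < K"
    and le: "N \<le> scale_measure (ennreal K) M" "M \<le> scale_measure (ennreal K) N"
  shows "absolutely_continuous M N"
    and "AE z in M. RN_deriv M N z \<le> ennreal K" "AE z in M. ennreal (1 / K) \<le> RN_deriv M N z"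
proof -
  have N: "emeasure N A \<le> ennreal K * emeasure M A" for A
    using le_measureD3[OF le(1)] s by (simp add: le_fun_def)
  have M: "emeasure M A \<le> ennreal K * emeasure N A" for A
    using le_measureD3[OF le(2)] s by (simp add: le_fun_def)
  show ac: "absolutely_continuous M N"
    unfolding absolutely_continuous_def
  proof
    fix A assume "A \<in> null_sets M"
    then show "A \<in> null_sets N" using N[of A] s by (auto simp: null_sets_def)
  qed
  have d: "density M (RN_deriv M N) = N" by (rule density_RN_deriv[OF ac s])
  let ?f = "RN_deriv M N"
  have NA: "emeasure N A = (\<integral>\<^sup>+z. ?f z * indicator A z \<partial>M)" if "A \<in> sets M" for A
    using that by (subst d[symmetric]) (simp add: emeasure_density)
  show "AE z in M. ?f z \<le> ennreal K"
  proof (rule AE_le_of_nn_integral_le)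
    show "(\<integral>\<^sup>+z. ennreal K \<partial>M) \<noteq> \<infinity>"
      by (simp add: emeasure_eq_measure ennreal_mult_eq_top_iff)
    fix A assume "A \<in> sets M"
    then show "(\<integral>\<^sup>+z. ?f z * indicator A z \<partial>M) \<le> (\<integral>\<^sup>+z. ennreal K * indicator A z \<partial>M)"
      using N[of A] by (simp add: NA nn_integral_cmult_indicator)
  qed auto
  show "AE z in M. ennreal (1 / K) \<le> ?f z"
  proof (rule AE_le_of_nn_integral_le)
    have "(\<integral>\<^sup>+z. ?f z \<partial>M) = emeasure N (space M)"
      using NA[of "space M"] by (simp cong: nn_integral_cong)
    also have "\<dots> \<le> ennreal K * emeasure M (space M)" by (rule N)
    also have "\<dots> < \<infinity>" by (simp add: emeasure_eq_measure ennreal_mult_less_top)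
    finally show "(\<integral>\<^sup>+z. ?f z \<partial>M) \<noteq> \<infinity>" by simp
    fix A assume A: "A \<in> sets M"
    have "ennreal (1 / K) * emeasure M A \<le> ennreal (1 / K) * (ennreal K * emeasure N A)"
      by (rule mult_left_mono[OF M]) simp
    also have "\<dots> = emeasure N A"
      using K by (simp add: mult.assoc[symmetric] ennreal_mult[symmetric])
    finally show "(\<integral>\<^sup>+z. ennreal (1 / K) * indicator A z \<partial>M) \<le> (\<integral>\<^sup>+z. ?f z * indicator A z \<partial>M)"
      using A by (simp add: NA nn_integral_cmult_indicator)
  qed auto
qed

section \<open>Averages over the circle\<close>

lemma mat_mult_nth: "(mat t *v (z :: complex^'d)) $ i = t * z $ i"
proof -
  have "(mat t *v z) $ i = (\<Sum>j\<in>UNIV. if j = i then t * z $ j else 0)"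
    unfolding matrix_vector_mult_def mat_def vec_lambda_beta by (rule sum.cong) auto
  then show ?thesis by simp
qed

lemma unitary_mat: "cmod t = 1 \<Longrightarrow> unitary_matrix (mat t :: complex^'d^'d)"
proof -
  assume "cmod t = 1"
  then have "cnj t * t = 1" using complex_norm_square[of t] by (simp add: mult.commute)
  moreover have "(\<Sum>k\<in>UNIV. cnj ((mat t :: complex^'d^'d) $ k $ i) * (mat t :: complex^'d^'d) $ k $ j) =
      (\<Sum>k\<in>UNIV. if k = i then if i = j then cnj t * t else 0 else 0)" for i j :: 'd
    by (intro sum.cong) (auto simp: mat_def)
  ultimately show ?thesis
    by (simp add: unitary_matrix_iff vec_eq_iff matrix_mult_nth adjoint_matrix_def)
       (simp add: mat_def)
qed

lemma cmonomial_mat: "cmonomial \<alpha> (mat t *v z) = t ^ (\<Sum>j\<in>UNIV. \<alpha> j) * cmonomial \<alpha> z"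
  by (simp add: cmonomial_def mat_mult_nth power_mult_distrib prod.distrib power_sum)

lemma root_of_unity_sum:
  fixes m N :: nat
  assumes "m < N"
  shows "(\<Sum>k<N. (cis (2 * pi * k / N)) ^ m) = (if m = 0 then of_nat N else 0)"
proof (cases "m = 0")
  case False
  define x where "x = cis (2 * pi * m / N)"
  have x: "x = exp (2 * of_real pi * \<i> * of_nat m / of_nat N)"
    by (simp add: x_def cis_conv_exp mult_ac)
  have "x \<noteq> 1"
    unfolding x using complex_root_unity_eq_1[of N m] assms False by (auto dest: dvd_imp_le)
  moreover have "x ^ N = 1"
    unfolding x using complex_root_unity[of N m] assms by simp
  ultimately have "(\<Sum>k<N. x ^ k) = 0" by (simp add: geometric_sum)
  moreover have "(cis (2 * pi * k / N)) ^ m = x ^ k" for k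
    by (simp add: x_def Complex.DeMoivre mult_ac)
  ultimately show ?thesis using False by simp
qed simp

text \<open>Averaging over the \<open>N\<close>-th roots of unity kills every homogeneous component whose degree is not a
multiple of \<open>N\<close>.  For \<open>N\<close> above the degree only the constant term is left.\<close>

lemma polynomial_root_average:
  assumes "p \<in> polynomial_functions"
  obtains N :: nat where "0 < N"
    "\<And>z. (\<Sum>k<N. p (mat (cis (2 * pi * k / N)) *v z)) = of_nat N * p 0"
proof -
  obtain A c where A: "finite A" "p = (\<lambda>z. \<Sum>\<alpha>\<in>A. c \<alpha> * cmonomial \<alpha> z)"
    using assms by (auto simp: polynomial_functions_def)
  define N where "N = Suc (\<Sum>\<alpha>\<in>A. \<Sum>j\<in>UNIV. \<alpha> j)"
  have mono: "(\<Sum>k<N. cmonomial \<alpha> (mat (cis (2 * pi * k / N)) *v z)) = of_nat N * cmonomial \<alpha> 0"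
    if "\<alpha> \<in> A" for \<alpha> z
  proof -
    have "(\<Sum>j\<in>UNIV. \<alpha> j) \<le> (\<Sum>\<alpha>\<in>A. \<Sum>j\<in>UNIV. \<alpha> j)"
      using A(1) that by (intro member_le_sum) auto
    then have "(\<Sum>j\<in>UNIV. \<alpha> j) < N" by (simp add: N_def)
    then have "(\<Sum>k<N. cmonomial \<alpha> (mat (cis (2 * pi * k / N)) *v z)) =
        (if (\<Sum>j\<in>UNIV. \<alpha> j) = 0 then of_nat N else 0) * cmonomial \<alpha> z"
      by (simp only: cmonomial_mat root_of_unity_sum flip: sum_distrib_right)
    also have "\<dots> = of_nat N * cmonomial \<alpha> 0"
    proof (cases "\<forall>j. \<alpha> j = 0")
      case False
      then show ?thesis by (auto simp: cmonomial_def)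
    qed (simp add: cmonomial_def)
    finally show ?thesis .
  qed
  have "(\<Sum>k<N. p (mat (cis (2 * pi * k / N)) *v z)) = of_nat N * p 0" for z
  proof -
    have "(\<Sum>k<N. p (mat (cis (2 * pi * k / N)) *v z)) =
        (\<Sum>\<alpha>\<in>A. c \<alpha> * (\<Sum>k<N. cmonomial \<alpha> (mat (cis (2 * pi * k / N)) *v z)))"
      unfolding A(2) sum_distrib_left by (rule sum.swap)
    also have "\<dots> = (\<Sum>\<alpha>\<in>A. c \<alpha> * (of_nat N * cmonomial \<alpha> 0))"
      by (intro sum.cong refl) (simp only: mono)
    also have "\<dots> = of_nat N * p 0" unfolding A(2) sum_distrib_left by (simp add: mult_ac)
    finally show ?thesis .
  qed
  then show ?thesis using that[of N] by (simp add: N_def)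
qed

lemma l2norm_sum:
  assumes "finite I" "\<And>i. i \<in> I \<Longrightarrow> square_integrable M (f i)"
  shows "square_integrable M (\<lambda>z. \<Sum>i\<in>I. f i z) \<and> l2norm M (\<lambda>z. \<Sum>i\<in>I. f i z) \<le> (\<Sum>i\<in>I. l2norm M (f i))"
  using assms
proof (induction I)
  case (insert i I)
  then show ?case
    using l2norm_triangle[of M "f i" "\<lambda>z. \<Sum>i\<in>I. f i z"] by (auto intro: square_integrable_add)
qed (simp add: square_integrable_def l2norm_def)

context sphere_measure
begin

lemma l2norm_invariant:
  assumes "unitary_matrix v" "rotated_measure v \<mu> = \<mu>" "continuous_on UNIV f"
  shows "l2norm \<mu> (\<lambda>z. f (v *v z)) = l2norm \<mu> f"
proof -
  have "(\<lambda>z. (cmod (f z))\<^sup>2) \<in> borel_measurable \<mu>"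
    by (intro measurable_continuous continuous_intros assms)
  from integral_rotated[OF assms(1) this] show ?thesis by (simp add: l2norm_def assms(2))
qed

lemma reinhardt_circle:
  assumes "reinhardt \<mu>" "cmod t = 1"
  shows "rotated_measure (mat t) \<mu> = \<mu>"
proof -
  have "(\<lambda>z :: complex^'d. \<chi> j. (\<chi> j. t) $ j * z $ j) = (\<lambda>z. mat t *v z)"
    by (simp add: fun_eq_iff vec_eq_iff mat_mult_nth)
  moreover have "distr \<mu> \<mu> (\<lambda>z. \<chi> j. (\<chi> j. t) $ j * z $ j) = \<mu>"
    using assms unfolding reinhardt_def by (metis vec_lambda_beta)
  ultimately show ?thesis by (simp add: rotated_measure_def)
qed

lemma integral_polynomial:
  assumes R: "reinhardt \<mu>" and p: "p \<in> polynomial_functions"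
  shows "(LINT z|\<mu>. p z) = p 0 * measure \<mu> (space \<mu>)"
proof -
  obtain N :: nat where N: "0 < N" "\<And>z :: complex^'d. (\<Sum>k<N. p (mat (cis (2 * pi * k / N)) *v z)) = of_nat N * p 0"
    using polynomial_root_average[OF p] by metis
  have inv: "(LINT z|\<mu>. p (mat (cis x) *v z)) = (LINT z|\<mu>. p z)" for x
    using integral_rotated[OF unitary_mat measurable_continuous[OF continuous_on_polynomial[OF p]], of "cis x"]
      reinhardt_circle[OF R, of "cis x"] by simp
  have "of_nat N * (LINT z|\<mu>. p z) = (\<Sum>k<N. (LINT z|\<mu>. p (mat (cis (2 * pi * k / N)) *v z)))"
    by (simp add: inv)
  also have "\<dots> = (LINT z|\<mu>. (\<Sum>k<N. p (mat (cis (2 * pi * k / N)) *v z)))"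
    by (intro Bochner_Integration.integral_sum[symmetric] integrable_continuous continuous_on_polynomial
        polynomial_compose_unitary p)
  also have "\<dots> = of_nat N * (p 0 * measure \<mu> (space \<mu>))" 
    by (simp add: N(2) scaleR_conv_of_real)
  finally show ?thesis using N(1) by simp
qed

lemma l2norm_root_average:
  assumes p: "p \<in> polynomial_functions" and q: "q \<in> polynomial_functions"
    and B: "\<And>t. cmod t = 1 \<Longrightarrow> l2norm \<mu> (\<lambda>z. p z * q (mat t *v z)) \<le> B"
  shows "cmod (q 0) * l2norm \<mu> p \<le> B"
proof -
  obtain N :: nat where N: "0 < N" "\<And>z :: complex^'d. (\<Sum>k<N. q (mat (cis (2 * pi * k / N)) *v z)) = of_nat N * q 0"
    using polynomial_root_average[OF q] by metis
  let ?f = "\<lambda>k z. p z * q (mat (cis (2 * pi * real k / real N)) *v z)"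
  have "real N * (cmod (q 0) * l2norm \<mu> p) = l2norm \<mu> (\<lambda>z. (of_nat N * q 0) * p z)"
    by (simp add: l2norm_cmult norm_mult)
  also have "(\<lambda>z. (of_nat N * q 0) * p z) = (\<lambda>z. \<Sum>k<N. ?f k z)"
    unfolding sum_distrib_left[symmetric] N(2) by (simp add: mult.commute)
  also have "l2norm \<mu> \<dots> \<le> (\<Sum>k<N. l2norm \<mu> (?f k))"
    by (intro l2norm_sum[THEN conjunct2] square_integrable_polynomial polynomial_mult p
        polynomial_compose_unitary q) auto
  also have "\<dots> \<le> (\<Sum>k<N. B)" by (intro sum_mono B) simp
  also have "\<dots> = real N * B" by simp
  finally show ?thesis using N(1) by simp
qed

end

section \<open>Weak homogeneity bounds the composition operators\<close>

text \<open>An intertwiner is determined by its value \<open>h\<close> on the constant 1: it is composition with \<open>u\<close>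
followed by multiplication by \<open>h\<close>.\<close>

lemma (in sphere_measure) intertwiner_on_polynomials:
  assumes \<Gamma>: "bounded_operator (hardy_space \<mu>) (hardy_space \<mu>) \<Gamma>"
    and act: "\<And>j x. x \<in> carrier (hardy_space \<mu>) \<Longrightarrow>
      \<Gamma> (coord_mult \<mu> j x) = matrix_act_tuple (hardy_space \<mu>) u (coord_mult \<mu>) j (\<Gamma> x)"
    and h: "hardy_function \<mu> h" "\<Gamma> (ae_class \<mu> (\<lambda>_. 1)) = ae_class \<mu> h"
    and p: "p \<in> polynomial_functions"
  shows "\<Gamma> (ae_class \<mu> p) = ae_class \<mu> (\<lambda>z. p (u *v z) * h z) \<and> hardy_function \<mu> (\<lambda>z. p (u *v z) * h z)"
  using p
proof (induction rule: polynomial_induct)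
  case (const c)
  have "ae_class \<mu> (\<lambda>_. c) = c \<odot>\<^bsub>hardy_space \<mu>\<^esub> ae_class \<mu> (\<lambda>_. 1)"
    by (simp add: hardy_space_ops hardy_polynomial polynomial_const)
  moreover have "\<Gamma> (c \<odot>\<^bsub>hardy_space \<mu>\<^esub> ae_class \<mu> (\<lambda>_. 1)) =
      c \<odot>\<^bsub>hardy_space \<mu>\<^esub> \<Gamma> (ae_class \<mu> (\<lambda>_. 1))"
    by (intro bounded_operatorD(3)[OF \<Gamma>] hardy_carrierI hardy_polynomial polynomial_const)
  ultimately have "\<Gamma> (ae_class \<mu> (\<lambda>_. c)) = c \<odot>\<^bsub>hardy_space \<mu>\<^esub> ae_class \<mu> h"
    by (simp only: h(2))
  then show ?case by (simp add: hardy_space_ops h hardy_cmult)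
next
  case (add p q)
  have "ae_class \<mu> (\<lambda>z. p z + q z) = ae_class \<mu> p \<oplus>\<^bsub>hardy_space \<mu>\<^esub> ae_class \<mu> q"
    using add by (simp add: hardy_space_ops hardy_polynomial)
  moreover have "\<Gamma> (ae_class \<mu> p \<oplus>\<^bsub>hardy_space \<mu>\<^esub> ae_class \<mu> q) =
      \<Gamma> (ae_class \<mu> p) \<oplus>\<^bsub>hardy_space \<mu>\<^esub> \<Gamma> (ae_class \<mu> q)"
    by (intro bounded_operatorD(2)[OF \<Gamma>] hardy_carrierI hardy_polynomial add)
  ultimately have "\<Gamma> (ae_class \<mu> (\<lambda>z. p z + q z)) =
      \<Gamma> (ae_class \<mu> p) \<oplus>\<^bsub>hardy_space \<mu>\<^esub> \<Gamma> (ae_class \<mu> q)"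
    by (simp only:)
  then show ?case
    using add by (simp add: hardy_space_ops distrib_right hardy_add)
next
  case (coord p j)
  let ?g = "\<lambda>z. p (u *v z) * h z"
  have "ae_class \<mu> (\<lambda>z. z $ j * p z) = coord_mult \<mu> j (ae_class \<mu> p)"
    using coord by (simp add: coord_mult_class hardy_functionD hardy_polynomial)
  then have "\<Gamma> (ae_class \<mu> (\<lambda>z. z $ j * p z)) = matrix_act_tuple (hardy_space \<mu>) u (coord_mult \<mu>) j (ae_class \<mu> ?g)"
    using coord by (simp add: act hardy_carrierI hardy_polynomial)
  also have "\<dots> = ae_class \<mu> (\<lambda>z. (u *v z) $ j * ?g z)"
    using coord by (intro matrix_act_class) simp
  finally have e: "\<Gamma> (ae_class \<mu> (\<lambda>z. z $ j * p z)) = ae_class \<mu> (\<lambda>z. (u *v z) $ j * p (u *v z) * h z)"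
    by (simp add: mult.assoc)
  have "(\<lambda>z. (u *v z) $ j * ?g z) = (\<lambda>z. \<Sum>k\<in>UNIV. u $ j $ k * (z $ k * ?g z))"
    by (simp add: matrix_vector_mult_def sum_distrib_right mult.assoc)
  then have "hardy_function \<mu> (\<lambda>z. (u *v z) $ j * ?g z)"
    using finsum_hardy[of UNIV "\<lambda>k z. u $ j $ k * (z $ k * ?g z)"] coord hardy_cmult[OF hardy_coord] by simp
  then show ?case using e by (simp add: mult.assoc)
qed

lemma (in sphere_measure) hardy_function_approx:
  assumes "hardy_function \<mu> f" "0 < e"
  obtains p where "p \<in> polynomial_functions" "l2norm \<mu> (\<lambda>z. f z - p z) < e"
  using assms unfolding hardy_function_def by blast

text \<open>Approximating \<open>h\<close> by polynomials \<open>q\<close> and using that the mean of a polynomial is its value at 0, the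
mean of \<open>(p \<circ> u) h\<close> is \<open>p(0)\<close> times the mean of \<open>h\<close>.  If the latter vanished, the range of \<open>\<Gamma>\<close>
would be orthogonal to the constants, contradicting surjectivity.\<close>

lemma (in sphere_measure) intertwiner_mean_nonzero:
  assumes R: "reinhardt \<mu>" and pos: "0 < measure \<mu> (space \<mu>)"
    and \<Gamma>: "bounded_invertible_operator (hardy_space \<mu>) (hardy_space \<mu>) \<Gamma>"
    and h: "hardy_function \<mu> h"
    and poly: "\<And>p. p \<in> polynomial_functions \<Longrightarrow> \<Gamma> (ae_class \<mu> p) = ae_class \<mu> (\<lambda>z. p (u *v z) * h z)"
    and polyh: "\<And>p. p \<in> polynomial_functions \<Longrightarrow> hardy_function \<mu> (\<lambda>z. p (u *v z) * h z)"
  shows "(LINT z|\<mu>. h z) \<noteq> 0"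
proof
  assume h0: "(LINT z|\<mu>. h z) = 0"
  define K where "K = sqrt (measure \<mu> (space \<mu>) + 1)"
  have K: "0 < K" by (simp add: K_def add_nonneg_pos)
  note int_le = integral_le_l2norm(2)[folded K_def] and int = integral_le_l2norm(1)
  have ortho: "(LINT z|\<mu>. p (u *v z) * h z) = 0" if p: "p \<in> polynomial_functions" for p
  proof -
    have pu: "(\<lambda>z. p (u *v z)) \<in> polynomial_functions" by (rule polynomial_compose_unitary[OF p])
    obtain B where B: "0 \<le> B" "\<And>z :: complex^'d. norm z = 1 \<Longrightarrow> cmod (p (u *v z)) \<le> B"
      using polynomial_bounded[OF pu] by blast
    have "cmod (LINT z|\<mu>. p (u *v z) * h z) \<le> e" if e: "0 < e" for e
    proof -
      \<comment> \<open>Total error: \<open>K B d\<close> from replacing \<open>h\<close> by \<open>q\<close>, and \<open>K |p(0)| d\<close> from the mean of \<open>q\<close>.\<close>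
      define d where "d = e / (K * (B + cmod (p 0)) + 1)"
      have D: "0 < K * (B + cmod (p 0)) + 1" using K B by (intro add_nonneg_pos mult_nonneg_nonneg) auto
      then have d: "0 < d" using e by (simp add: d_def)
      obtain q where q: "q \<in> polynomial_functions" "l2norm \<mu> (\<lambda>z. h z - q z) < d"
        using hardy_function_approx[OF h d] by blast
      have sq: "square_integrable \<mu> (\<lambda>z. h z - q z)"
        by (intro square_integrable_diff hardy_functionD(1)[OF h] square_integrable_polynomial q)
      have "(LINT z|\<mu>. h z - q z) = - (q 0 * measure \<mu> (space \<mu>))"
        using h0 int[OF hardy_functionD(1)[OF h]] int[OF square_integrable_polynomial[OF q(1)]]
        by (simp add: integral_polynomial[OF R q(1)])
      then have q0: "cmod (q 0 * measure \<mu> (space \<mu>)) \<le> K * d"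
        using int_le[OF sq] q(2) K by (smt (verit) norm_minus_cancel mult_left_mono)
      have sq2: "square_integrable \<mu> (\<lambda>z. p (u *v z) * (h z - q z))"
        and le2: "l2norm \<mu> (\<lambda>z. p (u *v z) * (h z - q z)) \<le> B * l2norm \<mu> (\<lambda>z. h z - q z)"
        using square_integrable_continuous_mult[OF continuous_on_polynomial[OF pu] sq B(2)] by auto
      have pq: "(\<lambda>z. p (u *v z) * q z) \<in> polynomial_functions" by (rule polynomial_mult[OF pu q(1)])
      have "(LINT z|\<mu>. p (u *v z) * h z) =
          (LINT z|\<mu>. p (u *v z) * (h z - q z)) + (LINT z|\<mu>. p (u *v z) * q z)"
        using int[OF sq2] int[OF square_integrable_polynomial[OF pq]]
        by (simp add: right_diff_distrib flip: Bochner_Integration.integral_add)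
      also have "(LINT z|\<mu>. p (u *v z) * q z) = p 0 * (q 0 * measure \<mu> (space \<mu>))"
        by (subst integral_polynomial[OF R pq]) simp
      finally have eq: "(LINT z|\<mu>. p (u *v z) * h z) =
          (LINT z|\<mu>. p (u *v z) * (h z - q z)) + p 0 * (q 0 * measure \<mu> (space \<mu>))" .
      have "cmod (LINT z|\<mu>. p (u *v z) * h z) \<le>
          cmod (LINT z|\<mu>. p (u *v z) * (h z - q z)) + cmod (p 0) * cmod (q 0 * measure \<mu> (space \<mu>))"
        unfolding eq norm_mult[of "p 0", symmetric] by (rule norm_triangle_ineq)
      also have "\<dots> \<le> K * (B * d) + cmod (p 0) * (K * d)"
      proof (intro add_mono mult_left_mono q0)
        have "cmod (LINT z|\<mu>. p (u *v z) * (h z - q z)) \<le> K * (B * l2norm \<mu> (\<lambda>z. h z - q z))"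
          using int_le[OF sq2] le2 K by (smt (verit) mult_left_mono)
        also have "\<dots> \<le> K * (B * d)" using K B q(2) by (intro mult_left_mono) auto
        finally show "cmod (LINT z|\<mu>. p (u *v z) * (h z - q z)) \<le> K * (B * d)" .
      qed simp
      also have "\<dots> \<le> (K * (B + cmod (p 0)) + 1) * d" using d by (simp add: algebra_simps)
      also have "\<dots> = e" using D by (simp add: d_def)
      finally show ?thesis .
    qed
    then have "cmod (LINT z|\<mu>. p (u *v z) * h z) \<le> 0" by (metis field_le_epsilon add_0)
    then show ?thesis by simp
  qed
  have \<Gamma>b: "bounded_operator (hardy_space \<mu>) (hardy_space \<mu>) \<Gamma>"
    by (rule bounded_invertible_operatorD(1)[OF \<Gamma>])
  obtain C where C: "\<And>x. x \<in> carrier (hardy_space \<mu>) \<Longrightarrow> cnorm (hardy_space \<mu>) (\<Gamma> x) \<le> C * cnorm (hardy_space \<mu>) x"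
    using bounded_operator_bound[OF \<Gamma>b] by blast
  have one: "ae_class \<mu> (\<lambda>_. 1) \<in> carrier (hardy_space \<mu>)"
    by (intro hardy_carrierI hardy_polynomial polynomial_const)
  \<comment> \<open>The constant 1 is a value of \<open>\<Gamma>\<close>, hence up to small norm the image of a polynomial, whose mean vanishes.\<close>
  have "\<exists>x\<in>carrier (hardy_space \<mu>). \<Gamma> x = ae_class \<mu> (\<lambda>_. 1)"
    by (rule bounded_invertible_operatorD(2)[OF \<Gamma> one])
  then obtain g where g: "hardy_function \<mu> g" "\<Gamma> (ae_class \<mu> g) = ae_class \<mu> (\<lambda>_. 1)"
    by (auto simp: carrier_hardy)
  have "measure \<mu> (space \<mu>) \<le> e" if e: "0 < e" for e
  proof -
    define d where "d = e / (K * (\<bar>C\<bar> + 1))"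
    have d: "0 < d" using e K by (simp add: d_def)
    obtain p where p: "p \<in> polynomial_functions" "l2norm \<mu> (\<lambda>z. g z - p z) < d"
      using hardy_function_approx[OF g(1) d] by blast
    have gp: "hardy_function \<mu> (\<lambda>z. g z - p z)"
      using hardy_add[OF g(1) hardy_cmult[OF hardy_polynomial[OF p(1)], of "-1"]] by simp
    have "\<Gamma> (ae_class \<mu> (\<lambda>z. g z - p z)) \<in> carrier (hardy_space \<mu>)"
      by (rule bounded_operatorD(1)[OF \<Gamma>b hardy_carrierI[OF gp]])
    then obtain k where k: "hardy_function \<mu> k" "\<Gamma> (ae_class \<mu> (\<lambda>z. g z - p z)) = ae_class \<mu> k"
      by (auto simp: carrier_hardy)
    have "l2norm \<mu> k \<le> C * l2norm \<mu> (\<lambda>z. g z - p z)"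
      using C[OF hardy_carrierI[OF gp]] by (simp add: k hardy_space_ops gp)
    also have "\<dots> \<le> (\<bar>C\<bar> + 1) * d" using p(2) by (intro mult_mono) auto
    finally have kn: "l2norm \<mu> k \<le> (\<bar>C\<bar> + 1) * d" .
    have "ae_class \<mu> g = ae_class \<mu> p \<oplus>\<^bsub>hardy_space \<mu>\<^esub> ae_class \<mu> (\<lambda>z. g z - p z)"
      using p gp by (simp add: hardy_space_ops hardy_polynomial)
    moreover have "\<Gamma> (ae_class \<mu> p \<oplus>\<^bsub>hardy_space \<mu>\<^esub> ae_class \<mu> (\<lambda>z. g z - p z)) =
        \<Gamma> (ae_class \<mu> p) \<oplus>\<^bsub>hardy_space \<mu>\<^esub> \<Gamma> (ae_class \<mu> (\<lambda>z. g z - p z))"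
      by (intro bounded_operatorD(2)[OF \<Gamma>b] hardy_carrierI hardy_polynomial p gp)
    ultimately have "\<Gamma> (ae_class \<mu> g) = ae_class \<mu> (\<lambda>z. p (u *v z) * h z) \<oplus>\<^bsub>hardy_space \<mu>\<^esub> ae_class \<mu> k"
      by (simp only: k(2) poly[OF p(1)])
    also have "\<dots> = ae_class \<mu> (\<lambda>z. p (u *v z) * h z + k z)"
      by (rule hardy_space_ops(1)[OF polyh[OF p(1)] k(1)])
    finally have "ae_class \<mu> (\<lambda>_. 1) = ae_class \<mu> (\<lambda>z. p (u *v z) * h z + k z)" by (simp only: g(2))
    then have ae: "AE z in \<mu>. 1 = p (u *v z) * h z + k z" by (simp add: ae_class_eq_iff)
    have [measurable]: "(\<lambda>z. p (u *v z) * h z) \<in> borel_measurable \<mu>" "k \<in> borel_measurable \<mu>"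
      by (rule hardy_functionD[OF polyh[OF p(1)]] hardy_functionD[OF k(1)])+
    have "complex_of_real (measure \<mu> (space \<mu>)) = (LINT z|\<mu>. 1)" by (simp add: scaleR_conv_of_real)
    also have "\<dots> = (LINT z|\<mu>. p (u *v z) * h z + k z)"
      by (rule integral_cong_AE) (use ae in auto)
    also have "\<dots> = (LINT z|\<mu>. k z)"
      using int[OF hardy_functionD(1)[OF polyh[OF p(1)]]] int[OF hardy_functionD(1)[OF k(1)]]
      by (simp add: ortho[OF p(1)])
    finally have "measure \<mu> (space \<mu>) = cmod (LINT z|\<mu>. k z)"
      by (metis abs_of_nonneg measure_nonneg norm_of_real)
    also have "\<dots> \<le> K * l2norm \<mu> k" by (rule int_le[OF hardy_functionD(1)[OF k(1)]])
    also have "\<dots> \<le> K * ((\<bar>C\<bar> + 1) * d)" using kn K by (intro mult_left_mono) auto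
    also have "\<dots> = e" using K by (simp add: d_def)
    finally show ?thesis .
  qed
  then have "measure \<mu> (space \<mu>) \<le> 0" by (metis field_le_epsilon add_0)
  then show False using pos by simp
qed

text \<open>The multiplier \<open>h\<close> of an intertwiner can be unbounded.  Invariance of \<open>\<mu>\<close> under the circle removes
it: replacing \<open>p\<close> by \<open>z \<mapsto> p(z / t)\<close> for unimodular \<open>t\<close> leaves the norm of \<open>p\<close> unchanged and turns
\<open>h\<close> into \<open>h(t z)\<close>, so that averaging over \<open>t\<close> replaces \<open>h\<close> by its mean, which is not zero.  What
is left is a bound for \<open>p \<circ> u\<close>.  The average is taken over roots of unity and for polynomials \<open>q\<close>
close to \<open>h\<close>.\<close>

lemma (in sphere_measure) composition_bound_of_homogeneous:
  assumes R: "reinhardt \<mu>" and pos: "0 < measure \<mu> (space \<mu>)"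
    and hom: "weakly_unitarily_homogeneous (hardy_space \<mu>) (coord_mult \<mu>)"
    and u: "unitary_matrix u"
  shows "\<exists>C. \<forall>p\<in>polynomial_functions. l2norm \<mu> (\<lambda>z. p (u *v z)) \<le> C * l2norm \<mu> p"
proof -
  have "\<exists>\<Gamma>. bounded_invertible_operator (hardy_space \<mu>) (hardy_space \<mu>) \<Gamma> \<and>
      (\<forall>j. \<forall>x\<in>carrier (hardy_space \<mu>).
        \<Gamma> (coord_mult \<mu> j x) = matrix_act_tuple (hardy_space \<mu>) u (coord_mult \<mu>) j (\<Gamma> x))"
    using hom u by (simp only: weakly_unitarily_homogeneous_def)
  then obtain \<Gamma> where \<Gamma>: "bounded_invertible_operator (hardy_space \<mu>) (hardy_space \<mu>) \<Gamma> \<and>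
      (\<forall>j. \<forall>x\<in>carrier (hardy_space \<mu>).
        \<Gamma> (coord_mult \<mu> j x) = matrix_act_tuple (hardy_space \<mu>) u (coord_mult \<mu>) j (\<Gamma> x))"
    by (rule exE)
  note \<Gamma>i = \<Gamma>[THEN conjunct1]
  have act: "\<Gamma> (coord_mult \<mu> j x) = matrix_act_tuple (hardy_space \<mu>) u (coord_mult \<mu>) j (\<Gamma> x)"
    if "x \<in> carrier (hardy_space \<mu>)" for j x
    using \<Gamma> that by blast
  have \<Gamma>b: "bounded_operator (hardy_space \<mu>) (hardy_space \<mu>) \<Gamma>"
    by (rule bounded_invertible_operatorD(1)[OF \<Gamma>i])
  have "\<Gamma> (ae_class \<mu> (\<lambda>_. 1)) \<in> carrier (hardy_space \<mu>)"
    by (intro bounded_operatorD(1)[OF \<Gamma>b] hardy_carrierI hardy_polynomial polynomial_const)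
  then obtain h where h: "hardy_function \<mu> h" "\<Gamma> (ae_class \<mu> (\<lambda>_. 1)) = ae_class \<mu> h"
    by (auto simp: carrier_hardy)
  have poly: "\<Gamma> (ae_class \<mu> p) = ae_class \<mu> (\<lambda>z. p (u *v z) * h z) \<and>
      hardy_function \<mu> (\<lambda>z. p (u *v z) * h z)" if "p \<in> polynomial_functions" for p
    by (rule intertwiner_on_polynomials[OF \<Gamma>b act h that])
  obtain C0 where C0: "\<And>x. x \<in> carrier (hardy_space \<mu>) \<Longrightarrow> cnorm (hardy_space \<mu>) (\<Gamma> x) \<le> C0 * cnorm (hardy_space \<mu>) x"
    using bounded_operator_bound[OF \<Gamma>b] by blast
  have C: "l2norm \<mu> (\<lambda>z. p (u *v z) * h z) \<le> C0 * l2norm \<mu> p" if "p \<in> polynomial_functions" for p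
    using C0[OF hardy_carrierI[OF hardy_polynomial[OF that]]] poly[OF that]
    by (simp add: hardy_space_ops hardy_polynomial that)
  define c where "c = (LINT z|\<mu>. h z)"
  have c: "c \<noteq> 0"
    unfolding c_def using poly by (intro intertwiner_mean_nonzero[OF R pos \<Gamma>i h(1)]) auto
  define m where "m = measure \<mu> (space \<mu>)"
  have m: "0 < m" using pos by (simp add: m_def)
  define K where "K = sqrt (measure \<mu> (space \<mu>) + 1)"
  note int_le = integral_le_l2norm(2)[folded K_def] and int = integral_le_l2norm(1)
  have "l2norm \<mu> (\<lambda>z. p (u *v z)) \<le> m * C0 / cmod c * l2norm \<mu> p" if p: "p \<in> polynomial_functions" for p
  proof -
    have pu: "(\<lambda>z. p (u *v z)) \<in> polynomial_functions" by (rule polynomial_compose_unitary[OF p])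
    obtain B where B: "0 \<le> B" "\<And>z :: complex^'d. norm z = 1 \<Longrightarrow> cmod (p z) \<le> B"
      using polynomial_bounded[OF p] by blast
    let ?L = "l2norm \<mu> (\<lambda>z. p (u *v z))"
    have step: "cmod c * ?L \<le> m * C0 * l2norm \<mu> p + e * (m * B + K * ?L)" if e: "0 < e" for e
    proof -
      obtain q where q: "q \<in> polynomial_functions" "l2norm \<mu> (\<lambda>z. h z - q z) < e"
        using hardy_function_approx[OF h(1) e] by blast
      have sq: "square_integrable \<mu> (\<lambda>z. h z - q z)"
        by (intro square_integrable_diff hardy_functionD(1)[OF h(1)] square_integrable_polynomial q)
      have "l2norm \<mu> (\<lambda>z. p (u *v z) * q (mat t *v z)) \<le> C0 * l2norm \<mu> p + B * e" if t: "cmod t = 1" for t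
      proof -
        let ?s = "mat (cnj t) :: complex^'d^'d"
        have t': "cmod (cnj t) = 1" using t by simp
        have us: "u *v (?s *v z) = ?s *v (u *v z)" for z
        proof -
          have "?s *v x = cnj t *s x" for x :: "complex^'d" by (simp add: vec_eq_iff mat_mult_nth)
          then show ?thesis by (simp add: vector_scalar_commute)
        qed
        have ts: "mat t *v (?s *v z) = z" for z :: "complex^'d"
          using t complex_norm_square[of t] by (simp add: vec_eq_iff mat_mult_nth mult.assoc[symmetric])
        \<comment> \<open>Since \<open>\<mu>\<close> is invariant under \<open>t\<close>, the rotation can be moved from \<open>q\<close> to \<open>p\<close>, whose norm ignores it.\<close>
        let ?r = "\<lambda>z. p (?s *v z)"
        have r: "?r \<in> polynomial_functions" by (rule polynomial_compose_unitary[OF p])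
        have ru: "(\<lambda>z. ?r (u *v z)) \<in> polynomial_functions" by (rule polynomial_compose_unitary[OF r])
        have "continuous_on UNIV (\<lambda>z. p (u *v z) * q (mat t *v z))"
          by (intro continuous_on_polynomial polynomial_mult pu polynomial_compose_unitary q)
        from l2norm_invariant[OF unitary_mat[OF t'] reinhardt_circle[OF R t'] this]
        have "l2norm \<mu> (\<lambda>z. p (u *v z) * q (mat t *v z)) = l2norm \<mu> (\<lambda>z. ?r (u *v z) * q z)"
          by (simp add: us ts)
        also have "\<dots> \<le> l2norm \<mu> (\<lambda>z. ?r (u *v z) * h z) + l2norm \<mu> (\<lambda>z. ?r (u *v z) * q z - ?r (u *v z) * h z)"
          by (rule l2norm_triangle_diff[OF square_integrable_polynomial[OF polynomial_mult[OF ru q(1)]]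
                hardy_functionD(1)[OF poly[OF r, THEN conjunct2]]])
        also have "l2norm \<mu> (\<lambda>z. ?r (u *v z) * q z - ?r (u *v z) * h z) = l2norm \<mu> (\<lambda>z. ?r (u *v z) * (h z - q z))"
          by (subst l2norm_diff_commute) (simp add: right_diff_distrib)
        also have "\<dots> \<le> B * l2norm \<mu> (\<lambda>z. h z - q z)"
          by (rule square_integrable_continuous_mult(2)[OF continuous_on_polynomial[OF ru] sq])
             (simp add: B norm_unitary_matrix_vector[OF u] norm_unitary_matrix_vector[OF unitary_mat[OF t']])
        also have "l2norm \<mu> (\<lambda>z. ?r (u *v z) * h z) \<le> C0 * l2norm \<mu> ?r" by (rule C[OF r])
        also have "l2norm \<mu> ?r = l2norm \<mu> p"
          by (rule l2norm_invariant[OF unitary_mat[OF t'] reinhardt_circle[OF R t'] continuous_on_polynomial[OF p]])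
        also have "B * l2norm \<mu> (\<lambda>z. h z - q z) \<le> B * e" using q(2) B by (intro mult_left_mono) auto
        finally show ?thesis by simp
      qed
      from l2norm_root_average[OF pu q(1) this]
      have "cmod (q 0) * ?L \<le> C0 * l2norm \<mu> p + B * e" .
      then have A: "m * (cmod (q 0) * ?L) \<le> m * (C0 * l2norm \<mu> p + B * e)" using m by (intro mult_left_mono) auto
      have "c - q 0 * m = (LINT z|\<mu>. h z - q z)"
        using int[OF hardy_functionD(1)[OF h(1)]] int[OF square_integrable_polynomial[OF q(1)]]
        by (simp add: c_def m_def integral_polynomial[OF R q(1)])
      then have "cmod (c - q 0 * m) \<le> K * e"
        using int_le[OF sq] q(2) unfolding K_def by (smt (verit) mult_left_mono real_sqrt_ge_zero measure_nonneg)
      then have "cmod c \<le> m * cmod (q 0) + K * e"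
        using norm_triangle_ineq2[of c "q 0 * m"] m by (simp add: norm_mult mult.commute)
      then have "cmod c * ?L \<le> (m * cmod (q 0) + K * e) * ?L" by (rule mult_right_mono) simp
      then show ?thesis using A by (simp add: algebra_simps)
    qed
    have "cmod c * ?L \<le> m * C0 * l2norm \<mu> p"
    proof (rule field_le_epsilon)
      fix e :: real assume e: "0 < e"
      define D where "D = m * B + K * ?L + 1"
      have D: "0 < D" unfolding D_def K_def using m B by (intro add_nonneg_pos add_nonneg_nonneg mult_nonneg_nonneg) auto
      have "cmod c * ?L \<le> m * C0 * l2norm \<mu> p + e / D * (m * B + K * ?L)"
        using e D by (intro step) simp
      also have "e / D * (m * B + K * ?L) \<le> e / D * D"
        using e D by (intro mult_left_mono) (auto simp: D_def)
      finally show "cmod c * ?L \<le> m * C0 * l2norm \<mu> p + e" using D by simp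
    qed
    then show ?thesis using c by (simp add: field_simps)
  qed
  then show ?thesis by blast
qed

section \<open>Uniformity over the unitary group\<close>

lemma (in sphere_measure) closed_composition_bound:
  "closed {u :: complex^'d^'d. unitary_matrix u \<and>
    (\<forall>p\<in>polynomial_functions. l2norm \<mu> (\<lambda>z. p (u *v z)) \<le> C * l2norm \<mu> p)}" (is "closed ?F")
  unfolding closed_sequential_limits
proof (intro allI impI)
  fix x :: "nat \<Rightarrow> complex^'d^'d" and u
  assume *: "(\<forall>n. x n \<in> ?F) \<and> x \<longlonglongrightarrow> u"
  have x: "unitary_matrix (x n)" for n using * by blast
  have lim: "x \<longlonglongrightarrow> u" using * by blast
  have u: "unitary_matrix u"
    using closed_sequentially[OF compact_imp_closed[OF compact_unitary] _ lim] x by simp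
  have "l2norm \<mu> (\<lambda>z. p (u *v z)) \<le> C * l2norm \<mu> p" if p: "p \<in> polynomial_functions" for p
  proof -
    obtain B where B: "0 \<le> B" "\<And>z :: complex^'d. norm z = 1 \<Longrightarrow> cmod (p z) \<le> B"
      using polynomial_bounded[OF p] by blast
    have m: "(\<lambda>z. (cmod (p (v *v z)))\<^sup>2) \<in> borel_measurable \<mu>" for v
      by (intro measurable_continuous continuous_intros continuous_on_polynomial polynomial_compose_unitary p)
    have pt: "(\<lambda>n. (cmod (p (x n *v z)))\<^sup>2) \<longlonglongrightarrow> (cmod (p (u *v z)))\<^sup>2" for z
    proof -
      have "continuous_on UNIV (\<lambda>v :: complex^'d^'d. (cmod (p (v *v z)))\<^sup>2)"
        by (intro continuous_intros continuous_on_compose2[OF continuous_on_polynomial[OF p]]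
            continuous_on_matrix_vector continuous_on_id) auto
      then have "isCont (\<lambda>v :: complex^'d^'d. (cmod (p (v *v z)))\<^sup>2) u"
        by (simp add: continuous_on_eq_continuous_at)
      then show ?thesis by (rule isCont_tendsto_compose[OF _ lim])
    qed
    have "(\<lambda>n. LINT z|\<mu>. (cmod (p (x n *v z)))\<^sup>2) \<longlonglongrightarrow> (LINT z|\<mu>. (cmod (p (u *v z)))\<^sup>2)"
    proof (rule integral_dominated_convergence[where w = "\<lambda>_. B\<^sup>2"])
      show "AE z in \<mu>. norm ((cmod (p (x n *v z)))\<^sup>2) \<le> B\<^sup>2" for n
        using B x by (intro AE_I2) (simp add: in_space_iff norm_unitary_matrix_vector power_mono)
    qed (use m pt in auto)
    then have "(\<lambda>n. l2norm \<mu> (\<lambda>z. p (x n *v z))) \<longlonglongrightarrow> l2norm \<mu> (\<lambda>z. p (u *v z))"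
      unfolding l2norm_def by (rule tendsto_real_sqrt)
    moreover have "l2norm \<mu> (\<lambda>z. p (x n *v z)) \<le> C * l2norm \<mu> p" for n
      using * p by blast
    ultimately show ?thesis by (intro LIMSEQ_le_const2) auto
  qed
  then show "u \<in> ?F" using u by blast
qed

text \<open>The sets \<open>F n\<close> of unitaries with bound \<open>n\<close> are closed and cover the compact group, so by Baire one of
them contains a neighbourhood of some \<open>u0\<close>.  Finitely many translates of that neighbourhood cover the
group, and the bounds are submultiplicative.\<close>

lemma (in sphere_measure) uniform_composition_bound:
  assumes pt: "\<And>u :: complex^'d^'d. unitary_matrix u \<Longrightarrow>
    \<exists>C. \<forall>p\<in>polynomial_functions. l2norm \<mu> (\<lambda>z. p (u *v z)) \<le> C * l2norm \<mu> p"
  shows "\<exists>K\<ge>0. \<forall>u :: complex^'d^'d. unitary_matrix u \<longrightarrow>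
    (\<forall>p\<in>polynomial_functions. l2norm \<mu> (\<lambda>z. p (u *v z)) \<le> K * l2norm \<mu> p)"
proof -
  let ?U = "Collect unitary_matrix :: (complex^'d^'d) set"
  define F where "F n = {u :: complex^'d^'d. unitary_matrix u \<and>
    (\<forall>p\<in>polynomial_functions. l2norm \<mu> (\<lambda>z. p (u *v z)) \<le> real n * l2norm \<mu> p)}" for n
  have closed: "closed (F n)" for n unfolding F_def by (rule closed_composition_bound)
  have cover: "\<exists>n. u \<in> F n" if u: "unitary_matrix u" for u
  proof -
    obtain C where C: "\<forall>p\<in>polynomial_functions. l2norm \<mu> (\<lambda>z. p (u *v z)) \<le> C * l2norm \<mu> p"
      using pt[OF u] by blast
    obtain n :: nat where n: "C \<le> real n" using real_arch_simple by blast
    have "l2norm \<mu> (\<lambda>z. p (u *v z)) \<le> real n * l2norm \<mu> p" if "p \<in> polynomial_functions" for p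
    proof -
      have "C * l2norm \<mu> p \<le> real n * l2norm \<mu> p" using n by (rule mult_right_mono) simp
      then show ?thesis using C that by (meson order_trans)
    qed
    then show ?thesis using u by (auto simp: F_def)
  qed
  have one: "mat 1 \<in> ?U" using unitary_mat[of 1] by simp
  have "\<exists>n. \<not> ?U \<subseteq> closure (?U - F n)"
  proof (rule ccontr)
    assume "\<not> (\<exists>n. \<not> ?U \<subseteq> closure (?U - F n))"
    then have dense: "?U \<subseteq> closure (?U - F n)" for n by blast
    have "?U \<subseteq> closure (\<Inter>(range (\<lambda>n. ?U - F n)))"
    proof (rule Baire[OF compact_imp_closed[OF compact_unitary]])
      fix T assume "T \<in> range (\<lambda>n. ?U - F n)"
      then obtain n where T: "T = ?U - F n" by blast
      have "openin (top_of_set ?U) (?U \<inter> - F n)"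
        using closed[of n] by (intro openin_open_Int) (simp add: open_Compl)
      then show "openin (top_of_set ?U) T \<and> ?U \<subseteq> closure T"
        using dense[of n] by (simp add: T Diff_eq)
    qed simp
    also have "\<Inter>(range (\<lambda>n. ?U - F n)) = {}" using cover by blast
    finally show False using one by auto
  qed
  then obtain n u0 where u0: "unitary_matrix u0" "u0 \<notin> closure (?U - F n)" by blast
  then obtain e where e: "0 < e" "\<And>v. v \<in> ?U - F n \<Longrightarrow> \<not> dist v u0 < e"
    unfolding closure_approachable by blast
  have near: "v \<in> F n" if "unitary_matrix v" "dist u0 v < e" for v
    using e(2)[of v] that by (auto simp: dist_commute)
  define W where "W a = (\<lambda>u. adjoint_matrix a ** u) -` ball u0 e" for a :: "complex^'d^'d"
  have W: "open (W a)" for a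
    unfolding W_def
    by (rule open_vimage[OF open_ball]) (intro continuous_on_matrix_mult continuous_on_const continuous_on_id)
  have "?U \<subseteq> (\<Union>a\<in>?U. W a)"
  proof
    fix u :: "complex^'d^'d" assume "u \<in> ?U"
    then have u: "unitary_matrix u" by simp
    have a: "unitary_matrix (u ** adjoint_matrix u0)" by (intro unitary_mult unitary_adjoint u u0(1))
    have "adjoint_matrix (u ** adjoint_matrix u0) ** u = u0 ** (adjoint_matrix u ** u)"
      by (simp add: adjoint_matrix_mult matrix_mul_assoc)
    also have "\<dots> = u0" using u by (simp add: unitary_matrix_iff)
    finally have "u \<in> W (u ** adjoint_matrix u0)" using e(1) by (simp add: W_def)
    then show "u \<in> (\<Union>a\<in>?U. W a)" using a by blast
  qed
  then obtain D where D: "D \<subseteq> ?U" "finite D" "?U \<subseteq> (\<Union>a\<in>D. W a)"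
    using compactE_image[OF compact_unitary, of ?U W] W by metis
  have "\<forall>a\<in>D. \<exists>C. \<forall>p\<in>polynomial_functions. l2norm \<mu> (\<lambda>z. p (a *v z)) \<le> C * l2norm \<mu> p"
    using D(1) pt by blast
  then obtain C where C: "\<And>a p. a \<in> D \<Longrightarrow> p \<in> polynomial_functions \<Longrightarrow>
      l2norm \<mu> (\<lambda>z. p (a *v z)) \<le> C a * l2norm \<mu> p"
    by metis
  define K where "K = real n * (\<Sum>a\<in>D. \<bar>C a\<bar>)"
  show ?thesis
  proof (intro exI[of _ K] conjI allI impI ballI)
    show "0 \<le> K" by (simp add: K_def sum_nonneg)
    fix u :: "complex^'d^'d" and p :: "complex^'d \<Rightarrow> complex"
    assume u: "unitary_matrix u" and p: "p \<in> polynomial_functions"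
    obtain a where a: "a \<in> D" "u \<in> W a" using D(3) u by auto
    have au: "unitary_matrix a" using a D by auto
    let ?b = "adjoint_matrix a ** u"
    have "?b \<in> F n"
      using a(2) by (intro near unitary_mult unitary_adjoint au u) (simp add: W_def)
    moreover have pa: "(\<lambda>z. p (a *v z)) \<in> polynomial_functions" by (rule polynomial_compose_unitary[OF p])
    ultimately have "l2norm \<mu> (\<lambda>z. p (a *v (?b *v z))) \<le> real n * l2norm \<mu> (\<lambda>z. p (a *v z))"
      by (auto simp: F_def)
    also have "(\<lambda>z. p (a *v (?b *v z))) = (\<lambda>z. p (u *v z))"
      by (simp add: unitary_adjoint_cancel[OF au] flip: matrix_vector_mul_assoc)
    also have "real n * l2norm \<mu> (\<lambda>z. p (a *v z)) \<le> real n * (\<bar>C a\<bar> * l2norm \<mu> p)"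
      by (intro mult_left_mono order_trans[OF C[OF a(1) p]] mult_right_mono) auto
    also have "\<dots> \<le> real n * ((\<Sum>a\<in>D. \<bar>C a\<bar>) * l2norm \<mu> p)"
      using D(2) a(1) by (intro mult_left_mono mult_right_mono member_le_sum) auto
    finally show "l2norm \<mu> (\<lambda>z. p (u *v z)) \<le> K * l2norm \<mu> p" by (simp add: K_def mult.assoc)
  qed
qed

section \<open>Comparison with the rotated measures and with surface measure\<close>

context sphere_measure
begin

lemma rotated_le_of_composition_bound:
  assumes K: "0 \<le> K" and u: "unitary_matrix u"
    and bound: "\<And>p. p \<in> polynomial_functions \<Longrightarrow> l2norm \<mu> (\<lambda>z. p (u *v z)) \<le> K * l2norm \<mu> p"
  shows "rotated_measure u \<mu> \<le> scale_measure (ennreal (K\<^sup>2)) \<mu>"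
proof (rule measure_le_of_peak_le[OF sphere_measure_rotated[OF u] sphere_measure_axioms])
  fix n and w :: "complex^'d"
  have "(\<lambda>z. (cmod (peak n w z))\<^sup>2) \<in> borel_measurable \<mu>"
    by (intro measurable_continuous continuous_intros continuous_on_peak)
  then have "(LINT z|rotated_measure u \<mu>. (cmod (peak n w z))\<^sup>2) = (l2norm \<mu> (\<lambda>z. peak n w (u *v z)))\<^sup>2"
    by (simp add: integral_rotated[OF u] l2norm_square)
  also have "\<dots> \<le> (K * l2norm \<mu> (peak n w))\<^sup>2"
    by (intro power_mono bound polynomial_peak) simp
  finally show "(LINT z|rotated_measure u \<mu>. (cmod (peak n w z))\<^sup>2) \<le> K\<^sup>2 * (LINT z|\<mu>. (cmod (peak n w z))\<^sup>2)"
    by (simp add: power_mult_distrib l2norm_square)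
qed simp

text \<open>The preimage of \<open>u^{-1} A\<close> under the inverse unitary is \<open>A\<close>, so the upper bound for the inverse,
evaluated at \<open>u^{-1} A\<close>, is a lower bound for \<open>u\<close>.\<close>

lemma le_rotated:
  assumes u: "unitary_matrix u"
    and le: "rotated_measure (adjoint_matrix u) \<mu> \<le> scale_measure K \<mu>"
  shows "\<mu> \<le> scale_measure K (rotated_measure u \<mu>)"
proof -
  have "emeasure \<mu> A \<le> K * emeasure (rotated_measure u \<mu>) A" if A: "A \<in> sets \<mu>" for A
  proof -
    let ?B = "(\<lambda>z. u *v z) -` A \<inter> space \<mu>"
    have B: "?B \<in> sets \<mu>" by (rule measurable_sets[OF measurable_unitary[OF u] A])
    have "(\<lambda>z. adjoint_matrix u *v z) -` ?B \<inter> space \<mu> = A"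
      using sets.sets_into_space[OF A]
      by (auto simp: unitary_adjoint_cancel[OF u] in_space_iff
          norm_unitary_matrix_vector[OF unitary_adjoint[OF u]])
    then have "emeasure \<mu> A = emeasure (rotated_measure (adjoint_matrix u) \<mu>) ?B"
      unfolding rotated_measure_def
      by (subst emeasure_distr[OF measurable_unitary[OF unitary_adjoint[OF u]] B]) simp
    also have "\<dots> \<le> K * emeasure \<mu> ?B"
      using le_measureD3[OF le] by (simp add: rotated_measure_def le_fun_def)
    also have "emeasure \<mu> ?B = emeasure (rotated_measure u \<mu>) A"
      unfolding rotated_measure_def by (rule emeasure_distr[OF measurable_unitary[OF u] A, symmetric])
    finally show ?thesis .
  qed
  then show ?thesis by (subst le_measure) (auto simp: rotated_measure_def)
qed

text \<open>The function \<open>w \<mapsto> \<integral>|peak n w|\<^sup>2 d\<mu>\<close> changes at most by the factor \<open>K\<^sup>2\<close> along the only orbit of the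
unitary group, so it is comparable with its average over the sphere.  By Fubini that average is the
mass of the kernel times the mass of \<open>\<mu>\<close>, and the mass of the kernel is the same integral for surface
measure.\<close>

lemma comparable_surface_measure:
  assumes K: "0 \<le> K" and pos: "0 < measure \<mu> (space \<mu>)"
    and bound: "\<And>u p. unitary_matrix (u :: complex^'d^'d) \<Longrightarrow> p \<in> polynomial_functions \<Longrightarrow>
      l2norm \<mu> (\<lambda>z. p (u *v z)) \<le> K * l2norm \<mu> p"
  shows "\<mu> \<le> scale_measure (ennreal (K\<^sup>2 * measure \<mu> (space \<mu>))) \<sigma>"
    and "\<sigma> \<le> scale_measure (ennreal (K\<^sup>2 / measure \<mu> (space \<mu>))) \<mu>"
proof -
  define m where "m n w = (LINT z|\<mu>. (cmod (peak n w z))\<^sup>2)" for n w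
  let ?M = "peak_mass TYPE('d)"
  have orbit: "m n w' \<le> K\<^sup>2 * m n w" if w: "norm w = 1" "norm w' = 1" for n w w'
  proof -
    obtain v where v: "unitary_matrix v" "v *v w = w'" using unitary_transitive[OF w] by blast
    have "m n w' = (l2norm \<mu> (\<lambda>z. peak n w (adjoint_matrix v *v z)))\<^sup>2"
      by (simp add: m_def l2norm_square peak_unitary v(2))
    also have "\<dots> \<le> (K * l2norm \<mu> (peak n w))\<^sup>2"
      by (intro power_mono bound polynomial_peak unitary_adjoint v(1)) simp
    finally show ?thesis by (simp add: m_def power_mult_distrib l2norm_square)
  qed
  have avg: "(LINT w|\<sigma>. m n w) = ?M n * measure \<mu> (space \<mu>)" and mi: "integrable \<sigma> (m n)" for n
  proof -
    have one: "continuous_on UNIV (\<lambda>_ :: complex^'d. 1 :: real)" by simp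
    have "(LINT w|\<sigma>. m n w) = (LINT z|\<mu>. LINT w|\<sigma>. (cmod (peak n w z))\<^sup>2)"
      using peak_fubini(1)[OF one, of n] by (simp add: m_def)
    also have "\<dots> = (LINT z|\<mu>. ?M n)"
      by (rule Bochner_Integration.integral_cong) (simp_all add: in_space_iff peak_mass_eq)
    finally show "(LINT w|\<sigma>. m n w) = ?M n * measure \<mu> (space \<mu>)" by (simp add: mult.commute)
    show "integrable \<sigma> (m n)" using peak_fubini(3)[OF one, of n] by (simp add: m_def[abs_def])
  qed
  have M: "(LINT z|\<sigma>. (cmod (peak n w z))\<^sup>2) = ?M n" if "norm w = 1" for n and w :: "complex^'d"
    using peak_mass_eq[OF that, of n] by (simp add: norm_peak_commute)
  have upper: "m n w \<le> (K\<^sup>2 * measure \<mu> (space \<mu>)) * ?M n" if w: "norm w = 1" for n w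
  proof -
    have "(LINT w'|(\<sigma> :: (complex^'d) measure). m n w) \<le> (LINT w'|\<sigma>. K\<^sup>2 * m n w')"
      by (rule integral_mono) (auto simp: mi surface.in_space_iff intro: orbit w)
    then show ?thesis by (simp add: surface.prob_space avg mult_ac)
  qed
  have lower: "?M n * measure \<mu> (space \<mu>) \<le> K\<^sup>2 * m n w" if w: "norm w = 1" for n w
  proof -
    have "(LINT w'|\<sigma>. m n w') \<le> (LINT w'|(\<sigma> :: (complex^'d) measure). K\<^sup>2 * m n w)"
      by (rule integral_mono) (auto simp: mi surface.in_space_iff intro: orbit w)
    then show ?thesis by (simp add: surface.prob_space avg)
  qed
  show "\<mu> \<le> scale_measure (ennreal (K\<^sup>2 * measure \<mu> (space \<mu>))) \<sigma>"
    by (rule measure_le_of_peak_le[OF sphere_measure_axioms surface.sphere_measure_axioms])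
       (use upper in \<open>simp_all add: m_def M\<close>)
  show "\<sigma> \<le> scale_measure (ennreal (K\<^sup>2 / measure \<mu> (space \<mu>))) \<mu>"
    by (rule measure_le_of_peak_le[OF surface.sphere_measure_axioms sphere_measure_axioms])
       (use lower pos in \<open>simp_all add: m_def M field_simps\<close>)
qed

end

lemma scale_measure_mono:
  assumes "N \<le> scale_measure (ennreal a) M" "sets N = sets M" "a \<le> b"
  shows "N \<le> scale_measure (ennreal b) M"
proof -
  have "emeasure N A \<le> ennreal b * emeasure M A" for A
  proof -
    have "emeasure N A \<le> ennreal a * emeasure M A"
      using le_measureD3[OF assms(1)] assms(2) by (simp add: le_fun_def)
    also have "\<dots> \<le> ennreal b * emeasure M A" using assms(3) by (intro mult_right_mono ennreal_leI) auto
    finally show ?thesis .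
  qed
  then show ?thesis using assms(2) by (subst le_measure) auto
qed

theorem theorem4p2:
  fixes \<mu> :: "(complex^'d) measure"
  assumes "finite_measure \<mu>"
    and "sets \<mu> = sets sphere_borel"
    and "reinhardt \<mu>"
    and "\<And>\<alpha>. cnorm (L2_space \<mu>) (ae_class \<mu> (cmonomial \<alpha>)) > 0"
    and "\<And>j. bounded_operator (hardy_space \<mu>) (hardy_space \<mu>) (coord_mult \<mu> j)"
  shows
    "(weakly_unitarily_homogeneous (hardy_space \<mu>) (coord_mult \<mu>) \<longleftrightarrow>
        (\<exists>k K :: real. 0 < k \<and> 0 < K \<and>
          (\<forall>u. unitary_matrix u \<longrightarrow>
             absolutely_continuous \<mu> (rotated_measure u \<mu>) \<and>
             (AE z in \<mu>. ennreal k \<le> RN_deriv \<mu> (rotated_measure u \<mu>) z \<and>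
                          RN_deriv \<mu> (rotated_measure u \<mu>) z \<le> ennreal K))))
     \<and>
     (weakly_unitarily_homogeneous (hardy_space \<mu>) (coord_mult \<mu>) \<longleftrightarrow>
        similar_tuples (hardy_space \<mu>) (coord_mult \<mu>)
          (hardy_space surface_measure) (coord_mult surface_measure))"
    (is "(?hom \<longleftrightarrow> ?RN) \<and> (?hom \<longleftrightarrow> ?sim)")
proof -
  interpret finite_measure \<mu> by fact
  interpret sphere_measure \<mu> by unfold_locales fact
  have sr: "sets (rotated_measure u \<mu>) = sets \<mu>" for u by (simp add: rotated_measure_def)
  have pos: "0 < measure \<mu> (space \<mu>)"
  proof -
    have "cmonomial (\<lambda>_. 0) = (\<lambda>_ :: complex^'d. 1)" by (simp add: cmonomial_def fun_eq_iff)
    then show ?thesis using assms(4)[of "\<lambda>_. 0"] by (simp add: cnorm_L2 l2norm_def)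
  qed
  have uniform: "\<exists>K\<ge>0. \<forall>u :: complex^'d^'d. unitary_matrix u \<longrightarrow> (\<forall>p\<in>polynomial_functions.
      l2norm \<mu> (\<lambda>z. p (u *v z)) \<le> K * l2norm \<mu> p)" if ?hom
    by (rule uniform_composition_bound[OF composition_bound_of_homogeneous[OF assms(3) pos that]])
  have "?RN" if hom: ?hom
  proof -
    obtain K where K: "0 \<le> K" and b: "\<forall>u :: complex^'d^'d. unitary_matrix u \<longrightarrow> (\<forall>p\<in>polynomial_functions.
      l2norm \<mu> (\<lambda>z. p (u *v z)) \<le> K * l2norm \<mu> p)"
      using uniform[OF hom] by blast
    define L where "L = K\<^sup>2 + 1"
    have L: "0 < L" by (simp add: L_def add_nonneg_pos)
    have le: "rotated_measure u \<mu> \<le> scale_measure (ennreal L) \<mu>" if u: "unitary_matrix u" for u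
      by (rule scale_measure_mono[OF rotated_le_of_composition_bound[OF K u] sr]) (use b u in \<open>auto simp: L_def\<close>)
    have "absolutely_continuous \<mu> (rotated_measure u \<mu>) \<and>
        (AE z in \<mu>. ennreal (1 / L) \<le> RN_deriv \<mu> (rotated_measure u \<mu>) z \<and>
          RN_deriv \<mu> (rotated_measure u \<mu>) z \<le> ennreal L)" if u: "unitary_matrix u" for u
      using RN_bounds[OF sr L le[OF u] le_rotated[OF u le[OF unitary_adjoint[OF u]]]] by auto
    then show ?RN using L by (intro exI[of _ "1 / L"] exI[of _ L]) simp
  qed
  moreover have ?hom if RN: ?RN
  proof -
    obtain k K where K: "0 < K" and RN: "\<And>u. unitary_matrix u \<Longrightarrow> absolutely_continuous \<mu> (rotated_measure u \<mu>) \<and>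
        (AE z in \<mu>. ennreal k \<le> RN_deriv \<mu> (rotated_measure u \<mu>) z \<and>
          RN_deriv \<mu> (rotated_measure u \<mu>) z \<le> ennreal K)"
      using RN by blast
    show ?hom
      by (rule weakly_homogeneous_if_dominated[of K])
         (use K RN in \<open>auto intro!: scale_measure_of_RN_le sr\<close>)
  qed
  moreover have ?sim if hom: ?hom
  proof -
    obtain K where K: "0 \<le> K" and b: "\<forall>u :: complex^'d^'d. unitary_matrix u \<longrightarrow> (\<forall>p\<in>polynomial_functions.
      l2norm \<mu> (\<lambda>z. p (u *v z)) \<le> K * l2norm \<mu> p)"
      using uniform[OF hom] by blast
    have cmp: "\<mu> \<le> scale_measure (ennreal (K\<^sup>2 * measure \<mu> (space \<mu>))) \<sigma>"
      "\<sigma> \<le> scale_measure (ennreal (K\<^sup>2 / measure \<mu> (space \<mu>))) \<mu>"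
      by (rule comparable_surface_measure[OF K pos]; use b in blast)+
    define L where "L = max (K\<^sup>2 * measure \<mu> (space \<mu>)) (K\<^sup>2 / measure \<mu> (space \<mu>))"
    have s: "sets \<mu> = sets \<sigma>" by (simp add: sets_sphere surface.sets_sphere)
    have "\<mu> \<le> scale_measure (ennreal L) \<sigma>" "\<sigma> \<le> scale_measure (ennreal L) \<mu>"
      by (rule scale_measure_mono[OF cmp(1) s] scale_measure_mono[OF cmp(2) s[symmetric]]; simp add: L_def)+
    moreover have "0 \<le> L" by (simp add: L_def le_max_iff_disj)
    ultimately show ?sim
      by (intro similar_if_comparable[OF sphere_measure_axioms surface.sphere_measure_axioms])
  qed
  moreover have ?hom if ?sim
  proof (rule weakly_homogeneous_similar[OF sphere_measure_axioms surface.sphere_measure_axioms that])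
    show "weakly_unitarily_homogeneous (hardy_space \<sigma>) (coord_mult (\<sigma> :: (complex^'d) measure))"
      by (rule surface.weakly_homogeneous_if_dominated[of 1]) (simp_all add: rotated_surface_measure)
  qed
  ultimately show ?thesis by blast
qed

end
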